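(* Let $H$ be a real separable Hilbert space, let $X,X_1,X_2,\ldots$ be i.i.d. $H$-valued random vectors with $E(X)=0$ such that for every $f\in H^*$ there is $t_f>0$ with $E(\|X\|^3e^{t|f(X)|})<\infty$ for $0<|t|<t_f$, and set $S_n=\sum_{j=1}^nX_j$. Let $\gamma$ be the centered Gaussian measure on $H$ which is the weak limit of $\mathcal{L}(S_n/n^{1/2})$. Let $\{b_n\}$ be positive constants with $b_n/n^{1/2}\to\infty$ and $b_n/n^{2/3}\to0$. Let $D\subset H$ be open and convex with $D\cap H_\gamma\ne\emptyset$ and $0\notin\overline D$, and let $a_0$ be the unique dominating point for $(D,\gamma)$. If, for some $\beta>0$, $D$ contains slices whose diameters near $a_0$ dominate the function $\tau(s)=\beta s^{1/2}$, then $$\liminf_{n\to\infty}n^{-1/2}b_n\,P(S_n/b_n\in D)\exp\{n^{-1}b_n^2\lambda_\gamma(a_0)\}>0.$$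
   Context: Notation (with $B=H$): $\hat\gamma(f)=\int_B e^{f(x)}\,d\gamma(x)$ for $f\in B^*$. For the centered Gaussian measure $\gamma$, $H_\gamma\subset B$ is the Hilbert space generating $\gamma$: the completion of $S(B^* )$, where $Sf=\int_B xf(x)\,d\gamma(x)$ (Bochner integral), under the inner product $\langle Sf,Sg\rangle_\gamma=\int_B fg\,d\gamma$. The rate function is $\lambda_\gamma(x)=\sup_{f\in B^*}[f(x)-\log\hat\gamma(f)]$, which equals $\|x\|_\gamma^2/2$ for $x\in H_\gamma$ and $+\infty$ otherwise. Dominating point (known facts): for open convex $D$ with $D\cap H_\gamma\ne\emptyset$ and $0\notin\overline D$, there is a unique point $a_0\in\partial D$ (the dominating point for $(D,\gamma)$) such that (i) $\lambda_\gamma(a_0)=\inf_{x\in D}\lambda_\gamma(x)=\inf_{x\in\overline D}\lambda_\gamma(x)<\infty$, and for some $g\in B^*$: (ii) $D\subset\{x:g(x)\ge g(a_0)\}$; (iii) $\lambda_\gamma(a_0)=g(a_0)-\log\hat\gamma(g)$; (iv) $a_0=\int_B x\exp\{g(x)-\log\hat\gamma(g)\}\,d\gamma(x)$ (Bochner integral). Slices: $D$ contains slices whose diameters near $a_0$ dominate the function $\tau(s)$ if for some $f\in B^*$ satisfying $$\sup_{\{z:\lambda_\gamma(z)\le\lambda_\gamma(a_0)\}}f(z)=f(a_0)<f(x)\quad\forall x\in D$$ there exist $x_0\in B$ and $\delta>0$ such that $f(x_0)>0$ and $$\{y+sx_0: f(y)=0,\ \|y\|\le\tau(s),\ 0<s\le\delta\}\subset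 D-a_0.$$ *)

theory Defs
  imports "HOL-Probability.Probability"
begin

text \<open>The topological dual of \<open>'b\<close> is the type \<open>'b \<Rightarrow>\<^sub>L real\<close> of bounded linear functionals.\<close>

definition centered_gaussian :: "'b::real_normed_vector measure \<Rightarrow> bool" where
  "centered_gaussian \<gamma> \<longleftrightarrow>
     prob_space \<gamma> \<and> sets \<gamma> = sets borel \<and>
     (\<forall>f :: 'b \<Rightarrow>\<^sub>L real.
        (AE x in \<gamma>. blinfun_apply f x = 0) \<or>
        (\<exists>\<sigma>>0. distributed \<gamma> lborel (blinfun_apply f) (normal_density 0 \<sigma>)))"

text \<open>The library's \<open>weak_conv_m\<close> covers only measures on the real line.\<close>

definition weakly_converges :: "(nat \<Rightarrow> 'b::topological_space measure) \<Rightarrow> 'b measure \<Rightarrow> bool" where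
  "weakly_converges \<mu> \<nu> \<longleftrightarrow>
     (\<forall>h :: 'b \<Rightarrow> real. continuous_on UNIV h \<longrightarrow> bounded (range h) \<longrightarrow>
        (\<lambda>n. \<integral>x. h x \<partial>\<mu> n) \<longlonglongrightarrow> (\<integral>x. h x \<partial>\<nu>))"

definition laplace :: "'b::real_normed_vector measure \<Rightarrow> ('b \<Rightarrow>\<^sub>L real) \<Rightarrow> real" where
  "laplace \<gamma> f = (\<integral>x. exp (blinfun_apply f x) \<partial>\<gamma>)"

definition cov_map ::
  "'b::{banach, second_countable_topology} measure \<Rightarrow> ('b \<Rightarrow>\<^sub>L real) \<Rightarrow> 'b" where
  "cov_map \<gamma> f = (\<integral>x. blinfun_apply f x *\<^sub>R x \<partial>\<gamma>)"

text \<open>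
  The Hilbert space generating \<open>\<gamma>\<close>, as a subset of \<open>'b\<close>. On the range of \<open>cov_map \<gamma>\<close> the inner
  product of \<open>cov_map \<gamma> f\<close> and \<open>cov_map \<gamma> g\<close> is \<open>\<integral>x. f x * g x \<partial>\<gamma>\<close>, so the squared distance of
  these two points is \<open>\<integral>x. (f x - g x)\<^sup>2 \<partial>\<gamma>\<close>. Since the resulting norm dominates a multiple of the
  norm of \<open>'b\<close>, the elements of the completion are identified with the limits in \<open>'b\<close> of the
  sequences in that range that are Cauchy for this distance.
\<close>

definition generating_space :: "'b::{banach, second_countable_topology} measure \<Rightarrow> 'b set" where
  "generating_space \<gamma> =
     {x. \<exists>F :: nat \<Rightarrow> ('b \<Rightarrow>\<^sub>L real).
        (\<forall>e>0. \<exists>N. \<forall>m\<ge>N. \<forall>n\<ge>N.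
           sqrt (\<integral>y. (blinfun_apply (F m) y - blinfun_apply (F n) y)\<^sup>2 \<partial>\<gamma>) < e) \<and>
        (\<lambda>n. cov_map \<gamma> (F n)) \<longlonglongrightarrow> x}"

definition rate :: "'b::real_normed_vector measure \<Rightarrow> 'b \<Rightarrow> ereal" where
  "rate \<gamma> x = (SUP f :: 'b \<Rightarrow>\<^sub>L real. ereal (blinfun_apply f x - ln (laplace \<gamma> f)))"

text \<open>
  The point \<open>a\<close> is nonzero whenever \<open>0 \<notin> closure D\<close>, so the last equation cannot hold through
  the convention that the Bochner integral of a non-integrable function is 0.
\<close>

definition dominating_point ::
  "'b::{banach, second_countable_topology} measure \<Rightarrow> 'b set \<Rightarrow> 'b \<Rightarrow> bool" where
  "dominating_point \<gamma> D a \<longleftrightarrow>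
     a \<in> frontier D \<and>
     rate \<gamma> a = (INF x\<in>D. rate \<gamma> x) \<and>
     rate \<gamma> a = (INF x\<in>closure D. rate \<gamma> x) \<and>
     rate \<gamma> a < \<infinity> \<and>
     (\<exists>g :: 'b \<Rightarrow>\<^sub>L real.
        D \<subseteq> {x. blinfun_apply g x \<ge> blinfun_apply g a} \<and>
        rate \<gamma> a = ereal (blinfun_apply g a - ln (laplace \<gamma> g)) \<and>
        a = (\<integral>x. exp (blinfun_apply g x - ln (laplace \<gamma> g)) *\<^sub>R x \<partial>\<gamma>))"

definition slices_dominate ::
  "'b::real_normed_vector measure \<Rightarrow> 'b set \<Rightarrow> 'b \<Rightarrow> (real \<Rightarrow> real) \<Rightarrow> bool" where
  "slices_dominate \<gamma> D a \<tau> \<longleftrightarrow>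
     (\<exists>f :: 'b \<Rightarrow>\<^sub>L real.
        (SUP z\<in>{z. rate \<gamma> z \<le> rate \<gamma> a}. ereal (blinfun_apply f z)) = ereal (blinfun_apply f a) \<and>
        (\<forall>x\<in>D. blinfun_apply f a < blinfun_apply f x) \<and>
        (\<exists>x0. \<exists>\<delta>>0. blinfun_apply f x0 > 0 \<and>
           {y + s *\<^sub>R x0 | y s. blinfun_apply f y = 0 \<and> norm y \<le> \<tau> s \<and> 0 < s \<and> s \<le> \<delta>}
             \<subseteq> (\<lambda>d. d - a) ` D))"

end

theory Submission
  imports Defs
begin

text \<open>
  The slice condition forces the dominating point to be \<open>a0 = E (h (X) X)\<close> with \<open>h\<close> a multiple of
  the slicing functional and \<open>rate \<gamma> a0 = E (h (X)\<^sup>2) / 2\<close>. Tilting the law of the summands by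
  \<open>exp (t h)\<close> with \<open>t = b n / n\<close> moves the mean of \<open>S n\<close> to \<open>b n a0\<close> up to \<open>o (sqrt n)\<close>, at a cost
  that matches \<open>exp (- (b n)\<^sup>2 / n * rate \<gamma> a0)\<close> because \<open>(b n)\<^sup>3 / n\<^sup>2\<close> tends to \<open>0\<close>.

  Put \<open>L = n / b n\<close>, which is small against \<open>sqrt n\<close>. Under the tilted law, \<open>S n / b n\<close> lies in the
  slices as soon as \<open>h (S n - b n a0)\<close> falls into a window \<open>[A L, A' L]\<close>, where the remaining
  exponential factor is bounded below, and \<open>norm (S n - b n a0) \<le> R sqrt n\<close>, where \<open>R\<close> may grow
  like \<open>sqrt A\<close>. A local limit estimate, obtained by testing against Gaussian kernels and comparing
  characteristic functions, gives the window a probability of order \<open>L / sqrt n = sqrt n / b n\<close>,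
  uniformly in its position. Splitting the sum into two halves shows that the tail event costs a
  factor \<open>1 / R\<^sup>2\<close> on top of that order, so it can be discarded for large \<open>A\<close>.
\<close>

section \<open>Gaussian smoothing and Fourier inversion\<close>

text \<open>No smoothness of the law is assumed, so the characteristic function of a sum is
  controlled only up to a fixed frequency \<open>\<epsilon>\<close>; beyond it the modulus may be 1,
  as for lattice variables. Kernels of width \<open>L\<close> make this harmless: after rescaling by
  \<open>L\<close>, the far frequencies weigh at most \<open>1 / (\<epsilon> * L)^2\<close> by
  Chebyshev. This is \<open>O (L / n)\<close>, below the main order \<open>L / sqrt n\<close>,
  because \<open>b n <= n^(2/3)\<close> means \<open>n <= L^3\<close>. The growth condition on
  \<open>b n\<close> thus serves twice, for the window and for the cubic cost of tilting.

  The tilt changes with \<open>n\<close>, so the constants of the local estimate may depend only on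
  a lower bound for the variance along \<open>h\<close> and an upper bound for third moments. The
  order of choice matters too: \<open>R\<close> is fixed without reference to the height
  \<open>A\<close> of the window, and only then is \<open>A\<close> taken so large that a slice at
  height \<open>s\<close> of order \<open>A * n / (b n)^2\<close> has radius
  \<open>\<beta> * sqrt s\<close> above the size \<open>R * sqrt n / b n\<close> of the
  fluctuations. The exponent 1/2 in the slice condition makes these scales agree.\<close>

lemma gaussian_fourier:
  fixes a q :: real
  assumes "q \<ge> 0"
  shows "(CLINT u|std_normal_distribution. iexp (a * u) * exp (- q * u\<^sup>2 / 2))
     = complex_of_real (exp (- a\<^sup>2 / (2 * (1 + q))) / sqrt (1 + q))"
proof -
  \<comment> \<open>This scaling merges \<open>exp (- q * u^2 / 2)\<close> with the normal density
    into a standard normal density, so only the characteristic function at \<open>a * c\<close>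
    remains.\<close>
  define c where "c = 1 / sqrt (1 + q)"
  have c: "c > 0" "c\<^sup>2 * (1 + q) = 1"
    using assms by (auto simp: c_def power_divide)
  have e: "- x\<^sup>2 / 2 = - (c * x)\<^sup>2 / 2 - q * (c * x)\<^sup>2 / 2" for x
  proof -
    have "(c * x)\<^sup>2 * (1 + q) = x\<^sup>2"
      using c(2) by (simp add: power_mult_distrib mult.assoc mult.left_commute)
    then show ?thesis by (simp add: field_simps)
  qed
  have e': "exp (- (c * x)\<^sup>2 / 2) * exp (- q * (c * x)\<^sup>2 / 2) = exp (- x\<^sup>2 / 2)" for x
    unfolding exp_add[symmetric] using e[of x] by simp
  have "(CLINT u|std_normal_distribution. iexp (a * u) * exp (- q * u\<^sup>2 / 2))
    = (CLINT u|lborel. std_normal_density u *\<^sub>R (iexp (a * u) * exp (- q * u\<^sup>2 / 2)))"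
    by (subst integral_density) (auto simp: normal_density_nonneg)
  also have "\<dots> = c *\<^sub>R (CLINT x|lborel. std_normal_density (c * x) *\<^sub>R (iexp (a * (c * x)) * exp (- q * (c * x)\<^sup>2 / 2)))"
    using lborel_integral_real_affine[where c = c and t = 0 and f = "\<lambda>u. std_normal_density u *\<^sub>R (iexp (a * u) * exp (- q * u\<^sup>2 / 2))"] c(1) by simp
  also have "(\<lambda>x. std_normal_density (c * x) *\<^sub>R (iexp (a * (c * x)) * exp (- q * (c * x)\<^sup>2 / 2)))
     = (\<lambda>x. std_normal_density x *\<^sub>R iexp (a * c * x))"
  proof
    fix x
    have "std_normal_density (c * x) * exp (- q * (c * x)\<^sup>2 / 2) = std_normal_density x"
      unfolding std_normal_density_def using e'[of x] by simp
    then have "complex_of_real (std_normal_density (c * x)) * exp (- q * (c * x)\<^sup>2 / 2) = complex_of_real (std_normal_density x)"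
      by (simp only: of_real_mult[symmetric])
    then show "std_normal_density (c * x) *\<^sub>R (iexp (a * (c * x)) * exp (- q * (c * x)\<^sup>2 / 2)) = std_normal_density x *\<^sub>R iexp (a * c * x)"
      unfolding scaleR_conv_of_real by (simp only: mult.assoc[symmetric] mult.commute[of "iexp (a * (c * x))"] mult.commute[of _ "iexp (a * (c * x))"]) (simp add: mult_ac)
  qed
  also have "(CLINT x|lborel. std_normal_density x *\<^sub>R iexp (a * c * x)) = char std_normal_distribution (a * c)"
    unfolding char_def by (subst integral_density) (auto simp: normal_density_nonneg)
  also have "\<dots> = exp (- (a * c)\<^sup>2 / 2)"
    by (simp add: char_std_normal_distribution)
  also have "(a * c)\<^sup>2 = a\<^sup>2 / (1 + q)"
    using assms by (simp add: c_def power_mult_distrib power_divide)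
  finally show ?thesis
    unfolding scaleR_conv_of_real by (simp add: c_def field_simps)
qed

lemma gaussian_exp_square:
  fixes q :: real
  assumes "q \<ge> 0"
  shows "(LINT u|std_normal_distribution. exp (- q * u\<^sup>2 / 2)) = 1 / sqrt (1 + q)"
proof -
  have "complex_of_real (LINT u|std_normal_distribution. exp (- q * u\<^sup>2 / 2)) = complex_of_real (1 / sqrt (1 + q))"
    using gaussian_fourier[OF assms, of 0] by (simp flip: integral_complex_of_real)
  then show ?thesis unfolding of_real_eq_iff .
qed

lemma gaussian_second_moment:
  "integrable std_normal_distribution (\<lambda>u. u\<^sup>2)" "(LINT u|std_normal_distribution. u\<^sup>2) = 1"
  using integrable_std_normal_distribution_moment[of 2] std_normal_distribution_even_moments[of 1]
  by (auto simp: fact_2)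

text \<open>The Gaussian is its own Fourier transform: the kernel is the characteristic function of
  a standard normal variable, and Fubini swaps the two expectations. Both measures are probabilities
  and the integrand is bounded, so this works for every law.\<close>

lemma (in real_distribution) gaussian_kernel_fourier:
  fixes a L :: real
  shows "complex_of_real (expectation (\<lambda>x. exp (- ((x - a) / L)\<^sup>2 / 2)))
    = (CLINT u|std_normal_distribution. iexp (- (a / L) * u) * char M (u / L))"
proof -
  interpret N: real_distribution std_normal_distribution by (rule real_dist_normal_dist)
  interpret P: pair_prob_space M std_normal_distribution ..
  have int: "integrable (M \<Otimes>\<^sub>M std_normal_distribution) (\<lambda>(x, u). iexp (u * ((x - a) / L)))"
    by (rule P.P.integrable_const_bound[where B = 1]) (auto simp: case_prod_beta)
  have "complex_of_real (exp (- ((x - a) / L)\<^sup>2 / 2)) = (CLINT u|std_normal_distribution. iexp (u * ((x - a) / L)))" for x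
    using fun_cong[OF char_std_normal_distribution, of "(x - a) / L"] by (simp add: char_def mult.commute)
  then have "complex_of_real (expectation (\<lambda>x. exp (- ((x - a) / L)\<^sup>2 / 2)))
    = (CLINT x|M. CLINT u|std_normal_distribution. iexp (u * ((x - a) / L)))"
    by (simp flip: integral_complex_of_real)
  also have "\<dots> = (CLINT u|std_normal_distribution. CLINT x|M. iexp (u * ((x - a) / L)))"
    using P.Fubini_integral[OF int] by simp
  also have "\<dots> = (CLINT u|std_normal_distribution. iexp (- (a / L) * u) * char M (u / L))"
  proof (rule Bochner_Integration.integral_cong[OF refl])
    fix u
    have "iexp (u * ((x - a) / L)) = iexp (- (a / L) * u) * iexp (u / L * x)" for x
      by (simp add: exp_add[symmetric] diff_divide_distrib algebra_simps)
    then show "(CLINT x|M. iexp (u * ((x - a) / L))) = iexp (- (a / L) * u) * char M (u / L)"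
      unfolding char_def by simp
  qed
  finally show ?thesis .
qed

section \<open>Characteristic functions of sums of independent variables\<close>

lemma exp_minus_quadratic_bound:
  fixes y :: real
  assumes "y \<ge> 0"
  shows "\<bar>exp (- y) - (1 - y)\<bar> \<le> y\<^sup>2 / 2"
proof -
  have up: "exp (- y) \<le> 1 - y + y\<^sup>2 / 2"
  proof -

    define g where "g x = 1 - x + x\<^sup>2 / 2 - exp (- x)" for x :: real
    have "g 0 \<le> g y"
    proof (rule DERIV_nonneg_imp_nondecreasing[OF assms])
      fix x :: real
      assume "0 \<le> x"
      show "\<exists>d. (g has_real_derivative d) (at x) \<and> 0 \<le> d"
        unfolding g_def using exp_ge_add_one_self[of "- x"]
        by (intro exI[of _ "-1 + x + exp (- x)"] conjI) (rule derivative_eq_intros refl | simp)+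
    qed
    then show ?thesis by (simp add: g_def)
  qed
  then show ?thesis
    using exp_ge_add_one_self[of "- y"] by auto
qed

lemma square_le_one_plus_cube: "x\<^sup>2 \<le> 1 + \<bar>x\<bar> ^ 3" for x :: real
proof (cases "\<bar>x\<bar> \<le> 1")
  case True
  then have "x\<^sup>2 \<le> 1" by (simp add: abs_square_le_1)
  then show ?thesis by (simp add: add_increasing2)
next
  case False
  then have "\<bar>x\<bar> ^ 2 \<le> \<bar>x\<bar> ^ 3" by (intro power_increasing) auto
  then show ?thesis by simp
qed

lemma exp_card_mult: "exp (- a * real n * b / c) = exp (- a * b / c) ^ n" for a b c :: real
  by (subst exp_of_nat_mult[symmetric]) (simp add: mult_ac)

locale centered_summands = prob_space P for P :: "'b measure" +
  fixes Y :: "'i \<Rightarrow> 'b \<Rightarrow> real" and I :: "'i set" and v K :: real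
  assumes fin: "finite I"
    and indep: "indep_vars (\<lambda>_. borel) Y I"
    and cube: "i \<in> I \<Longrightarrow> integrable P (\<lambda>\<omega>. \<bar>Y i \<omega>\<bar> ^ 3)"
    and mean: "i \<in> I \<Longrightarrow> expectation (Y i) = 0"
    and var: "i \<in> I \<Longrightarrow> expectation (\<lambda>\<omega>. (Y i \<omega>)\<^sup>2) = v"
    and third: "i \<in> I \<Longrightarrow> expectation (\<lambda>\<omega>. \<bar>Y i \<omega>\<bar> ^ 3) \<le> K"
    and K: "K \<ge> 0" and v: "v \<ge> 0" "v \<le> 1 + K"
begin

lemma rv: "i \<in> I \<Longrightarrow> Y i \<in> borel_measurable P"
  using indep by (simp add: indep_vars_def2)

lemma square_integrable: "i \<in> I \<Longrightarrow> integrable P (\<lambda>\<omega>. (Y i \<omega>)\<^sup>2)"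
  by (rule Bochner_Integration.integrable_bound[where f = "\<lambda>\<omega>. 1 + \<bar>Y i \<omega>\<bar> ^ 3"])
    (auto simp: cube rv square_le_one_plus_cube intro!: AE_I2 borel_measurable_power)

lemma integrable_summand: "i \<in> I \<Longrightarrow> integrable P (Y i)"
  using square_integrable_imp_integrable[OF rv square_integrable] .

lemma char_taylor:
  assumes i: "i \<in> I"
  shows "cmod (char (distr P borel (Y i)) s - of_real (1 - v * s\<^sup>2 / 2)) \<le> K * \<bar>s\<bar> ^ 3 / 6"
proof -
  have "expectation (\<lambda>\<omega>. min (6 * (Y i \<omega>)\<^sup>2) (\<bar>s\<bar> * \<bar>Y i \<omega>\<bar> ^ 3)) \<le> expectation (\<lambda>\<omega>. \<bar>s\<bar> * \<bar>Y i \<omega>\<bar> ^ 3)"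
    using i by (intro integral_mono Bochner_Integration.integrable_min integrable_mult_right cube square_integrable) auto
  also have "\<dots> \<le> \<bar>s\<bar> * K"
    using third[OF i] by (simp add: mult_left_mono)
  finally have "(s\<^sup>2 / 6) * expectation (\<lambda>\<omega>. min (6 * (Y i \<omega>)\<^sup>2) (\<bar>s\<bar> * \<bar>Y i \<omega>\<bar> ^ 3)) \<le> (s\<^sup>2 / 6) * (\<bar>s\<bar> * K)"
    by (rule mult_left_mono) simp
  also have "(s\<^sup>2 / 6) * (\<bar>s\<bar> * K) = K * \<bar>s\<bar> ^ 3 / 6"
    by (simp add: eval_nat_numeral)
  finally have "cmod (char (distr P borel (Y i)) s - (1 - s\<^sup>2 * v / 2)) \<le> K * \<bar>s\<bar> ^ 3 / 6"
    using i mean var by (intro order_trans[OF char_approx3']) (auto simp: rv integrable_summand square_integrable)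
  then show ?thesis
    by (simp add: mult.commute)
qed

text \<open>Both functions agree with \<open>1 - v * s^2 / 2\<close> up to order
  \<open>|s|^3\<close>; for \<open>|s| <= 1\<close> the fourth-order term of the Gaussian is
  absorbed in the cubic one, and \<open>v <= 1 + K\<close> leaves a single constant.\<close>

lemma char_gaussian_approx:
  assumes i: "i \<in> I" and s: "\<bar>s\<bar> \<le> 1"
  shows "cmod (char (distr P borel (Y i)) s - of_real (exp (- v * s\<^sup>2 / 2))) \<le> (1 + K)\<^sup>2 * \<bar>s\<bar> ^ 3"
proof -
  have "\<bar>exp (- (v * s\<^sup>2 / 2)) - (1 - v * s\<^sup>2 / 2)\<bar> \<le> (v * s\<^sup>2 / 2)\<^sup>2 / 2"
    using v by (intro exp_minus_quadratic_bound) auto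
  also have "\<dots> = v\<^sup>2 * \<bar>s\<bar> ^ 4 / 8"
    by (simp add: field_simps power2_eq_square eval_nat_numeral)
  also have "v\<^sup>2 * \<bar>s\<bar> ^ 4 \<le> (1 + K)\<^sup>2 * \<bar>s\<bar> ^ 3"
    using v s by (intro mult_mono power_mono power_decreasing) auto
  finally have "cmod (of_real (1 - v * s\<^sup>2 / 2) - of_real (exp (- v * s\<^sup>2 / 2))) \<le> (1 + K)\<^sup>2 * \<bar>s\<bar> ^ 3 / 8"
    unfolding of_real_diff[symmetric] norm_of_real by (simp add: abs_minus_commute)
  moreover have "K \<le> (1 + K)\<^sup>2"
    using K by (simp add: power2_eq_square algebra_simps)
  then have "K * \<bar>s\<bar> ^ 3 / 6 \<le> (1 + K)\<^sup>2 * \<bar>s\<bar> ^ 3 / 6"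
    by (intro divide_right_mono mult_right_mono) auto
  ultimately have "cmod (char (distr P borel (Y i)) s - of_real (exp (- v * s\<^sup>2 / 2)))
      \<le> (1 + K)\<^sup>2 * \<bar>s\<bar> ^ 3 / 6 + (1 + K)\<^sup>2 * \<bar>s\<bar> ^ 3 / 8"
    using char_taylor[OF i, of s] by (intro norm_diff_triangle_le[OF order_trans]) auto
  also have "\<dots> \<le> (1 + K)\<^sup>2 * \<bar>s\<bar> ^ 3"
    by simp
  finally show ?thesis .
qed

abbreviation sum_char :: "real \<Rightarrow> complex" where
  "sum_char \<equiv> char (distr P borel (\<lambda>\<omega>. \<Sum>i\<in>I. Y i \<omega>))"

lemma sum_rv: "(\<lambda>\<omega>. \<Sum>i\<in>I. Y i \<omega>) \<in> borel_measurable P"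
  by (intro borel_measurable_sum rv)

lemma sum_char_prod: "sum_char s = (\<Prod>i\<in>I. char (distr P borel (Y i)) s)"
  using indep by (rule char_distr_sum)

lemma cmod_char_le_1: "i \<in> I \<Longrightarrow> cmod (char (distr P borel (Y i)) s) \<le> 1"
  by (intro real_distribution.cmod_char_le_1 real_distribution_distr rv)

lemma cmod_sum_char_le_1: "cmod (sum_char s) \<le> 1"
  by (intro real_distribution.cmod_char_le_1 real_distribution_distr sum_rv)

text \<open>Products of numbers in the unit disc differ by at most the sum of the differences of
  their factors. The error \<open>n * |s|^3\<close> is useful at \<open>s = 1 / sqrt n\<close>,
  where the central limit argument evaluates it.\<close>

lemma sum_char_gaussian_approx:
  assumes s: "\<bar>s\<bar> \<le> 1"
  shows "cmod (sum_char s - of_real (exp (- v * real (card I) * s\<^sup>2 / 2))) \<le> real (card I) * ((1 + K)\<^sup>2 * \<bar>s\<bar> ^ 3)"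
proof -
  have "of_real (exp (- v * real (card I) * s\<^sup>2 / 2)) = (\<Prod>i\<in>I. complex_of_real (exp (- v * s\<^sup>2 / 2)))"
    by (simp only: exp_card_mult prod_constant of_real_power)
  then have "cmod (sum_char s - of_real (exp (- v * real (card I) * s\<^sup>2 / 2)))
     \<le> (\<Sum>i\<in>I. cmod (char (distr P borel (Y i)) s - complex_of_real (exp (- v * s\<^sup>2 / 2))))"
    unfolding sum_char_prod using v by (simp del: prod_constant) (intro norm_prod_diff; simp add: cmod_char_le_1)
  also have "\<dots> \<le> (\<Sum>i\<in>I. (1 + K)\<^sup>2 * \<bar>s\<bar> ^ 3)"
    using s by (intro sum_mono char_gaussian_approx) auto
  finally show ?thesis by simp
qed

context
  fixes v0 \<epsilon> :: real
  assumes v0: "0 < v0" "v0 \<le> v"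
  defines "\<epsilon> \<equiv> min 1 v0 / (1 + K)"
begin

text \<open>The last two bounds are what \<open>\<epsilon>\<close> is made for: for
  \<open>|s| <= \<epsilon>\<close> the first keeps \<open>1 - v * s^2 / 2\<close> nonnegative, and
  the second lets the quadratic term absorb the cubic remainder of the Taylor expansion.\<close>

lemma eps: "0 < \<epsilon>" "\<epsilon> \<le> 1" "(1 + K) * \<epsilon>\<^sup>2 \<le> 2" "K * \<epsilon> \<le> v0"
proof -
  show "0 < \<epsilon>" "\<epsilon> \<le> 1" using v0 K by (auto simp: \<epsilon>_def field_simps)
  have "(1 + K) * \<epsilon> \<le> 1" using K by (auto simp: \<epsilon>_def)
  then have "(1 + K) * \<epsilon> * \<epsilon> \<le> 1 * 1"
    using \<open>0 < \<epsilon>\<close> \<open>\<epsilon> \<le> 1\<close> K by (intro mult_mono) auto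
  then show "(1 + K) * \<epsilon>\<^sup>2 \<le> 2" by (simp add: power2_eq_square)
  have "K * \<epsilon> \<le> (1 + K) * \<epsilon>" using \<open>0 < \<epsilon>\<close> by simp
  also have "\<dots> \<le> v0" using K by (auto simp: \<epsilon>_def)
  finally show "K * \<epsilon> \<le> v0" .
qed

lemma cmod_char_decay:
  assumes i: "i \<in> I" and s: "\<bar>s\<bar> \<le> \<epsilon>"
  shows "cmod (char (distr P borel (Y i)) s) \<le> exp (- v0 * s\<^sup>2 / 4)"
proof -
  have s2: "s\<^sup>2 \<le> \<epsilon>\<^sup>2" using s by (simp add: abs_le_square_iff[symmetric])
  have "v * s\<^sup>2 \<le> (1 + K) * \<epsilon>\<^sup>2" using v s2 K by (intro mult_mono) auto
  then have pos: "0 \<le> 1 - v * s\<^sup>2 / 2" using eps by simp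
  have "K * \<bar>s\<bar> ^ 3 = (K * \<bar>s\<bar>) * s\<^sup>2" by (simp add: eval_nat_numeral)
  also have "\<dots> \<le> v0 * s\<^sup>2"
    using s eps K by (intro mult_right_mono) (auto intro: order_trans[OF mult_left_mono])
  finally have k: "K * \<bar>s\<bar> ^ 3 \<le> v0 * s\<^sup>2" .
  have "cmod (char (distr P borel (Y i)) s) \<le> cmod (of_real (1 - v * s\<^sup>2 / 2)) + K * \<bar>s\<bar> ^ 3 / 6"
    using char_taylor[OF i, of s] by (smt (verit) norm_triangle_sub)
  also have "\<dots> = 1 - v * s\<^sup>2 / 2 + K * \<bar>s\<bar> ^ 3 / 6"
    using pos unfolding norm_of_real by simp
  also have "\<dots> \<le> 1 + (- v0 * s\<^sup>2 / 4)"
    using k mult_right_mono[OF v0(2), of "s\<^sup>2"] mult_nonneg_nonneg[OF less_imp_le[OF v0(1)], of "s\<^sup>2"] by simp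
  also have "\<dots> \<le> exp (- v0 * s\<^sup>2 / 4)"
    by (rule exp_ge_add_one_self)
  finally show ?thesis .
qed

lemma cmod_sum_char_decay:
  assumes s: "\<bar>s\<bar> \<le> \<epsilon>"
  shows "cmod (sum_char s) \<le> exp (- v0 * real (card I) * s\<^sup>2 / 4)"
proof -
  have "cmod (sum_char s) \<le> (\<Prod>i\<in>I. exp (- v0 * s\<^sup>2 / 4))"
    unfolding sum_char_prod prod_norm[symmetric] using s by (intro prod_mono) (use cmod_char_decay in auto)
  also have "\<dots> = exp (- v0 * real (card I) * s\<^sup>2 / 4)"
    by (simp only: exp_card_mult prod_constant)
  finally show ?thesis .
qed

text \<open>Beyond \<open>\<epsilon>\<close> only the trivial bound 1 is available. Replacing it by
  \<open>s^2 / \<epsilon>^2\<close> gives one formula for all \<open>s\<close>, which can be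
  integrated exactly against the normal law.\<close>

lemma cmod_sum_char_bound:
  "cmod (sum_char s) \<le> exp (- v0 * real (card I) * s\<^sup>2 / 4) + s\<^sup>2 / \<epsilon>\<^sup>2"
proof (cases "\<bar>s\<bar> \<le> \<epsilon>")
  \<comment> \<open>A single formula is checked on each side of \<open>\<epsilon>\<close>; on this
    side the quadratic term is merely added.\<close>
  case True
  then show ?thesis using cmod_sum_char_decay[OF True] by (simp add: add_increasing2)
next
  case False
  then have "\<epsilon>\<^sup>2 \<le> s\<^sup>2" using eps by (simp add: abs_le_square_iff[symmetric])
  then have "1 \<le> s\<^sup>2 / \<epsilon>\<^sup>2" using eps by simp
  then show ?thesis using cmod_sum_char_le_1[of s] by (simp add: add_increasing order_trans)
qed

text \<open>Dividing both products by the common decay factor keeps a Gaussian factor in the error.\<close>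

lemma sum_char_gaussian_approx_decay:
  assumes s: "\<bar>s\<bar> \<le> \<epsilon>"
  shows "cmod (sum_char s - of_real (exp (- v * real (card I) * s\<^sup>2 / 2)))
    \<le> real (card I) * ((1 + K)\<^sup>2 * \<bar>s\<bar> ^ 3) * exp (v0 / 4) * exp (- v0 * real (card I) * s\<^sup>2 / 4)"
proof -
  define \<theta> where "\<theta> = exp (- v0 * s\<^sup>2 / 4)"
  have \<theta>: "\<theta> > 0" by (simp add: \<theta>_def)
  have s1: "\<bar>s\<bar> \<le> 1" using s eps by simp
  have \<theta>n: "\<theta> ^ card I = exp (- v0 * real (card I) * s\<^sup>2 / 4)"
    by (simp only: exp_card_mult \<theta>_def)
  define z where "z i = char (distr P borel (Y i)) s / of_real \<theta>" for i
  define w where "w = complex_of_real (exp (- v * s\<^sup>2 / 2)) / of_real \<theta>"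
  have zs: "sum_char s = of_real (\<theta> ^ card I) * (\<Prod>i\<in>I. z i)"
  proof -
    have "sum_char s = (\<Prod>i\<in>I. of_real \<theta> * z i)"
      using \<theta> by (simp add: sum_char_prod z_def)
    then show ?thesis by (simp only: prod.distrib prod_constant of_real_power)
  qed
  have ws: "of_real (exp (- v * real (card I) * s\<^sup>2 / 2)) = of_real (\<theta> ^ card I) * (\<Prod>i\<in>I. w)"
  proof -
    have "of_real (exp (- v * real (card I) * s\<^sup>2 / 2)) = complex_of_real (exp (- v * s\<^sup>2 / 2)) ^ card I"
      by (simp only: exp_card_mult of_real_power)
    also have "complex_of_real (exp (- v * s\<^sup>2 / 2)) = of_real \<theta> * w"
      using \<theta> by (simp add: w_def)
    finally show ?thesis by (simp only: power_mult_distrib prod_constant of_real_power)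
  qed
  have z1: "cmod (z i) \<le> 1" if "i \<in> I" for i
    using cmod_char_decay[OF that s] \<theta> by (simp add: z_def norm_divide \<theta>_def)
  have "exp (- v * s\<^sup>2 / 2) \<le> \<theta>"
    unfolding \<theta>_def using mult_right_mono[OF v0(2), of "s\<^sup>2"] mult_nonneg_nonneg[OF less_imp_le[OF v0(1)], of "s\<^sup>2"]
    by (simp del: mult_le_cancel_right)
  then have w1: "cmod w \<le> 1" using \<theta> by (simp add: w_def norm_divide)
  \<comment> \<open>Each difference \<open>z i - w\<close> carries one factor
    \<open>1 / \<theta>\<close>, which is bounded because \<open>|s| <= 1\<close>.\<close>
  have "exp (- v0 / 4) \<le> \<theta>"
    unfolding \<theta>_def using v0 s1 by (simp add: abs_square_le_1 mult_le_cancel_left1)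
  then have \<theta>i: "1 / \<theta> \<le> exp (v0 / 4)"
    using \<theta> by (simp add: exp_minus field_simps)
  have "cmod (z i - w) \<le> (1 + K)\<^sup>2 * \<bar>s\<bar> ^ 3 * exp (v0 / 4)" if "i \<in> I" for i
  proof -
    have "cmod (z i - w) = cmod (char (distr P borel (Y i)) s - of_real (exp (- v * s\<^sup>2 / 2))) * (1 / \<theta>)"
      unfolding z_def w_def diff_divide_distrib[symmetric] norm_divide norm_of_real using \<theta>
      by (simp only: abs_of_pos times_divide_eq_right mult_1_right)
    also have "\<dots> \<le> ((1 + K)\<^sup>2 * \<bar>s\<bar> ^ 3) * exp (v0 / 4)"
      using \<theta> \<theta>i char_gaussian_approx[OF that s1] by (intro mult_mono) auto
    finally show ?thesis .
  qed
  then have "cmod ((\<Prod>i\<in>I. z i) - (\<Prod>i\<in>I. w)) \<le> (\<Sum>i\<in>I. (1 + K)\<^sup>2 * \<bar>s\<bar> ^ 3 * exp (v0 / 4))"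
    using z1 w1 by (intro order_trans[OF norm_prod_diff] sum_mono) auto
  then have "\<theta> ^ card I * cmod ((\<Prod>i\<in>I. z i) - (\<Prod>i\<in>I. w))
     \<le> \<theta> ^ card I * (real (card I) * ((1 + K)\<^sup>2 * \<bar>s\<bar> ^ 3 * exp (v0 / 4)))"
    using \<theta> by (intro mult_left_mono) auto
  moreover have "cmod (sum_char s - of_real (exp (- v * real (card I) * s\<^sup>2 / 2))) = \<theta> ^ card I * cmod ((\<Prod>i\<in>I. z i) - (\<Prod>i\<in>I. w))"
    unfolding zs ws right_diff_distrib[symmetric] norm_mult norm_of_real using \<theta> by (simp only: abs_of_pos zero_less_power)
  ultimately show ?thesis unfolding \<theta>n by (simp only: mult_ac)
qed

end

end

section \<open>Local limit estimates for real sums by Gaussian kernels\<close>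

lemma cube_times_gaussian_bounded:
  fixes w c :: real
  assumes "w \<ge> 0" "c > 0"
  shows "w ^ 3 * exp (- c * w\<^sup>2) \<le> 1 + 2 / c\<^sup>2"
proof -
  have "w ^ 3 \<le> 1 + w ^ 4"
  proof (cases "w \<le> 1")
    case True
    then have "w ^ 3 \<le> 1" using assms by (simp add: power_le_one)
    then show ?thesis using assms by (simp add: add_increasing2)
  next
    case False
    then have "w ^ 3 \<le> w ^ 4" by (intro power_increasing) auto
    then show ?thesis by simp
  qed
  moreover have "(c * w\<^sup>2)\<^sup>2 / 2 \<le> exp (c * w\<^sup>2)"
    using exp_lower_Taylor_quadratic[of "c * w\<^sup>2"] assms by (smt (verit) mult_nonneg_nonneg zero_le_power2)
  then have "w ^ 4 \<le> 2 / c\<^sup>2 * exp (c * w\<^sup>2)"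
    using assms by (simp add: field_simps power_mult_distrib)
  moreover have "1 \<le> exp (c * w\<^sup>2)" using assms by simp
  ultimately have "w ^ 3 \<le> (1 + 2 / c\<^sup>2) * exp (c * w\<^sup>2)"
    unfolding distrib_right by linarith
  then have "w ^ 3 * exp (- (c * w\<^sup>2)) \<le> (1 + 2 / c\<^sup>2) * exp (c * w\<^sup>2) * exp (- (c * w\<^sup>2))"
    by (rule mult_right_mono) simp
  then show ?thesis
    by (simp add: mult.assoc exp_add[symmetric])
qed

lemma norm_integral_le:
  fixes f :: "'b \<Rightarrow> 'c::{banach, second_countable_topology}"
  assumes "integrable M f" "integrable M g" "\<And>x. norm (f x) \<le> g x"
  shows "norm (integral\<^sup>L M f) \<le> integral\<^sup>L M g"
  using assms by (intro order_trans[OF integral_norm_bound] integral_mono integrable_norm) auto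

context centered_summands
begin

lemma kernel_fourier:
  "complex_of_real (expectation (\<lambda>\<omega>. exp (- (((\<Sum>i\<in>I. Y i \<omega>) - a) / L)\<^sup>2 / 2)))
    = (CLINT u|std_normal_distribution. iexp (- (a / L) * u) * sum_char (u / L))"
proof -
  interpret D: real_distribution "distr P borel (\<lambda>\<omega>. \<Sum>i\<in>I. Y i \<omega>)"
    using sum_rv by (rule real_distribution_distr)
  show ?thesis
    using D.gaussian_kernel_fourier[of a L] by (subst (asm) integral_distr[OF sum_rv]) auto
qed

lemma sum_char_measurable: "sum_char \<in> borel_measurable borel"
  by (intro real_distribution.char_measurable real_distribution_distr sum_rv)

text \<open>Taking the modulus under the Fourier integral removes \<open>a\<close>, so the bound is
  uniform in the position. With \<open>s = u / L\<close> the decay becomes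
  \<open>exp (- q * u^2 / 2)\<close>, which integrates to less than \<open>1 / sqrt q\<close>, a
  multiple of \<open>L / sqrt n\<close>; the far frequencies give
  \<open>1 / (\<epsilon> * L)^2\<close>, of no larger order once
  \<open>sqrt n <= L^3\<close>.\<close>

lemma kernel_expectation_upper:
  assumes v0: "0 < v0" "v0 \<le> v" and I: "card I \<ge> 1" and L: "L > 0" "sqrt (card I) \<le> L ^ 3"
  shows "expectation (\<lambda>\<omega>. exp (- (((\<Sum>i\<in>I. Y i \<omega>) - a) / L)\<^sup>2 / 2))
    \<le> (sqrt 2 / sqrt v0 + 1 / (min 1 v0 / (1 + K))\<^sup>2) * (L / sqrt (card I))"
proof -
  interpret N: real_distribution std_normal_distribution by (rule real_dist_normal_dist)
  define n where "n = real (card I)"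
  have n: "n \<ge> 1" using I by (simp add: n_def)
  define \<epsilon> where "\<epsilon> = min 1 v0 / (1 + K)"
  have \<epsilon>: "\<epsilon> > 0" using v0 K by (simp add: \<epsilon>_def)
  define q where "q = v0 * n / (2 * L\<^sup>2)"
  have q: "q > 0" using v0 n L by (simp add: q_def)
  have [measurable]: "sum_char \<in> borel_measurable borel" by (rule sum_char_measurable)
  have int: "integrable std_normal_distribution (\<lambda>u. exp (- q * u\<^sup>2 / 2) + (1 / (\<epsilon>\<^sup>2 * L\<^sup>2)) * u\<^sup>2)"
    using q by (intro Bochner_Integration.integrable_add integrable_mult_right gaussian_second_moment(1)
        N.integrable_const_bound[where B = 1]) auto
  have "expectation (\<lambda>\<omega>. exp (- (((\<Sum>i\<in>I. Y i \<omega>) - a) / L)\<^sup>2 / 2))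
     \<le> cmod (CLINT u|std_normal_distribution. iexp (- (a / L) * u) * sum_char (u / L))"
    unfolding kernel_fourier[symmetric] norm_of_real by simp
  also have "\<dots> \<le> (LINT u|std_normal_distribution. exp (- q * u\<^sup>2 / 2) + (1 / (\<epsilon>\<^sup>2 * L\<^sup>2)) * u\<^sup>2)"
  proof (rule norm_integral_le[OF _ int])
    show "integrable std_normal_distribution (\<lambda>u. iexp (- (a / L) * u) * sum_char (u / L))"
      by (intro N.integrable_const_bound[where B = 1]) (auto simp: norm_mult cmod_sum_char_le_1)
    fix u
    have "cmod (sum_char (u / L)) \<le> exp (- v0 * n * (u / L)\<^sup>2 / 4) + (u / L)\<^sup>2 / \<epsilon>\<^sup>2"
      unfolding n_def \<epsilon>_def by (rule cmod_sum_char_bound[OF v0])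
    also have "\<dots> = exp (- q * u\<^sup>2 / 2) + (1 / (\<epsilon>\<^sup>2 * L\<^sup>2)) * u\<^sup>2"
      by (simp add: q_def power_divide mult.commute)
    finally show "cmod (iexp (- (a / L) * u) * sum_char (u / L)) \<le> exp (- q * u\<^sup>2 / 2) + (1 / (\<epsilon>\<^sup>2 * L\<^sup>2)) * u\<^sup>2"
      by (simp add: norm_mult)
  qed
  also have "\<dots> = 1 / sqrt (1 + q) + 1 / (\<epsilon>\<^sup>2 * L\<^sup>2)"
    using q by (subst Bochner_Integration.integral_add)
      (auto simp: gaussian_exp_square[of q, simplified] gaussian_second_moment intro!: N.integrable_const_bound[where B = 1])
  also have "1 / sqrt (1 + q) \<le> 1 / sqrt q"
    using q by (intro divide_left_mono) auto
  also have "1 / sqrt q = sqrt 2 / sqrt v0 * (L / sqrt n)"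
    using L by (simp add: q_def real_sqrt_divide real_sqrt_mult)
  also have "1 / (\<epsilon>\<^sup>2 * L\<^sup>2) \<le> 1 / \<epsilon>\<^sup>2 * (L / sqrt n)"
  proof -
    have "1 / L\<^sup>2 \<le> L / sqrt n"
      using L n by (simp add: field_simps n_def eval_nat_numeral)
    then have "1 / \<epsilon>\<^sup>2 * (1 / L\<^sup>2) \<le> 1 / \<epsilon>\<^sup>2 * (L / sqrt n)" by (intro mult_left_mono) auto
    then show ?thesis by simp
  qed
  finally show ?thesis unfolding n_def \<epsilon>_def by (simp only: distrib_right)
qed

text \<open>The comparison is with the value \<open>G\<close> for an exactly Gaussian sum, which has
  order \<open>L / sqrt n\<close> as long as the centre and the width are at most
  \<open>sqrt n\<close>. The error has to be smaller by a factor \<open>1 / sqrt n\<close>: an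
  undamped \<open>n * |s|^3\<close> would integrate only to \<open>n / L^3\<close>, so the estimate
  that retains a Gaussian factor is used, and the far frequencies require
  \<open>n <= L^3\<close>.\<close>

lemma kernel_expectation_lower:
  fixes a L :: real
  assumes v0: "0 < v0" "v0 \<le> v" and I: "card I \<ge> 1"
    and L: "L > 0" "card I \<le> L ^ 3" "L\<^sup>2 \<le> card I" and a: "a\<^sup>2 \<le> card I"
  defines "\<epsilon> \<equiv> min 1 v0 / (1 + K)"
  shows "(exp (- 1 / (2 * v0)) / sqrt (2 + K)
      - ((1 + K)\<^sup>2 * exp (v0 / 4) * (1 + 128 / v0\<^sup>2) * (2 / sqrt v0) + 2 / \<epsilon>\<^sup>2) / sqrt (card I)) * (L / sqrt (card I))
    \<le> expectation (\<lambda>\<omega>. exp (- (((\<Sum>i\<in>I. Y i \<omega>) - a) / L)\<^sup>2 / 2))"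
proof -
  interpret N: real_distribution std_normal_distribution by (rule real_dist_normal_dist)
  define n where "n = real (card I)"
  have n: "n \<ge> 1" using I by (simp add: n_def)
  have Ln: "n \<le> L ^ 3" "L\<^sup>2 \<le> n" and an: "a\<^sup>2 \<le> n" using L a by (auto simp: n_def)
  have \<epsilon>: "\<epsilon> > 0" using v0 K by (simp add: \<epsilon>_def)
  define E where "E = expectation (\<lambda>\<omega>. exp (- (((\<Sum>i\<in>I. Y i \<omega>) - a) / L)\<^sup>2 / 2))"
  define q where "q = v * n / L\<^sup>2"
  define p where "p = v0 * n / (4 * L\<^sup>2)"
  have q: "q > 0" "p > 0" using v0 n L by (simp_all add: q_def p_def)
  define G where "G = exp (- (a / L)\<^sup>2 / (2 * (1 + q))) / sqrt (1 + q)"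
  define B where "B = (1 + K)\<^sup>2 * exp (v0 / 4)"
  have B: "B \<ge> 0" by (simp add: B_def)
  define c where "c = 1 + 128 / v0\<^sup>2"
  have [measurable]: "sum_char \<in> borel_measurable borel" by (rule sum_char_measurable)
  let ?h = "\<lambda>u. iexp (- (a / L) * u) * sum_char (u / L)"
  let ?g = "\<lambda>u. iexp (- (a / L) * u) * complex_of_real (exp (- q * u\<^sup>2 / 2))"
  let ?b = "\<lambda>u. B * c / sqrt n * exp (- p * u\<^sup>2 / 2) + 2 / (\<epsilon>\<^sup>2 * L\<^sup>2) * u\<^sup>2"
  have ih: "integrable std_normal_distribution ?h"
    by (intro N.integrable_const_bound[where B = 1]) (auto simp: norm_mult cmod_sum_char_le_1)
  have ig: "integrable std_normal_distribution ?g"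
    using q by (intro N.integrable_const_bound[where B = 1]) (auto simp: norm_mult)
  have ib: "integrable std_normal_distribution ?b"
    using q by (intro Bochner_Integration.integrable_add integrable_mult_right gaussian_second_moment(1)
        N.integrable_const_bound[where B = 1]) auto
  have pointwise: "cmod (sum_char s - of_real (exp (- v * n * s\<^sup>2 / 2)))
     \<le> B * c / sqrt n * exp (- v0 * n * s\<^sup>2 / 8) + 2 / \<epsilon>\<^sup>2 * s\<^sup>2" for s
  proof (cases "\<bar>s\<bar> \<le> \<epsilon>")
    case True
    define w where "w = sqrt n * \<bar>s\<bar>"
    have w: "w \<ge> 0" "w\<^sup>2 = n * s\<^sup>2" using n by (auto simp: w_def power_mult_distrib)
    have w3: "n * \<bar>s\<bar> ^ 3 = w ^ 3 / sqrt n"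
      using n by (simp add: w_def power3_eq_cube field_simps)
    \<comment> \<open>Half of the decay exponent \<open>v0 / 4\<close> is spent on bounding the
      cube, the other half is kept for the integration; \<open>v0 / 8\<close> here is the origin of
      \<open>128 / v0^2\<close>.\<close>
    have "w ^ 3 * exp (- (v0 / 8) * w\<^sup>2) \<le> c"
      using cube_times_gaussian_bounded[OF w(1), of "v0 / 8"] v0 by (simp add: c_def power_divide)
    then have "w ^ 3 * exp (- (v0 / 8) * w\<^sup>2) * exp (- (v0 / 8) * w\<^sup>2) \<le> c * exp (- (v0 / 8) * w\<^sup>2)"
      by (intro mult_right_mono) auto
    then have w4: "w ^ 3 * exp (- v0 * n * s\<^sup>2 / 4) \<le> c * exp (- v0 * n * s\<^sup>2 / 8)"
      by (simp add: w(2) mult.assoc mult.left_commute[of n v0] exp_add[symmetric])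
    have "cmod (sum_char s - of_real (exp (- v * n * s\<^sup>2 / 2)))
      \<le> n * ((1 + K)\<^sup>2 * \<bar>s\<bar> ^ 3) * exp (v0 / 4) * exp (- v0 * n * s\<^sup>2 / 4)"
      using sum_char_gaussian_approx_decay[OF v0, of s] True unfolding n_def \<epsilon>_def by blast
    also have "\<dots> = B * (n * \<bar>s\<bar> ^ 3) * exp (- v0 * n * s\<^sup>2 / 4)"
      by (simp add: B_def mult_ac)
    also have "\<dots> = B / sqrt n * (w ^ 3 * exp (- v0 * n * s\<^sup>2 / 4))"
      unfolding w3 by simp
    also have "\<dots> \<le> B / sqrt n * (c * exp (- v0 * n * s\<^sup>2 / 8))"
      using B n by (intro mult_left_mono w4) auto
    also have "\<dots> = B * c / sqrt n * exp (- v0 * n * s\<^sup>2 / 8)"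
      by simp
    finally show ?thesis by (rule order_trans) simp
  next
    case False
    then have "\<epsilon>\<^sup>2 \<le> s\<^sup>2" using \<epsilon> by (simp add: abs_le_square_iff[symmetric])
    then have "2 \<le> 2 / \<epsilon>\<^sup>2 * s\<^sup>2" using \<epsilon> by (simp add: field_simps)
    moreover have "cmod (sum_char s - of_real (exp (- v * n * s\<^sup>2 / 2))) \<le> 1 + 1"
      using v n cmod_sum_char_le_1[of s]
      by (intro order_trans[OF norm_triangle_ineq4] add_mono) (simp_all only: norm_of_real, auto)
    moreover have "0 \<le> B * c / sqrt n * exp (- v0 * n * s\<^sup>2 / 8)"
      using B n by (simp add: c_def)
    ultimately show ?thesis by linarith
  qed
  have hE: "(CLINT u|std_normal_distribution. ?h u) = complex_of_real E"
    unfolding E_def by (rule kernel_fourier[symmetric])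
  have gG: "(CLINT u|std_normal_distribution. ?g u) = complex_of_real G"
    using gaussian_fourier[of q "- (a / L)"] q unfolding G_def by (simp only: power2_minus less_imp_le)
  have "cmod (complex_of_real E - complex_of_real G) = cmod (CLINT u|std_normal_distribution. ?h u - ?g u)"
    unfolding hE[symmetric] gG[symmetric] using Bochner_Integration.integral_diff[OF ih ig] by simp
  also have "\<dots> \<le> (LINT u|std_normal_distribution. ?b u)"
  proof (rule norm_integral_le[OF Bochner_Integration.integrable_diff[OF ih ig] ib])
    fix u
    have "cmod (?h u - ?g u) = cmod (sum_char (u / L) - of_real (exp (- v * n * (u / L)\<^sup>2 / 2)))"
      unfolding right_diff_distrib[symmetric] norm_mult by (simp add: q_def power_divide)
    also have "\<dots> \<le> ?b u"
      using pointwise[of "u / L"] by (simp add: p_def power_divide mult.commute)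
    finally show "cmod (?h u - ?g u) \<le> ?b u" .
  qed
  also have "\<dots> = B * c / sqrt n * (1 / sqrt (1 + p)) + 2 / (\<epsilon>\<^sup>2 * L\<^sup>2)"
  proof -
    have "integrable std_normal_distribution (\<lambda>u. exp (- p * u\<^sup>2 / 2))"
      using q by (intro N.integrable_const_bound[where B = 1]) auto
    then show ?thesis
      using q by (subst Bochner_Integration.integral_add)
        (auto simp: gaussian_exp_square[of p, simplified] gaussian_second_moment)
  qed
  also have "\<dots> \<le> B * c / sqrt n * (2 / sqrt v0 * (L / sqrt n)) + 2 / \<epsilon>\<^sup>2 * (1 / sqrt n * (L / sqrt n))"
  proof (rule add_mono)
    have "1 / sqrt (1 + p) \<le> 1 / sqrt p"
      using q by (intro divide_left_mono) auto
    also have "\<dots> = 2 / sqrt v0 * (L / sqrt n)"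
      using L by (simp add: p_def real_sqrt_divide real_sqrt_mult)
    finally show "B * c / sqrt n * (1 / sqrt (1 + p)) \<le> B * c / sqrt n * (2 / sqrt v0 * (L / sqrt n))"
      using B n by (intro mult_left_mono) (auto simp: c_def)
    have "1 / L\<^sup>2 \<le> L / n"
      using L Ln n by (simp add: field_simps eval_nat_numeral)
    then have "2 / \<epsilon>\<^sup>2 * (1 / L\<^sup>2) \<le> 2 / \<epsilon>\<^sup>2 * (L / n)" by (intro mult_left_mono) auto
    then show "2 / (\<epsilon>\<^sup>2 * L\<^sup>2) \<le> 2 / \<epsilon>\<^sup>2 * (1 / sqrt n * (L / sqrt n))" using n by simp
  qed
  also have "\<dots> = (B * c * (2 / sqrt v0) + 2 / \<epsilon>\<^sup>2) / sqrt n * (L / sqrt n)"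
  proof -
    have "X / s * (b * y) + e * (1 / s * y) = (X * b + e) / s * y" for X s b y e :: real
      by (simp add: divide_inverse algebra_simps)
    then show ?thesis .
  qed
  finally have err: "G - (B * c * (2 / sqrt v0) + 2 / \<epsilon>\<^sup>2) / sqrt n * (L / sqrt n) \<le> E"
    unfolding of_real_diff[symmetric] norm_of_real by linarith
  \<comment> \<open>From \<open>a^2 <= n\<close> the exponent in \<open>G\<close> loses at most
    \<open>1 / (2 * v0)\<close>, and \<open>L^2 <= n\<close> with \<open>v <= 1 + K\<close> bounds
    \<open>L^2 * (1 + q)\<close> by \<open>(2 + K) * n\<close>.\<close>
  have "exp (- 1 / (2 * v0)) / sqrt (2 + K) * (L / sqrt n) \<le> G"
  proof -
    have "(a / L)\<^sup>2 / (2 * (1 + q)) \<le> (a / L)\<^sup>2 / (2 * q)"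
      using q by (intro divide_left_mono) auto
    also have "\<dots> = a\<^sup>2 / (2 * v * n)"
      using L by (simp add: q_def power_divide)
    also have "\<dots> \<le> n / (2 * v * n)"
      using an v0 n by (intro divide_right_mono) auto
    also have "\<dots> \<le> 1 / (2 * v0)"
      using v0 n by (simp add: field_simps)
    finally have e: "exp (- 1 / (2 * v0)) \<le> exp (- (a / L)\<^sup>2 / (2 * (1 + q)))"
      by simp
    have "L\<^sup>2 * (1 + q) = L\<^sup>2 + v * n" using L by (simp add: q_def field_simps)
    also have "\<dots> \<le> n + (1 + K) * n" using Ln v n by (intro add_mono mult_right_mono) auto
    also have "\<dots> = (2 + K) * n" by (simp add: algebra_simps)
    finally have "sqrt (L\<^sup>2 * (1 + q)) \<le> sqrt ((2 + K) * n)" by (rule real_sqrt_le_mono)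
    then have "L * sqrt (1 + q) \<le> sqrt (2 + K) * sqrt n"
      using L by (simp add: real_sqrt_mult)
    then have "1 / sqrt (2 + K) * (L / sqrt n) \<le> 1 / sqrt (1 + q)"
      using n K q by (simp add: field_simps)
    then have "exp (- 1 / (2 * v0)) * (1 / sqrt (2 + K) * (L / sqrt n)) \<le> exp (- (a / L)\<^sup>2 / (2 * (1 + q))) * (1 / sqrt (1 + q))"
      using e L n K by (intro mult_mono) auto
    then show ?thesis by (simp add: G_def)
  qed
  with err show ?thesis
    unfolding E_def n_def B_def c_def by (simp only: left_diff_distrib)
qed

end

text \<open>The factor from \<open>kernel_expectation_upper\<close>. It involves neither the number
  of summands nor the position nor the width, which is what makes the later choices uniform in the
  tilt.\<close>

definition kernel_const :: "real \<Rightarrow> real \<Rightarrow> real" where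
  "kernel_const v0 K = sqrt 2 / sqrt v0 + 1 / (min 1 v0 / (1 + K))\<^sup>2"

lemma kernel_const_pos: "0 < v0 \<Longrightarrow> 0 < kernel_const v0 K"
  unfolding kernel_const_def by (intro add_pos_nonneg) auto

context centered_summands
begin

text \<open>On the window the kernel is at least \<open>exp (- 1 / 2) >= 1 / 2\<close>, whence the
  factor 2.\<close>

lemma window_prob_upper:
  fixes a L :: real
  assumes v0: "0 < v0" "v0 \<le> v" and I: "card I \<ge> 1" and L: "L > 0" "sqrt (card I) \<le> L ^ 3"
  shows "prob {\<omega> \<in> space P. \<bar>(\<Sum>i\<in>I. Y i \<omega>) - a\<bar> \<le> L} \<le> 2 * kernel_const v0 K * (L / sqrt (card I))"
proof -
  define S where "S \<omega> = (\<Sum>i\<in>I. Y i \<omega>)" for \<omega>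
  have [measurable]: "S \<in> borel_measurable P" unfolding S_def by (rule sum_rv)
  let ?W = "{\<omega> \<in> space P. \<bar>S \<omega> - a\<bar> \<le> L}"
  have "prob ?W = expectation (indicator ?W)" by simp
  also have "\<dots> \<le> expectation (\<lambda>\<omega>. 2 * exp (- ((S \<omega> - a) / L)\<^sup>2 / 2))"
  proof (rule integral_mono)
    show "integrable P (indicator ?W :: _ \<Rightarrow> real)"
      by (rule integrable_const_bound[where B = 1]) auto
    show "integrable P (\<lambda>\<omega>. 2 * exp (- ((S \<omega> - a) / L)\<^sup>2 / 2))"
      by (rule integrable_const_bound[where B = 2]) auto
    fix \<omega>
    show "indicator ?W \<omega> \<le> 2 * exp (- ((S \<omega> - a) / L)\<^sup>2 / 2)"
    proof (cases "\<omega> \<in> ?W")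
      case True
      then have "((S \<omega> - a) / L)\<^sup>2 \<le> 1"
        using L by (simp add: abs_square_le_1 abs_divide)
      then have "1 - 1 / 2 \<le> 1 + (- ((S \<omega> - a) / L)\<^sup>2 / 2)" by simp
      also have "\<dots> \<le> exp (- ((S \<omega> - a) / L)\<^sup>2 / 2)" by (rule exp_ge_add_one_self)
      finally show ?thesis using True by simp
    qed simp
  qed
  also have "\<dots> = 2 * expectation (\<lambda>\<omega>. exp (- ((S \<omega> - a) / L)\<^sup>2 / 2))" by simp
  also have "\<dots> \<le> 2 * (kernel_const v0 K * (L / sqrt (card I)))"
    unfolding S_def kernel_const_def by (intro mult_left_mono kernel_expectation_upper assms) auto
  finally show ?thesis by (simp add: S_def)
qed

text \<open>The kernel has tails outside every window. Beyond \<open>\<kappa> * L\<close>, writing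
  \<open>exp (- x^2 / 2)\<close> as the square of \<open>exp (- x^2 / 4) <= 4 / x^2\<close> bounds
  it by \<open>4 / \<kappa>^2\<close> times the kernel of width \<open>sqrt 2 * L\<close>. The upper
  estimate for that wider kernel has the same order \<open>L / sqrt n\<close>, so a large
  \<open>\<kappa>\<close> makes the loss a small fraction of the main term.\<close>

lemma window_prob_lower:
  fixes a L :: real
  assumes v0: "0 < v0" "v0 \<le> v" and I: "card I \<ge> 1"
    and L: "L > 0" "card I \<le> L ^ 3" "L\<^sup>2 \<le> card I" and a: "a\<^sup>2 \<le> card I" and \<kappa>: "\<kappa> > 0"
  defines "\<epsilon> \<equiv> min 1 v0 / (1 + K)"
  shows "(exp (- 1 / (2 * v0)) / sqrt (2 + K)
      - ((1 + K)\<^sup>2 * exp (v0 / 4) * (1 + 128 / v0\<^sup>2) * (2 / sqrt v0) + 2 / \<epsilon>\<^sup>2) / sqrt (card I)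
      - 4 / \<kappa>\<^sup>2 * (sqrt 2 * kernel_const v0 K)) * (L / sqrt (card I))
    \<le> prob {\<omega> \<in> space P. \<bar>(\<Sum>i\<in>I. Y i \<omega>) - a\<bar> \<le> \<kappa> * L}"
proof -
  define S where "S \<omega> = (\<Sum>i\<in>I. Y i \<omega>)" for \<omega>
  have [measurable]: "S \<in> borel_measurable P" unfolding S_def by (rule sum_rv)
  let ?W = "{\<omega> \<in> space P. \<bar>S \<omega> - a\<bar> \<le> \<kappa> * L}"
  have int: "integrable P (\<lambda>\<omega>. exp (- ((S \<omega> - a) / c)\<^sup>2 / 2))" for c
    by (rule integrable_const_bound[where B = 1]) auto
  have n1: "1 \<le> real (card I)" using I by simp
  have "expectation (\<lambda>\<omega>. exp (- ((S \<omega> - a) / L)\<^sup>2 / 2))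
    \<le> expectation (\<lambda>\<omega>. indicator ?W \<omega> + 4 / \<kappa>\<^sup>2 * exp (- ((S \<omega> - a) / (sqrt 2 * L))\<^sup>2 / 2))"
  proof (rule integral_mono[OF int])
    show "integrable P (\<lambda>\<omega>. indicator ?W \<omega> + 4 / \<kappa>\<^sup>2 * exp (- ((S \<omega> - a) / (sqrt 2 * L))\<^sup>2 / 2))"
      by (intro Bochner_Integration.integrable_add integrable_mult_right int integrable_const_bound[where B = 1 and f = "indicator ?W"]) auto
    fix \<omega> assume \<omega>: "\<omega> \<in> space P"
    define x where "x = (S \<omega> - a) / L"
    have x2: "((S \<omega> - a) / (sqrt 2 * L))\<^sup>2 = x\<^sup>2 / 2"
      by (simp add: x_def power_divide power_mult_distrib)
    show "exp (- ((S \<omega> - a) / L)\<^sup>2 / 2) \<le> indicator ?W \<omega> + 4 / \<kappa>\<^sup>2 * exp (- ((S \<omega> - a) / (sqrt 2 * L))\<^sup>2 / 2)"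
    proof (cases "\<omega> \<in> ?W")
      case True
      then show ?thesis by (simp add: add_increasing2)
    next
      case False
      then have "\<kappa> \<le> \<bar>x\<bar>" using \<omega> L by (simp add: x_def abs_divide field_simps)
      then have k: "\<kappa>\<^sup>2 \<le> x\<^sup>2" using \<kappa> by (simp add: abs_le_square_iff[symmetric])
      have "x\<^sup>2 / 4 \<le> exp (x\<^sup>2 / 4)" using exp_ge_add_one_self[of "x\<^sup>2 / 4"] by linarith
      then have "\<kappa>\<^sup>2 / 4 \<le> exp (x\<^sup>2 / 4)" using k by simp
      then have "exp (- (x\<^sup>2 / 4)) \<le> 4 / \<kappa>\<^sup>2"
        using \<kappa> by (simp add: exp_minus field_simps)
      then have "exp (- (x\<^sup>2 / 4)) * exp (- (x\<^sup>2 / 4)) \<le> 4 / \<kappa>\<^sup>2 * exp (- (x\<^sup>2 / 4))"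
        by (intro mult_right_mono) auto
      then show ?thesis
        unfolding x2 using False by (simp add: exp_add[symmetric] x_def[symmetric])
    qed
  qed
  also have "\<dots> = prob ?W + 4 / \<kappa>\<^sup>2 * expectation (\<lambda>\<omega>. exp (- ((S \<omega> - a) / (sqrt 2 * L))\<^sup>2 / 2))"
    using int by (subst Bochner_Integration.integral_add) (auto intro!: integrable_const_bound[where B = 1 and f = "indicator ?W"])
  also have "\<dots> \<le> prob ?W + 4 / \<kappa>\<^sup>2 * (kernel_const v0 K * (sqrt 2 * L / sqrt (card I)))"
  proof (intro add_left_mono mult_left_mono)
    have "sqrt (card I) \<le> card I"
      using n1 by (intro real_le_lsqrt) (auto simp: power2_eq_square)
    also have "\<dots> \<le> L ^ 3" by (rule L)
    also have "\<dots> \<le> (sqrt 2 * L) ^ 3"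
      using L by (intro power_mono) auto
    finally show "expectation (\<lambda>\<omega>. exp (- ((S \<omega> - a) / (sqrt 2 * L))\<^sup>2 / 2)) \<le> kernel_const v0 K * (sqrt 2 * L / sqrt (card I))"
      unfolding S_def kernel_const_def using L by (intro kernel_expectation_upper v0 I) auto
  qed auto
  finally have "expectation (\<lambda>\<omega>. exp (- ((S \<omega> - a) / L)\<^sup>2 / 2)) - 4 / \<kappa>\<^sup>2 * (sqrt 2 * kernel_const v0 K) * (L / sqrt (card I)) \<le> prob ?W"
    by (simp add: mult_ac)
  moreover note kernel_expectation_lower[OF v0 I L a, folded \<epsilon>_def S_def]
  ultimately show ?thesis
    unfolding S_def[symmetric] left_diff_distrib by linarith
qed

end

section \<open>Consequences of independence through the product law\<close>

lemma (in prob_space) indep_inner_mean_zero: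
  fixes A B :: "'a \<Rightarrow> 'c::{real_inner, banach, second_countable_topology}"
  assumes ind: "indep_var borel A borel B"
    and sq: "integrable M (\<lambda>\<omega>. (norm (A \<omega>))\<^sup>2)" "integrable M (\<lambda>\<omega>. (norm (B \<omega>))\<^sup>2)"
    and B: "integrable M B" "expectation B = 0"
  shows "integrable M (\<lambda>\<omega>. inner (A \<omega>) (B \<omega>))" "expectation (\<lambda>\<omega>. inner (A \<omega>) (B \<omega>)) = 0"
proof -
  have [measurable]: "A \<in> borel_measurable M" "B \<in> borel_measurable M"
    using ind by (auto simp: indep_var_distribution_eq)
  have eq: "distr M borel A \<Otimes>\<^sub>M distr M borel B = distr M (borel \<Otimes>\<^sub>M borel) (\<lambda>\<omega>. (A \<omega>, B \<omega>))"
    using ind by (auto simp: indep_var_distribution_eq)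
  show int: "integrable M (\<lambda>\<omega>. inner (A \<omega>) (B \<omega>))"
  proof (rule Bochner_Integration.integrable_bound)
    show "integrable M (\<lambda>\<omega>. (norm (A \<omega>))\<^sup>2 + (norm (B \<omega>))\<^sup>2)" using sq by simp
    have "\<bar>inner x y\<bar> \<le> (norm x)\<^sup>2 + (norm y)\<^sup>2" for x y :: 'c
    proof -
      have "\<bar>inner x y\<bar> \<le> norm x * norm y" by (rule Cauchy_Schwarz_ineq2)
      also have "\<dots> \<le> (norm x)\<^sup>2 + (norm y)\<^sup>2"
        using sum_squares_bound[of "norm x" "norm y"] mult_nonneg_nonneg[OF norm_ge_zero[of x] norm_ge_zero[of y]] by linarith
      finally show ?thesis .
    qed
    then show "AE \<omega> in M. norm (inner (A \<omega>) (B \<omega>)) \<le> norm ((norm (A \<omega>))\<^sup>2 + (norm (B \<omega>))\<^sup>2)"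
      by auto
  qed measurable
  interpret DA: prob_space "distr M borel A" by (rule prob_space_distr) simp
  interpret DB: prob_space "distr M borel B" by (rule prob_space_distr) simp
  interpret pair_sigma_finite "distr M borel A" "distr M borel B" ..
  have intp: "integrable (distr M borel A \<Otimes>\<^sub>M distr M borel B) (\<lambda>z. inner (fst z) (snd z))"
    unfolding eq using int by (subst integrable_distr_eq) auto
  have "expectation (\<lambda>\<omega>. inner (A \<omega>) (B \<omega>)) = (\<integral>z. inner (fst z) (snd z) \<partial>(distr M borel A \<Otimes>\<^sub>M distr M borel B))"
    unfolding eq by (subst integral_distr) auto
  also have "\<dots> = (\<integral>x. \<integral>y. inner x y \<partial>distr M borel B \<partial>distr M borel A)"
    using integral_fst'[OF intp] by simp
  also have "\<dots> = (\<integral>x. inner x (expectation B) \<partial>distr M borel A)"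
    using B(1) by (intro Bochner_Integration.integral_cong) (auto simp: integral_distr)
  finally show "expectation (\<lambda>\<omega>. inner (A \<omega>) (B \<omega>)) = 0" using B by simp
qed

text \<open>For a fixed value \<open>x\<close> of \<open>A\<close> the second event is a window for
  \<open>h (B)\<close> centred at \<open>a - h x\<close>. Since \<open>c\<close> bounds all windows
  alike, integrating over the law of \<open>A\<close> leaves only the probability of
  \<open>E\<close>.\<close>

lemma (in prob_space) indep_conditional_prob_bound:
  fixes A B :: "'a \<Rightarrow> 'c::{second_countable_topology, t2_space}" and h :: "'c \<Rightarrow> real"
  assumes ind: "indep_var borel A borel B"
    and h[measurable]: "h \<in> borel_measurable borel" and E[measurable]: "E \<in> sets borel"
    and c: "\<And>t. prob {\<omega> \<in> space M. \<bar>h (B \<omega>) - t\<bar> \<le> L} \<le> c"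
  shows "prob {\<omega> \<in> space M. A \<omega> \<in> E \<and> \<bar>h (A \<omega>) + h (B \<omega>) - a\<bar> \<le> L} \<le> c * prob {\<omega> \<in> space M. A \<omega> \<in> E}"
proof -
  have [measurable]: "A \<in> borel_measurable M" "B \<in> borel_measurable M"
    using ind by (auto simp: indep_var_distribution_eq)
  have eq: "distr M borel A \<Otimes>\<^sub>M distr M borel B = distr M (borel \<Otimes>\<^sub>M borel) (\<lambda>\<omega>. (A \<omega>, B \<omega>))"
    using ind by (auto simp: indep_var_distribution_eq)
  interpret DA: prob_space "distr M borel A" by (rule prob_space_distr) simp
  interpret DB: prob_space "distr M borel B" by (rule prob_space_distr) simp
  have c0: "0 \<le> c" using c[of 0] measure_nonneg order_trans by blast
  define S where "S = {z :: 'c \<times> 'c. fst z \<in> E \<and> \<bar>h (fst z) + h (snd z) - a\<bar> \<le> L}"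
  have S[measurable]: "S \<in> sets (borel \<Otimes>\<^sub>M borel)"
  proof -
    have "(\<lambda>z::'c \<times> 'c. \<bar>h (fst z) + h (snd z) - a\<bar>) \<in> borel_measurable (borel \<Otimes>\<^sub>M borel)"
      by measurable
    then have *: "(\<lambda>z. \<bar>h (fst z) + h (snd z) - a\<bar>) -` {..L} \<inter> space (borel \<Otimes>\<^sub>M borel) \<in> sets (borel \<Otimes>\<^sub>M borel)"
      by (rule measurable_sets) simp
    have "(E \<times> UNIV) \<inter> ((\<lambda>z. \<bar>h (fst z) + h (snd z) - a\<bar>) -` {..L} \<inter> space (borel \<Otimes>\<^sub>M borel)) \<in> sets (borel \<Otimes>\<^sub>M borel)"
      by (rule sets.Int[OF pair_measureI[OF E] *]) simp
    also have "(E \<times> UNIV) \<inter> ((\<lambda>z. \<bar>h (fst z) + h (snd z) - a\<bar>) -` {..L} \<inter> space (borel \<Otimes>\<^sub>M borel)) = S"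
      by (auto simp: S_def space_pair_measure)
    finally show ?thesis .
  qed
  have "emeasure M {\<omega> \<in> space M. A \<omega> \<in> E \<and> \<bar>h (A \<omega>) + h (B \<omega>) - a\<bar> \<le> L} = emeasure (distr M borel A \<Otimes>\<^sub>M distr M borel B) S"
    unfolding eq by (subst emeasure_distr[OF _ S]) (simp, auto simp: S_def vimage_def intro!: arg_cong[where f = "emeasure M"])
  also have "\<dots> = (\<integral>\<^sup>+x. emeasure (distr M borel B) (Pair x -` S) \<partial>distr M borel A)"
    by (rule DB.emeasure_pair_measure_alt) simp
  also have "\<dots> \<le> (\<integral>\<^sup>+x. ennreal c * indicator E x \<partial>distr M borel A)"
  proof (rule nn_integral_mono)
    fix x
    have "Pair x -` S = (if x \<in> E then {y. \<bar>h y - (a - h x)\<bar> \<le> L} else {})"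
      by (auto simp: S_def algebra_simps)
    moreover have "emeasure (distr M borel B) {y. \<bar>h y - (a - h x)\<bar> \<le> L} = prob {\<omega> \<in> space M. \<bar>h (B \<omega>) - (a - h x)\<bar> \<le> L}"
      by (subst emeasure_distr) (auto simp: emeasure_eq_measure vimage_def intro!: arg_cong[where f = prob])
    ultimately show "emeasure (distr M borel B) (Pair x -` S) \<le> ennreal c * indicator E x"
      using c[of "a - h x"] by (auto simp: ennreal_leI)
  qed
  also have "\<dots> = ennreal c * emeasure (distr M borel A) E"
    by (rule nn_integral_cmult_indicator) simp
  also have "emeasure (distr M borel A) E = prob {\<omega> \<in> space M. A \<omega> \<in> E}"
    by (subst emeasure_distr) (auto simp: emeasure_eq_measure vimage_def intro!: arg_cong[where f = prob])
  finally show ?thesis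
    using c0 by (simp add: emeasure_eq_measure ennreal_mult[symmetric])
qed

section \<open>Vector-valued sums: windows with a tight complement\<close>

locale vector_summands = prob_space P for P :: "'b measure" +
  fixes U :: "'i \<Rightarrow> 'b \<Rightarrow> 'a::{real_inner, banach, second_countable_topology}"
    and I :: "'i set" and h :: "'a \<Rightarrow>\<^sub>L real" and v K :: real
  assumes fin: "finite I"
    and indep: "indep_vars (\<lambda>_. borel) U I"
    and cube: "i \<in> I \<Longrightarrow> integrable P (\<lambda>\<omega>. norm (U i \<omega>) ^ 3)"
    and mean: "i \<in> I \<Longrightarrow> expectation (U i) = 0"
    and var: "i \<in> I \<Longrightarrow> expectation (\<lambda>\<omega>. (blinfun_apply h (U i \<omega>))\<^sup>2) = v"
    and third: "i \<in> I \<Longrightarrow> expectation (\<lambda>\<omega>. norm (U i \<omega>) ^ 3) \<le> K"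
    and nonempty: "I \<noteq> {}"
begin

lemma rv: "i \<in> I \<Longrightarrow> U i \<in> borel_measurable P"
  using indep by (simp add: indep_vars_def2)

lemma square_integrable: "i \<in> I \<Longrightarrow> integrable P (\<lambda>\<omega>. (norm (U i \<omega>))\<^sup>2)"
  by (rule Bochner_Integration.integrable_bound[where f = "\<lambda>\<omega>. 1 + norm (U i \<omega>) ^ 3"])
    (auto simp: cube intro!: AE_I2 borel_measurable_power measurable_compose[OF rv borel_measurable_norm] order_trans[OF square_le_one_plus_cube])

lemma integrable_summand: "i \<in> I \<Longrightarrow> integrable P (U i)"
proof -
  assume i: "i \<in> I"
  have "integrable P (\<lambda>\<omega>. norm (U i \<omega>))"
    using rv[OF i] square_integrable[OF i] by (intro square_integrable_imp_integrable[OF _ square_integrable[OF i]]) measurable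
  then show ?thesis using rv[OF i] by (simp add: integrable_norm_iff)
qed

lemma square_bound: "i \<in> I \<Longrightarrow> expectation (\<lambda>\<omega>. (norm (U i \<omega>))\<^sup>2) \<le> 1 + K"
proof -
  assume i: "i \<in> I"
  have "expectation (\<lambda>\<omega>. (norm (U i \<omega>))\<^sup>2) \<le> expectation (\<lambda>\<omega>. 1 + norm (U i \<omega>) ^ 3)"
    using square_le_one_plus_cube[of "norm (U i _)"]
    by (intro integral_mono square_integrable[OF i] Bochner_Integration.integrable_add cube[OF i]) auto
  also have "\<dots> = 1 + expectation (\<lambda>\<omega>. norm (U i \<omega>) ^ 3)"
    using cube[OF i] by (simp add: prob_space)
  finally show ?thesis using third[OF i] by simp
qed

lemma K_nonneg: "0 \<le> K"
proof -
  obtain i where i: "i \<in> I" using nonempty by blast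
  have "0 \<le> expectation (\<lambda>\<omega>. norm (U i \<omega>) ^ 3)" by (rule integral_nonneg_AE) simp
  then show ?thesis using third[OF i] by linarith
qed

text \<open>Stated for subsets so that each half of a sum inherits the constants of the whole. The
  bound on \<open>v\<close> comes from \<open>x^2 <= 1 + |x|^3\<close> applied to one
  summand.\<close>

lemma real_summands:
  assumes J: "J \<subseteq> I"
  shows "centered_summands P (\<lambda>i \<omega>. blinfun_apply h (U i \<omega>)) J v (norm h ^ 3 * K)"
proof -
  have h[measurable]: "blinfun_apply h \<in> borel_measurable borel"
    by (intro borel_measurable_continuous_onI continuous_intros)
  have le: "\<bar>h x\<bar> ^ 3 \<le> norm h ^ 3 * norm x ^ 3" for x
    unfolding power_mult_distrib[symmetric] using norm_blinfun[of h x] by (intro power_mono) auto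
  have hrv: "(\<lambda>\<omega>. blinfun_apply h (U i \<omega>)) \<in> borel_measurable P" if "i \<in> I" for i
    using rv[OF that] by measurable
  have hc: "integrable P (\<lambda>\<omega>. \<bar>blinfun_apply h (U i \<omega>)\<bar> ^ 3)" if "i \<in> I" for i
    by (rule Bochner_Integration.integrable_bound[OF integrable_mult_right[OF cube[OF that], of "norm h ^ 3"]])
      (auto intro!: AE_I2 le borel_measurable_power borel_measurable_abs hrv that)
  have third': "expectation (\<lambda>\<omega>. \<bar>blinfun_apply h (U i \<omega>)\<bar> ^ 3) \<le> norm h ^ 3 * K" if "i \<in> I" for i
  proof -
    have "expectation (\<lambda>\<omega>. \<bar>blinfun_apply h (U i \<omega>)\<bar> ^ 3) \<le> expectation (\<lambda>\<omega>. norm h ^ 3 * norm (U i \<omega>) ^ 3)"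
      by (intro integral_mono hc integrable_mult_right cube that le)
    also have "\<dots> \<le> norm h ^ 3 * K"
      using third[OF that] by (simp add: mult_left_mono)
    finally show ?thesis .
  qed
  obtain i where i: "i \<in> I" using nonempty by blast
  have "v = expectation (\<lambda>\<omega>. (blinfun_apply h (U i \<omega>))\<^sup>2)" using var[OF i] by simp
  also have "\<dots> \<le> expectation (\<lambda>\<omega>. 1 + \<bar>blinfun_apply h (U i \<omega>)\<bar> ^ 3)"
  proof (rule integral_mono)
    show int: "integrable P (\<lambda>\<omega>. 1 + \<bar>blinfun_apply h (U i \<omega>)\<bar> ^ 3)" using hc[OF i] by simp
    show "integrable P (\<lambda>\<omega>. (blinfun_apply h (U i \<omega>))\<^sup>2)"
      by (rule Bochner_Integration.integrable_bound[OF int])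
        (auto intro!: AE_I2 borel_measurable_power hrv i simp: square_le_one_plus_cube)
  qed (rule square_le_one_plus_cube)
  also have "\<dots> = 1 + expectation (\<lambda>\<omega>. \<bar>blinfun_apply h (U i \<omega>)\<bar> ^ 3)"
    using hc[OF i] by (simp add: prob_space)
  finally have v1: "v \<le> 1 + norm h ^ 3 * K" using third'[OF i] by simp
  have v0: "0 \<le> v" using var[OF i] by (metis integral_nonneg_AE AE_I2 zero_le_power2)
  show ?thesis
  proof
    show "finite J" using fin J by (rule rev_finite_subset)
    show "indep_vars (\<lambda>_. borel) (\<lambda>i \<omega>. blinfun_apply h (U i \<omega>)) J"
      by (rule indep_vars_compose2[OF indep_vars_subset[OF indep J]]) simp
    show "0 \<le> norm h ^ 3 * K" using K_nonneg by simp
    fix i assume "i \<in> J"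
    then have i: "i \<in> I" using J by blast
    show "integrable P (\<lambda>\<omega>. \<bar>blinfun_apply h (U i \<omega>)\<bar> ^ 3)" "expectation (\<lambda>\<omega>. \<bar>blinfun_apply h (U i \<omega>)\<bar> ^ 3) \<le> norm h ^ 3 * K"
      "expectation (\<lambda>\<omega>. (blinfun_apply h (U i \<omega>))\<^sup>2) = v"
      by (fact hc[OF i] third'[OF i] var[OF i])+
    show "expectation (\<lambda>\<omega>. blinfun_apply h (U i \<omega>)) = 0"
      using integral_bounded_linear[OF blinfun.bounded_linear_right integrable_summand[OF i], of h] mean[OF i]
      by (simp add: blinfun.zero_right)
  qed (fact v0 v1)+
qed

lemma indep_pair: "i \<in> I \<Longrightarrow> j \<in> I \<Longrightarrow> i \<noteq> j \<Longrightarrow> indep_var borel (U i) borel (U j)"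
proof -
  assume ij: "i \<in> I" "j \<in> I" "i \<noteq> j"
  have "indep_var borel ((\<lambda>f. f i) \<circ> (\<lambda>\<omega>. restrict (\<lambda>i. U i \<omega>) {i})) borel ((\<lambda>f. f j) \<circ> (\<lambda>\<omega>. restrict (\<lambda>i. U i \<omega>) {j}))"
    using ij by (intro indep_var_compose[OF indep_var_restrict[OF indep]]) auto
  then show ?thesis by (simp add: comp_def)
qed

lemma indep_sums:
  assumes "J1 \<subseteq> I" "J2 \<subseteq> I" "J1 \<inter> J2 = {}"
  shows "indep_var borel (\<lambda>\<omega>. \<Sum>i\<in>J1. U i \<omega>) borel (\<lambda>\<omega>. \<Sum>i\<in>J2. U i \<omega>)"
proof -
  have "indep_var borel ((\<lambda>f. \<Sum>i\<in>J1. f i) \<circ> (\<lambda>\<omega>. restrict (\<lambda>i. U i \<omega>) J1)) borel ((\<lambda>f. \<Sum>i\<in>J2. f i) \<circ> (\<lambda>\<omega>. restrict (\<lambda>i. U i \<omega>) J2))"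
    using assms by (intro indep_var_compose[OF indep_var_restrict[OF indep]]) (auto intro!: borel_measurable_sum measurable_component_singleton)
  then show ?thesis by (simp add: comp_def)
qed

text \<open>Here the inner product on the space enters: the cross terms have mean zero by
  independence, so the second moment of the norm grows linearly and the sum lives on the scale
  \<open>sqrt n\<close>, as the width of the slices demands.\<close>

lemma sum_second_moment:
  assumes J: "J \<subseteq> I"
  shows "integrable P (\<lambda>\<omega>. (norm (\<Sum>i\<in>J. U i \<omega>))\<^sup>2)"
    "expectation (\<lambda>\<omega>. (norm (\<Sum>i\<in>J. U i \<omega>))\<^sup>2) \<le> real (card J) * (1 + K)"
proof -
  have eq: "(norm (\<Sum>i\<in>J. U i \<omega>))\<^sup>2 = (\<Sum>i\<in>J. \<Sum>j\<in>J. inner (U i \<omega>) (U j \<omega>))" for \<omega>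
    unfolding power2_norm_eq_inner inner_sum_left by (simp add: inner_sum_right)
  have fJ: "finite J" using fin J by (rule rev_finite_subset)
  have off: "integrable P (\<lambda>\<omega>. inner (U i \<omega>) (U j \<omega>))" "expectation (\<lambda>\<omega>. inner (U i \<omega>) (U j \<omega>)) = 0"
    if "i \<in> J" "j \<in> J" "i \<noteq> j" for i j
  proof -
    have ij: "i \<in> I" "j \<in> I" using that J by auto
    note * = indep_inner_mean_zero[OF indep_pair[OF ij that(3)] square_integrable[OF ij(1)] square_integrable[OF ij(2)] integrable_summand[OF ij(2)] mean[OF ij(2)]]
    show "integrable P (\<lambda>\<omega>. inner (U i \<omega>) (U j \<omega>))" by (rule *(1))
    show "expectation (\<lambda>\<omega>. inner (U i \<omega>) (U j \<omega>)) = 0" by (rule *(2))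
  qed
  have diag: "integrable P (\<lambda>\<omega>. inner (U i \<omega>) (U i \<omega>))" "expectation (\<lambda>\<omega>. inner (U i \<omega>) (U i \<omega>)) \<le> 1 + K"
    if "i \<in> J" for i
    using square_integrable[of i] square_bound[of i] that J by (auto simp: power2_norm_eq_inner)
  have int: "integrable P (\<lambda>\<omega>. inner (U i \<omega>) (U j \<omega>))" if "i \<in> J" "j \<in> J" for i j
    using off(1) diag(1) that by (cases "i = j") auto
  show "integrable P (\<lambda>\<omega>. (norm (\<Sum>i\<in>J. U i \<omega>))\<^sup>2)"
    unfolding eq by (intro Bochner_Integration.integrable_sum int)
  have "expectation (\<lambda>\<omega>. (norm (\<Sum>i\<in>J. U i \<omega>))\<^sup>2) = (\<Sum>i\<in>J. \<Sum>j\<in>J. expectation (\<lambda>\<omega>. inner (U i \<omega>) (U j \<omega>)))"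
    unfolding eq by (subst Bochner_Integration.integral_sum, intro Bochner_Integration.integrable_sum int, assumption+,
      intro sum.cong refl Bochner_Integration.integral_sum int)
  also have "\<dots> = (\<Sum>i\<in>J. expectation (\<lambda>\<omega>. inner (U i \<omega>) (U i \<omega>)))"
  proof (rule sum.cong[OF refl])
    fix i assume i: "i \<in> J"
    have "(\<Sum>j\<in>J. expectation (\<lambda>\<omega>. inner (U i \<omega>) (U j \<omega>))) = (\<Sum>j\<in>J. if j = i then expectation (\<lambda>\<omega>. inner (U i \<omega>) (U i \<omega>)) else 0)"
      using off(2)[OF i] by (intro sum.cong) auto
    then show "(\<Sum>j\<in>J. expectation (\<lambda>\<omega>. inner (U i \<omega>) (U j \<omega>))) = expectation (\<lambda>\<omega>. inner (U i \<omega>) (U i \<omega>))"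
      using fJ i by simp
  qed
  also have "\<dots> \<le> (\<Sum>i\<in>J. 1 + K)" by (intro sum_mono diag)
  finally show "expectation (\<lambda>\<omega>. (norm (\<Sum>i\<in>J. U i \<omega>))\<^sup>2) \<le> real (card J) * (1 + K)" by simp
qed

lemma sum_rv: "J \<subseteq> I \<Longrightarrow> (\<lambda>\<omega>. \<Sum>i\<in>J. U i \<omega>) \<in> borel_measurable P"
  by (intro borel_measurable_sum rv) auto

lemma sum_tail:
  assumes J: "J \<subseteq> I" and \<rho>: "\<rho> > 0"
  shows "prob {\<omega> \<in> space P. norm (\<Sum>i\<in>J. U i \<omega>) > \<rho>} \<le> real (card J) * (1 + K) / \<rho>\<^sup>2"
proof -
  have [measurable]: "(\<lambda>\<omega>. \<Sum>i\<in>J. U i \<omega>) \<in> borel_measurable P" by (rule sum_rv[OF J])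
  have "prob {\<omega> \<in> space P. norm (\<Sum>i\<in>J. U i \<omega>) > \<rho>} \<le> prob {\<omega> \<in> space P. (norm (\<Sum>i\<in>J. U i \<omega>))\<^sup>2 \<ge> \<rho>\<^sup>2}"
    using \<rho> by (intro finite_measure_mono) (auto intro: power_mono)
  also have "\<dots> \<le> expectation (\<lambda>\<omega>. (norm (\<Sum>i\<in>J. U i \<omega>))\<^sup>2) / \<rho>\<^sup>2"
    using \<rho> by (intro integral_Markov_inequality_measure[OF sum_second_moment(1)[OF J]]) auto
  also have "\<dots> \<le> real (card J) * (1 + K) / \<rho>\<^sup>2"
    by (intro divide_right_mono sum_second_moment(2) J) simp
  finally show ?thesis .
qed

text \<open>
  Conditionally on one half of the summands, the other half still spreads the functional \<open>h\<close> of
  the sum over the scale \<open>sqrt n\<close>, so the window costs a factor \<open>L / sqrt n\<close> on top of the tail.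
\<close>

lemma window_and_half_tail:
  fixes a L \<rho> :: real
  assumes J: "J1 \<union> J2 = I" "J1 \<inter> J2 = {}" and n: "card I \<le> 3 * card J2" "1 \<le> card J2"
    and v0: "0 < v0" "v0 \<le> v" and L: "L > 0" "real (card I) \<le> L ^ 3" and \<rho>: "\<rho> > 0"
  shows "prob {\<omega> \<in> space P. norm (\<Sum>i\<in>J1. U i \<omega>) > \<rho> \<and> \<bar>blinfun_apply h (\<Sum>i\<in>I. U i \<omega>) - a\<bar> \<le> L}
    \<le> 2 * sqrt 3 * kernel_const v0 (norm h ^ 3 * K) * (L / sqrt (real (card I))) * (real (card I) * (1 + K) / \<rho>\<^sup>2)"
proof -
  have sub: "J1 \<subseteq> I" "J2 \<subseteq> I" using J by auto
  have fJ: "finite J1" "finite J2" using sub fin finite_subset by blast+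
  have h[measurable]: "blinfun_apply h \<in> borel_measurable borel"
    by (intro borel_measurable_continuous_onI continuous_intros)
  define C where "C = kernel_const v0 (norm h ^ 3 * K)"
  have C: "C > 0" unfolding C_def by (rule kernel_const_pos[OF v0(1)])
  have n1: "1 \<le> real (card I)"
    using n card_mono[OF fin sub(2)] by linarith
  interpret Y: centered_summands P "\<lambda>i \<omega>. blinfun_apply h (U i \<omega>)" J2 v "norm h ^ 3 * K" by (rule real_summands[OF sub(2)])
  have hJ2: "blinfun_apply h (\<Sum>i\<in>J2. U i \<omega>) = (\<Sum>i\<in>J2. blinfun_apply h (U i \<omega>))" for \<omega>
    by (rule blinfun.sum_right)
  have split: "blinfun_apply h (\<Sum>i\<in>I. U i \<omega>) = blinfun_apply h (\<Sum>i\<in>J1. U i \<omega>) + blinfun_apply h (\<Sum>i\<in>J2. U i \<omega>)" for \<omega>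
    unfolding J(1)[symmetric] using fJ J(2) by (simp add: sum.union_disjoint blinfun.add_right)
  have "sqrt (real (card J2)) \<le> sqrt (real (card I))"
    using card_mono[OF fin sub(2)] by simp
  also have "\<dots> \<le> card I" using n1 by (intro real_le_lsqrt) (auto simp: power2_eq_square)
  also have "\<dots> \<le> L ^ 3" by (rule L)
  finally have L3: "sqrt (real (card J2)) \<le> L ^ 3" .
  have "sqrt (real (card I)) \<le> sqrt (3 * real (card J2))" using n by simp
  then have "1 / sqrt (real (card J2)) \<le> sqrt 3 / sqrt (real (card I))"
    using n n1 by (simp add: field_simps real_sqrt_mult)
  then have "2 * C * (L * (1 / sqrt (real (card J2)))) \<le> 2 * C * (L * (sqrt 3 / sqrt (real (card I))))"
    using L C by (intro mult_left_mono) auto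
  then have conc: "2 * C * (L / sqrt (real (card J2))) \<le> 2 * sqrt 3 * C * (L / sqrt (real (card I)))"
    by (simp add: mult_ac)
  have "prob {\<omega> \<in> space P. (\<Sum>i\<in>J1. U i \<omega>) \<in> {x. norm x > \<rho>} \<and> \<bar>blinfun_apply h (\<Sum>i\<in>J1. U i \<omega>) + blinfun_apply h (\<Sum>i\<in>J2. U i \<omega>) - a\<bar> \<le> L}
    \<le> 2 * sqrt 3 * C * (L / sqrt (real (card I))) * prob {\<omega> \<in> space P. (\<Sum>i\<in>J1. U i \<omega>) \<in> {x. norm x > \<rho>}}"
  proof (rule indep_conditional_prob_bound[OF indep_sums[OF sub J(2)] h])
    show "prob {\<omega> \<in> space P. \<bar>blinfun_apply h (\<Sum>i\<in>J2. U i \<omega>) - t\<bar> \<le> L} \<le> 2 * sqrt 3 * C * (L / sqrt (real (card I)))" for t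
      unfolding hJ2 using Y.window_prob_upper[OF v0 n(2) L(1) L3, of t] conc unfolding C_def by (rule order_trans)
  qed measurable
  also have "\<dots> \<le> 2 * sqrt 3 * C * (L / sqrt (real (card I))) * (real (card I) * (1 + K) / \<rho>\<^sup>2)"
  proof (rule mult_left_mono)
    have "prob {\<omega> \<in> space P. (\<Sum>i\<in>J1. U i \<omega>) \<in> {x. norm x > \<rho>}} \<le> real (card J1) * (1 + K) / \<rho>\<^sup>2"
      using sum_tail[OF sub(1) \<rho>] by simp
    also have "\<dots> \<le> real (card I) * (1 + K) / \<rho>\<^sup>2"
      using card_mono[OF fin sub(1)] K_nonneg by (intro divide_right_mono mult_right_mono) auto
    finally show "prob {\<omega> \<in> space P. (\<Sum>i\<in>J1. U i \<omega>) \<in> {x. norm x > \<rho>}} \<le> real (card I) * (1 + K) / \<rho>\<^sup>2" .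
  qed (use C L in auto)
  finally show ?thesis
    unfolding split C_def by simp
qed

end

text \<open>All four constants precede the measure, the summands, the variance and the position,
  because the tilted law changes with \<open>n\<close>. They are found in the order
  \<open>\<kappa>\<close>, then \<open>R\<close>, since the cost of a tail in norm is proportional
  to \<open>\<kappa>\<close>.\<close>

lemma local_window:
  fixes h :: "'a::{real_inner, banach, second_countable_topology} \<Rightarrow>\<^sub>L real" and v0 K :: real
  assumes v0: "0 < v0" and K: "0 \<le> K"
  obtains \<kappa> c R N where "\<kappa> > 0" "c > 0" "R > 0"
    and "\<And>(P::'b measure) (U::'i \<Rightarrow> 'b \<Rightarrow> 'a) I v a L.
      vector_summands P U I h v K \<Longrightarrow> v0 \<le> v \<Longrightarrow> N \<le> real (card I) \<Longrightarrow>
      0 < L \<Longrightarrow> real (card I) \<le> L ^ 3 \<Longrightarrow> L\<^sup>2 \<le> real (card I) \<Longrightarrow> a\<^sup>2 \<le> real (card I) \<Longrightarrow>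
      c * (L / sqrt (real (card I))) \<le> measure P {\<omega> \<in> space P.
        \<bar>blinfun_apply h (\<Sum>i\<in>I. U i \<omega>) - a\<bar> \<le> \<kappa> * L \<and> norm (\<Sum>i\<in>I. U i \<omega>) \<le> R * sqrt (real (card I))}"
proof -
  define K' where "K' = norm h ^ 3 * K"
  have K': "K' \<ge> 0" using K by (simp add: K'_def)
  define C where "C = kernel_const v0 K'"
  have C: "C > 0" unfolding C_def by (rule kernel_const_pos[OF v0])
  define c0 where "c0 = exp (- 1 / (2 * v0)) / sqrt (2 + K')"
  have c0: "c0 > 0" using K' by (simp add: c0_def)
  define C2 where "C2 = (1 + K')\<^sup>2 * exp (v0 / 4) * (1 + 128 / v0\<^sup>2) * (2 / sqrt v0) + 2 / (min 1 v0 / (1 + K'))\<^sup>2"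
  have C2: "C2 \<ge> 0" unfolding C2_def using v0 by (intro add_nonneg_nonneg mult_nonneg_nonneg) auto
  \<comment> \<open>Chosen so that the tail of the kernel,
    \<open>4 / \<kappa>^2 * (sqrt 2 * C)\<close>, is at most \<open>c0 / 4\<close>.\<close>
  define \<kappa> where "\<kappa> = sqrt (1 + 16 * sqrt 2 * C / c0)"
  have \<kappa>2: "\<kappa>\<^sup>2 = 1 + 16 * sqrt 2 * C / c0" using C c0 by (simp add: \<kappa>_def)
  have \<kappa>: "\<kappa> \<ge> 1" using C c0 by (simp add: \<kappa>_def)
  have \<kappa>_bound: "4 / \<kappa>\<^sup>2 * (sqrt 2 * C) \<le> c0 / 4"
    unfolding \<kappa>2 using C c0 by (simp add: field_simps add_pos_pos)
  \<comment> \<open>\<open>Q / R^2\<close> is the total factor of \<open>L / sqrt n\<close> from the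
    tails of both halves, each taken beyond \<open>R / 2 * sqrt n\<close>; the 16 combines the two
    halves, the factor 2 of the window bound and the 4 from halving the radius.\<close>
  define Q where "Q = 16 * sqrt 3 * C * \<kappa> * (1 + K)"
  have Q: "Q > 0" using C \<kappa> K by (simp add: Q_def)
  define R where "R = sqrt (1 + 8 * Q / c0)"
  have R2: "R\<^sup>2 = 1 + 8 * Q / c0" using Q c0 by (simp add: R_def)
  have R: "R > 0" using Q c0 by (simp add: R_def add_pos_pos)
  have R_bound: "Q / R\<^sup>2 \<le> c0 / 8"
    unfolding R2 using Q c0 by (simp add: field_simps add_pos_pos)
  \<comment> \<open>The second entry makes the Fourier error at most \<open>c0 / 2\<close>. Of the
    main term \<open>c0\<close>, a further \<open>c0 / 4\<close> goes to the kernel tail and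
    \<open>c0 / 8\<close> to the half sums, which leaves \<open>c0 / 8\<close>.\<close>
  define N where "N = max 3 ((2 * C2 / c0)\<^sup>2)"
  show thesis
  proof (rule that[of \<kappa> "c0 / 8" R N])
    show "\<kappa> > 0" "c0 / 8 > 0" "R > 0" using \<kappa> c0 R by auto
    fix P :: "'b measure" and U :: "'i \<Rightarrow> 'b \<Rightarrow> 'a" and I v a L
    assume "vector_summands P U I h v K" and v: "v0 \<le> v" and N: "N \<le> real (card I)"
      and L: "0 < L" "real (card I) \<le> L ^ 3" "L\<^sup>2 \<le> real (card I)" and a: "a\<^sup>2 \<le> real (card I)"
    interpret vector_summands P U I h v K by fact
    interpret Y: centered_summands P "\<lambda>i \<omega>. h (U i \<omega>)" I v K'
      unfolding K'_def by (rule real_summands[OF order_refl])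
    define n where "n = real (card I)"
    define x where "x = L / sqrt n"
    have n: "n \<ge> 3" "(2 * C2 / c0)\<^sup>2 \<le> n" using N by (auto simp: n_def N_def)
    have x: "x > 0" using L n by (simp add: x_def)
    have [measurable]: "(\<lambda>\<omega>. \<Sum>i\<in>J. U i \<omega>) \<in> borel_measurable P" if "J \<subseteq> I" for J
      by (rule sum_rv[OF that])
    have h[measurable]: "blinfun_apply h \<in> borel_measurable borel"
      by (intro borel_measurable_continuous_onI continuous_intros)
    let ?T = "\<lambda>J \<omega>. \<Sum>i\<in>J. U i \<omega>"
    let ?W = "{\<omega> \<in> space P. \<bar>blinfun_apply h (?T I \<omega>) - a\<bar> \<le> \<kappa> * L}"
    let ?G = "{\<omega> \<in> space P. \<bar>blinfun_apply h (?T I \<omega>) - a\<bar> \<le> \<kappa> * L \<and> norm (?T I \<omega>) \<le> R * sqrt n}"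
    define \<rho> where "\<rho> = R / 2 * sqrt n"
    have \<rho>: "\<rho> > 0" using R n by (simp add: \<rho>_def)
    let ?B = "\<lambda>J. {\<omega> \<in> space P. norm (?T J \<omega>) > \<rho> \<and> \<bar>blinfun_apply h (?T I \<omega>) - a\<bar> \<le> \<kappa> * L}"
    have "2 * C2 / c0 \<le> sqrt n"
      using n(2) by (rule real_le_rsqrt)
    then have "C2 / sqrt n \<le> c0 / 2"
      using n c0 by (simp add: field_simps)
    then have "c0 / 4 \<le> c0 - C2 / sqrt n - 4 / \<kappa>\<^sup>2 * (sqrt 2 * C)"
      using \<kappa>_bound by linarith
    then have "c0 / 4 * x \<le> (c0 - C2 / sqrt n - 4 / \<kappa>\<^sup>2 * (sqrt 2 * C)) * x"
      using x by (intro mult_right_mono) auto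
    also have "(c0 - C2 / sqrt n - 4 / \<kappa>\<^sup>2 * (sqrt 2 * C)) * x \<le> prob ?W"
      using Y.window_prob_lower[OF v0 v _ L a, of \<kappa>] \<kappa> n
      unfolding c0_def C2_def C_def n_def x_def blinfun.sum_right by simp
    finally have W: "c0 / 4 * x \<le> prob ?W" .
    have "card I div 2 \<le> card I" by simp
    then obtain J1 where J1: "J1 \<subseteq> I" "card J1 = card I div 2"
      by (rule obtain_subset_with_card_n)
    define J2 where "J2 = I - J1"
    have J: "J1 \<union> J2 = I" "J1 \<inter> J2 = {}" "J2 \<union> J1 = I" "J2 \<inter> J1 = {}" using J1 by (auto simp: J2_def)
    have cJ2: "card J2 = card I - card I div 2"
      unfolding J2_def using J1 fin by (simp add: card_Diff_subset finite_subset)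
    have n3: "3 \<le> card I" using n by (simp add: n_def)
    \<comment> \<open>With at least three summands either half still contains a third of them in
      spite of the rounding in \<open>card I div 2\<close>.\<close>
    have cards: "card I \<le> 3 * card J1" "1 \<le> card J1" "card I \<le> 3 * card J2" "1 \<le> card J2"
      using n3 unfolding J1(2) cJ2 by linarith+
    have \<kappa>L: "0 < \<kappa> * L" "real (card I) \<le> (\<kappa> * L) ^ 3"
    proof -
      show "0 < \<kappa> * L" using \<kappa> L by simp
      have "L ^ 3 \<le> (\<kappa> * L) ^ 3" using \<kappa> L by (intro power_mono) auto
      then show "real (card I) \<le> (\<kappa> * L) ^ 3" using L by linarith
    qed
    have half: "2 * sqrt 3 * C * (\<kappa> * L / sqrt n) * (n * (1 + K) / \<rho>\<^sup>2) = (Q / R\<^sup>2 * x) / 2"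
      using n R by (simp add: Q_def x_def \<rho>_def power_mult_distrib power_divide field_simps)
    have B1: "prob (?B J1) \<le> (Q / R\<^sup>2 * x) / 2"
      using window_and_half_tail[OF J(1,2) cards(3,4) v0 v \<kappa>L \<rho>, of a]
      unfolding half[symmetric] C_def K'_def n_def .
    have B2: "prob (?B J2) \<le> (Q / R\<^sup>2 * x) / 2"
      using window_and_half_tail[OF J(3,4) cards(1,2) v0 v \<kappa>L \<rho>, of a]
      unfolding half[symmetric] C_def K'_def n_def .
    have J12: "J1 \<subseteq> I" "J2 \<subseteq> I" using J by auto
    have split: "?T I \<omega> = ?T J1 \<omega> + ?T J2 \<omega>" for \<omega>
      unfolding J(1)[symmetric] using J12 fin J(2) by (intro sum.union_disjoint) (auto intro: finite_subset)
    have sets: "?G \<in> events" "?B J1 \<in> events" "?B J2 \<in> events"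
      using J12 by measurable
    have "?W \<subseteq> ?G \<union> (?B J1 \<union> ?B J2)"
    proof
      fix \<omega> assume \<omega>: "\<omega> \<in> ?W"
      show "\<omega> \<in> ?G \<union> (?B J1 \<union> ?B J2)"
      proof (cases "norm (?T I \<omega>) \<le> R * sqrt n")
        case False
        moreover have "norm (?T I \<omega>) \<le> norm (?T J1 \<omega>) + norm (?T J2 \<omega>)"
          unfolding split by (rule norm_triangle_ineq)
        ultimately have "norm (?T J1 \<omega>) > \<rho> \<or> norm (?T J2 \<omega>) > \<rho>" by (auto simp: \<rho>_def)
        then show ?thesis using \<omega> by blast
      qed (use \<omega> in auto)
    qed
    then have "prob ?W \<le> prob (?G \<union> (?B J1 \<union> ?B J2))"
      using sets by (intro finite_measure_mono) auto
    also have "\<dots> \<le> prob ?G + (prob (?B J1) + prob (?B J2))"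
      using sets by (intro order_trans[OF measure_Un_le] add_left_mono measure_Un_le) auto
    also have "\<dots> \<le> prob ?G + c0 / 8 * x"
      using B1 B2 mult_right_mono[OF R_bound less_imp_le[OF x]] by linarith
    finally have "c0 / 8 * x \<le> prob ?G" using W by simp
    then show "c0 / 8 * (L / sqrt (real (card I))) \<le> prob {\<omega> \<in> space P.
        \<bar>blinfun_apply h (?T I \<omega>) - a\<bar> \<le> \<kappa> * L \<and> norm (?T I \<omega>) \<le> R * sqrt (real (card I))}"
      by (simp add: x_def n_def)
  qed
qed

section \<open>Exponential tilting\<close>

text \<open>Both measures agree on rectangles by Tonelli. The point is that the density of the
  product is a product, so after exponential tilting it depends only on the sum of the
  coordinates.\<close>

lemma PiM_density:
  fixes \<mu> :: "'a measure" and w :: "'a \<Rightarrow> real"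
  assumes "prob_space \<mu>" and dens: "prob_space (density \<mu> (\<lambda>x. ennreal (w x)))"
    and w[measurable]: "w \<in> borel_measurable \<mu>" and w0: "\<And>x. 0 \<le> w x" and J: "finite J"
  shows "PiM J (\<lambda>_. density \<mu> (\<lambda>x. ennreal (w x))) = density (PiM J (\<lambda>_. \<mu>)) (\<lambda>x. ennreal (\<Prod>i\<in>J. w (x i)))"
proof -
  interpret \<mu>: prob_space \<mu> by fact
  interpret N: prob_space "density \<mu> (\<lambda>x. ennreal (w x))" by fact
  interpret P\<mu>: product_sigma_finite "\<lambda>_. \<mu>" ..
  interpret PN: product_sigma_finite "\<lambda>_. density \<mu> (\<lambda>x. ennreal (w x))" ..
  have [simp]: "sets (PiM J (\<lambda>_. density \<mu> (\<lambda>x. ennreal (w x)))) = sets (PiM J (\<lambda>_. \<mu>))"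
    by (intro sets_PiM_cong) auto
  have [measurable]: "(\<lambda>x. \<Prod>i\<in>J. w (x i)) \<in> borel_measurable (PiM J (\<lambda>_. \<mu>))"
    by measurable
  show ?thesis
  proof (rule PN.PiM_eqI[OF J, symmetric])
    fix A assume "\<And>i. i \<in> J \<Longrightarrow> A i \<in> sets (density \<mu> (\<lambda>x. ennreal (w x)))"
    then have A: "A i \<in> sets \<mu>" if "i \<in> J" for i using that by simp
    have PA[measurable]: "Pi\<^sub>E J A \<in> sets (PiM J (\<lambda>_. \<mu>))"
      using A by (intro sets_PiM_I_finite J)
    have "emeasure (density (PiM J (\<lambda>_. \<mu>)) (\<lambda>x. ennreal (\<Prod>i\<in>J. w (x i)))) (Pi\<^sub>E J A)
       = (\<integral>\<^sup>+x. ennreal (\<Prod>i\<in>J. w (x i)) * indicator (Pi\<^sub>E J A) x \<partial>PiM J (\<lambda>_. \<mu>))"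
      by (rule emeasure_density) simp_all
    also have "\<dots> = (\<integral>\<^sup>+x. (\<Prod>i\<in>J. ennreal (w (x i)) * indicator (A i) (x i)) \<partial>PiM J (\<lambda>_. \<mu>))"
    proof (rule nn_integral_cong)
      fix x assume x: "x \<in> space (PiM J (\<lambda>_. \<mu>))"
      have "indicator (Pi\<^sub>E J A) x = (\<Prod>i\<in>J. indicator (A i) (x i) :: ennreal)"
      proof (cases "\<forall>i\<in>J. x i \<in> A i")
        case True
        then show ?thesis using x by (auto simp: space_PiM PiE_def Pi_def)
      next
        case False
        then obtain i where "i \<in> J" "x i \<notin> A i" by blast
        then have "(\<Prod>i\<in>J. indicator (A i) (x i) :: ennreal) = 0" using J by (intro prod_zero bexI[of _ i]) auto
        then show ?thesis using \<open>i \<in> J\<close> \<open>x i \<notin> A i\<close> by (auto simp: indicator_def PiE_def Pi_def)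
      qed
      then show "ennreal (\<Prod>i\<in>J. w (x i)) * indicator (Pi\<^sub>E J A) x = (\<Prod>i\<in>J. ennreal (w (x i)) * indicator (A i) (x i))"
        using w0 by (simp add: prod.distrib prod_ennreal)
    qed
    also have "\<dots> = (\<Prod>i\<in>J. \<integral>\<^sup>+x. ennreal (w x) * indicator (A i) x \<partial>\<mu>)"
    proof (rule P\<mu>.product_nn_integral_prod[OF J])
      fix i assume "i \<in> J"
      then have [measurable]: "A i \<in> sets \<mu>" by (rule A)
      show "(\<lambda>x. ennreal (w x) * indicator (A i) x) \<in> borel_measurable \<mu>" by measurable
    qed
    also have "\<dots> = (\<Prod>i\<in>J. emeasure (density \<mu> (\<lambda>x. ennreal (w x))) (A i))"
      using A by (intro prod.cong refl emeasure_density[symmetric]) auto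
    finally show "emeasure (density (PiM J (\<lambda>_. \<mu>)) (\<lambda>x. ennreal (\<Prod>i\<in>J. w (x i)))) (Pi\<^sub>E J A)
      = (\<Prod>i\<in>J. emeasure (density \<mu> (\<lambda>x. ennreal (w x))) (A i))" .
  qed simp
qed

lemma indep_vars_PiM_coordinates:
  assumes "\<And>i. i \<in> J \<Longrightarrow> prob_space (N i)" and "J \<noteq> {}"
  shows "prob_space.indep_vars (PiM J N) N (\<lambda>i x. x i) J"
proof -
  interpret prob_space "PiM J N" using assms(1) by (rule prob_space_PiM)
  have "distr (PiM J N) (PiM J N) (\<lambda>x. \<lambda>i\<in>J. x i) = distr (PiM J N) (PiM J N) (\<lambda>x. x)"
    by (intro distr_cong) (auto simp: space_PiM)
  also have "\<dots> = PiM J N" by simp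
  also have "\<dots> = PiM J (\<lambda>i. distr (PiM J N) (N i) (\<lambda>x. x i))"
    using assms(1) by (intro PiM_cong refl distr_PiM_component[symmetric])
  finally show ?thesis
    by (subst indep_vars_iff_distr_eq_PiM'[OF assms(2)]) auto
qed

section \<open>Exponential moments and the moments of the tilted law\<close>

lemma abs_exp_taylor1_le: "\<bar>exp y - 1 - y\<bar> \<le> y\<^sup>2 * exp \<bar>y\<bar>" for y :: real
proof -
  obtain t where t: "\<bar>t\<bar> \<le> \<bar>y\<bar>" "exp y = (\<Sum>m<2. y ^ m / fact m) + exp t / fact 2 * y ^ 2"
    using Maclaurin_exp_le[of y 2] by blast
  then have "\<bar>exp y - 1 - y\<bar> = y\<^sup>2 * (exp t / 2)"
    by (simp add: numeral_2_eq_2)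
  also have "\<dots> \<le> y\<^sup>2 * exp \<bar>y\<bar>"
  proof (intro mult_left_mono)
    have "exp t \<le> exp \<bar>y\<bar>" using t(1) by simp
    then show "exp t / 2 \<le> exp \<bar>y\<bar>" using exp_gt_zero[of "\<bar>y\<bar>"] by linarith
  qed simp
  finally show ?thesis .
qed

text \<open>The fourth-order remainder is nonnegative, so only the sign of the cubic term has to be
  sacrificed. The lower bound carries no exponential factor.\<close>

lemma exp_ge_taylor3: "1 + y + y\<^sup>2 / 2 - \<bar>y\<bar> ^ 3 / 6 \<le> exp y" for y :: real
proof -
  obtain t where t: "\<bar>t\<bar> \<le> \<bar>y\<bar>" "exp y = (\<Sum>m<4. y ^ m / fact m) + exp t / fact 4 * y ^ 4"
    using Maclaurin_exp_le[of y 4] by blast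
  have "(\<Sum>m<4. y ^ m / fact m) = 1 + y + y\<^sup>2 / 2 + y ^ 3 / 6"
    by (simp add: eval_nat_numeral)
  moreover have "0 \<le> exp t / fact 4 * y ^ 4" by simp
  moreover have "- (\<bar>y\<bar> ^ 3) \<le> y ^ 3" unfolding power_abs[symmetric] by linarith
  ultimately show ?thesis using t(2) by linarith
qed

locale tilting = prob_space \<mu> for \<mu> :: "'a::{real_inner, banach, second_countable_topology} measure" +
  fixes h :: "'a \<Rightarrow>\<^sub>L real" and t0 :: real
  assumes sets_\<mu>[measurable_cong, simp]: "sets \<mu> = sets borel"
    and t0: "0 < t0"
    and exp_cube: "integrable \<mu> (\<lambda>x. norm x ^ 3 * exp (t0 * \<bar>blinfun_apply h x\<bar>))"
    and mean: "(\<integral>x. x \<partial>\<mu>) = 0"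
begin

lemma space_\<mu>: "space \<mu> = UNIV"
  using sets_eq_imp_space_eq[OF sets_\<mu>] by simp

lemma h_measurable[measurable]: "blinfun_apply h \<in> borel_measurable borel"
  by (intro borel_measurable_continuous_onI continuous_intros)

text \<open>One integrable majorant for all \<open>norm x ^ k * exp (t * |h x|)\<close> with
  \<open>k <= 3\<close> and \<open>0 <= t <= t0\<close>. The constant covers the unit ball, where
  lower powers of the norm exceed higher ones but \<open>|h x| <= norm h\<close>.\<close>

definition dom :: "'a \<Rightarrow> real" where
  "dom x = exp (t0 * norm h) + norm x ^ 3 * exp (t0 * \<bar>blinfun_apply h x\<bar>)"

definition D :: real where "D = (\<integral>x. dom x \<partial>\<mu>)"

lemma dom_integrable: "integrable \<mu> dom"
  unfolding dom_def using exp_cube by (intro Bochner_Integration.integrable_add) auto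

lemma dom_nonneg: "0 \<le> dom x"
  by (simp add: dom_def)

lemma D_nonneg: "0 \<le> D"
  unfolding D_def using dom_nonneg by simp

lemma dom_bound:
  assumes "k \<le> 3" "0 \<le> t" "t \<le> t0"
  shows "norm x ^ k * exp (t * \<bar>blinfun_apply h x\<bar>) \<le> dom x"
proof (cases "norm x \<le> 1")
  case True
  have "\<bar>blinfun_apply h x\<bar> \<le> norm h * norm x" using norm_blinfun[of h x] by simp
  also have "\<dots> \<le> norm h * 1" using True by (intro mult_left_mono) auto
  finally have "t * \<bar>blinfun_apply h x\<bar> \<le> t0 * norm h" using assms by (intro mult_mono) auto
  then have "norm x ^ k * exp (t * \<bar>blinfun_apply h x\<bar>) \<le> 1 * exp (t0 * norm h)"
    using True by (intro mult_mono power_le_one) auto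
  then show ?thesis by (simp add: dom_def add_increasing2)
next
  case False
  then have "norm x ^ k * exp (t * \<bar>blinfun_apply h x\<bar>) \<le> norm x ^ 3 * exp (t0 * \<bar>blinfun_apply h x\<bar>)"
    using assms by (intro mult_mono power_increasing) (auto intro: mult_right_mono)
  then show ?thesis by (simp add: dom_def add_increasing)
qed

lemma integrable_dominated:
  fixes f :: "'a \<Rightarrow> 'c::{banach, second_countable_topology}"
  assumes [measurable]: "f \<in> borel_measurable borel" and "\<And>x. norm (f x) \<le> c * dom x"
  shows "integrable \<mu> f" "norm (\<integral>x. f x \<partial>\<mu>) \<le> c * D"
proof -
  show int: "integrable \<mu> f"
    by (rule Bochner_Integration.integrable_bound[OF integrable_mult_right[OF dom_integrable, of c]])
      (auto intro!: AE_I2 order_trans[OF assms(2)])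
  have "norm (\<integral>x. f x \<partial>\<mu>) \<le> (\<integral>x. c * dom x \<partial>\<mu>)"
    by (rule norm_integral_le[OF int integrable_mult_right[OF dom_integrable] assms(2)])
  then show "norm (\<integral>x. f x \<partial>\<mu>) \<le> c * D" by (simp add: D_def)
qed

lemma h_le: "\<bar>blinfun_apply h x\<bar> \<le> norm h * norm x"
  using norm_blinfun[of h x] by simp

lemma exp_le: "0 \<le> t \<Longrightarrow> exp (t * blinfun_apply h x) \<le> exp (t * \<bar>blinfun_apply h x\<bar>)"
  by (simp add: mult_left_mono)

definition mgf :: "real \<Rightarrow> real" where "mgf t = (\<integral>x. exp (t * blinfun_apply h x) \<partial>\<mu>)"

definition a0 :: 'a where "a0 = (\<integral>x. blinfun_apply h x *\<^sub>R x \<partial>\<mu>)"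

text \<open>The intended value of the rate at \<open>a0\<close>: the supremum defining it is to be
  attained at \<open>h\<close>, where \<open>h a0 = 2 * r\<close> and the logarithm of the Gaussian
  Laplace transform is \<open>r\<close>.\<close>

definition r :: real where "r = (\<integral>x. (blinfun_apply h x)\<^sup>2 \<partial>\<mu>) / 2"

lemma integrable_id: "integrable \<mu> (\<lambda>x. x)"
  using dom_bound[of 1 0] t0 by (intro integrable_dominated(1)[where c = 1]) auto

lemma integrable_h: "integrable \<mu> (blinfun_apply h)" and mean_h: "(\<integral>x. blinfun_apply h x \<partial>\<mu>) = 0"
proof -
  show "integrable \<mu> (blinfun_apply h)"
    by (rule integrable_bounded_linear[OF blinfun.bounded_linear_right integrable_id])
  show "(\<integral>x. blinfun_apply h x \<partial>\<mu>) = 0"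
    using integral_bounded_linear[OF blinfun.bounded_linear_right integrable_id, of h] mean by simp
qed

lemma integrable_h2: "integrable \<mu> (\<lambda>x. (blinfun_apply h x)\<^sup>2)"
proof (rule integrable_dominated(1)[where c = "(norm h)\<^sup>2"])
  fix x
  have "(blinfun_apply h x)\<^sup>2 \<le> (norm h * norm x)\<^sup>2"
    using h_le[of x] by (metis abs_ge_zero power2_abs power_mono)
  also have "\<dots> \<le> (norm h)\<^sup>2 * dom x"
    unfolding power_mult_distrib using dom_bound[of 2 0 x] t0 by (intro mult_left_mono) auto
  finally show "norm ((blinfun_apply h x)\<^sup>2) \<le> (norm h)\<^sup>2 * dom x" by simp
qed measurable

lemma integrable_hx: "integrable \<mu> (\<lambda>x. blinfun_apply h x *\<^sub>R x)"
proof (rule integrable_dominated(1)[where c = "norm h"])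
  fix x
  have "norm (blinfun_apply h x *\<^sub>R x) \<le> (norm h * norm x) * norm x"
    using h_le[of x] by (simp add: mult_right_mono)
  also have "\<dots> = norm h * norm x ^ 2" by (simp add: power2_eq_square)
  also have "\<dots> \<le> norm h * dom x"
    using dom_bound[of 2 0 x] t0 by (intro mult_left_mono) auto
  finally show "norm (blinfun_apply h x *\<^sub>R x) \<le> norm h * dom x" .
qed measurable

context
  fixes t :: real
  assumes t: "0 \<le> t" "t \<le> t0"
begin

lemma tilted_integrable:
  fixes g :: "'a \<Rightarrow> 'c::{banach, second_countable_topology}"
  assumes [measurable]: "g \<in> borel_measurable borel" and g: "\<And>x. norm (g x) \<le> c * norm x ^ k" and "k \<le> 3" "0 \<le> c"
  shows "integrable \<mu> (\<lambda>x. exp (t * blinfun_apply h x) *\<^sub>R g x)"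
    "norm (\<integral>x. exp (t * blinfun_apply h x) *\<^sub>R g x \<partial>\<mu>) \<le> c * D"
proof -
  have bd: "norm (exp (t * blinfun_apply h x) *\<^sub>R g x) \<le> c * dom x" for x
  proof -
    have "norm (exp (t * blinfun_apply h x) *\<^sub>R g x) \<le> exp (t * \<bar>blinfun_apply h x\<bar>) * (c * norm x ^ k)"
      using exp_le[OF t(1), of x] g[of x] by (simp add: mult_mono)
    also have "\<dots> \<le> c * dom x"
      using dom_bound[OF \<open>k \<le> 3\<close> t, of x] \<open>0 \<le> c\<close> mult_left_mono by (simp add: mult_ac)
    finally show ?thesis .
  qed
  show "integrable \<mu> (\<lambda>x. exp (t * blinfun_apply h x) *\<^sub>R g x)"
    "norm (\<integral>x. exp (t * blinfun_apply h x) *\<^sub>R g x \<partial>\<mu>) \<le> c * D"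
    using integrable_dominated[OF _ bd] by auto
qed

lemma exp_integrable: "integrable \<mu> (\<lambda>x. exp (t * blinfun_apply h x))"
  using tilted_integrable(1)[of "\<lambda>_. 1::real" 1 0] by simp

text \<open>Jensen with mean zero. Thanks to this bound, normalising by \<open>mgf t\<close> never
  increases a norm, and estimates may be proved for the unnormalised integrals.\<close>

lemma mgf_ge_1: "1 \<le> mgf t"
proof -
  have "(\<integral>x. 1 + t * blinfun_apply h x \<partial>\<mu>) \<le> mgf t"
    unfolding mgf_def using integrable_h exp_integrable by (intro integral_mono) auto
  then show ?thesis using integrable_h by (simp add: mean_h prob_space)
qed

lemma mgf_lower_taylor: "1 + r * t\<^sup>2 - norm h ^ 3 * D * t ^ 3 \<le> mgf t"
proof -
  have cube: "integrable \<mu> (\<lambda>x. \<bar>blinfun_apply h x\<bar> ^ 3)" "norm (\<integral>x. \<bar>blinfun_apply h x\<bar> ^ 3 \<partial>\<mu>) \<le> norm h ^ 3 * D"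
  proof -
    have "norm (\<bar>blinfun_apply h x\<bar> ^ 3) \<le> norm h ^ 3 * dom x" for x
    proof -
      have "\<bar>blinfun_apply h x\<bar> ^ 3 \<le> (norm h * norm x) ^ 3" using h_le[of x] by (intro power_mono) auto
      also have "\<dots> \<le> norm h ^ 3 * dom x"
        unfolding power_mult_distrib using dom_bound[of 3 0 x] t0 by (intro mult_left_mono) auto
      finally show ?thesis by simp
    qed
    then show "integrable \<mu> (\<lambda>x. \<bar>blinfun_apply h x\<bar> ^ 3)" "norm (\<integral>x. \<bar>blinfun_apply h x\<bar> ^ 3 \<partial>\<mu>) \<le> norm h ^ 3 * D"
      by (intro integrable_dominated; measurable)+
  qed
  have "(\<integral>x. 1 + t * blinfun_apply h x + (t\<^sup>2 / 2) * (blinfun_apply h x)\<^sup>2 - (t ^ 3 / 6) * \<bar>blinfun_apply h x\<bar> ^ 3 \<partial>\<mu>) \<le> mgf t"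
    unfolding mgf_def
  proof (rule integral_mono[OF _ exp_integrable])
    show "integrable \<mu> (\<lambda>x. 1 + t * blinfun_apply h x + (t\<^sup>2 / 2) * (blinfun_apply h x)\<^sup>2 - (t ^ 3 / 6) * \<bar>blinfun_apply h x\<bar> ^ 3)"
      using integrable_h integrable_h2 cube by (intro Bochner_Integration.integrable_diff Bochner_Integration.integrable_add integrable_mult_right) auto
    fix x
    show "1 + t * blinfun_apply h x + (t\<^sup>2 / 2) * (blinfun_apply h x)\<^sup>2 - (t ^ 3 / 6) * \<bar>blinfun_apply h x\<bar> ^ 3 \<le> exp (t * blinfun_apply h x)"
      using exp_ge_taylor3[of "t * blinfun_apply h x"] t by (simp add: power_mult_distrib abs_mult)
  qed
  also have "(\<integral>x. 1 + t * blinfun_apply h x + (t\<^sup>2 / 2) * (blinfun_apply h x)\<^sup>2 - (t ^ 3 / 6) * \<bar>blinfun_apply h x\<bar> ^ 3 \<partial>\<mu>)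
     = 1 + t\<^sup>2 * r - (t ^ 3 / 6) * (\<integral>x. \<bar>blinfun_apply h x\<bar> ^ 3 \<partial>\<mu>)"
    using integrable_h integrable_h2 cube by (simp add: mean_h prob_space r_def)
  finally have 1: "1 + t\<^sup>2 * r - (t ^ 3 / 6) * (\<integral>x. \<bar>blinfun_apply h x\<bar> ^ 3 \<partial>\<mu>) \<le> mgf t" .
  have "(\<integral>x. \<bar>blinfun_apply h x\<bar> ^ 3 \<partial>\<mu>) \<le> norm h ^ 3 * D" using cube(2) by (simp add: abs_le_iff)
  then have "(t ^ 3 / 6) * (\<integral>x. \<bar>blinfun_apply h x\<bar> ^ 3 \<partial>\<mu>) \<le> (t ^ 3 / 6) * (norm h ^ 3 * D)"
    using t by (intro mult_left_mono) auto
  also have "\<dots> \<le> t ^ 3 * (norm h ^ 3 * D)"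
    using t D_nonneg by (intro mult_right_mono) auto
  finally show ?thesis using 1 by (simp add: mult_ac)
qed

lemma mgf_upper: "mgf t \<le> 1 + (norm h)\<^sup>2 * D * t\<^sup>2"
proof -
  have "norm (exp (t * blinfun_apply h x) - 1 - t * blinfun_apply h x) \<le> (t\<^sup>2 * (norm h)\<^sup>2) * dom x" for x
  proof -
    have "\<bar>exp (t * blinfun_apply h x) - 1 - t * blinfun_apply h x\<bar> \<le> (t * \<bar>blinfun_apply h x\<bar>)\<^sup>2 * exp (t * \<bar>blinfun_apply h x\<bar>)"
      using abs_exp_taylor1_le[of "t * blinfun_apply h x"] t by (simp add: abs_mult power_mult_distrib)
    also have "\<dots> \<le> (t * (norm h * norm x))\<^sup>2 * exp (t * \<bar>blinfun_apply h x\<bar>)"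
      using h_le[of x] t by (intro mult_right_mono power_mono mult_left_mono) auto
    also have "\<dots> = (t\<^sup>2 * (norm h)\<^sup>2) * (norm x ^ 2 * exp (t * \<bar>blinfun_apply h x\<bar>))"
      by (simp add: power_mult_distrib)
    also have "\<dots> \<le> (t\<^sup>2 * (norm h)\<^sup>2) * dom x"
      using dom_bound[of 2 t x] t by (intro mult_left_mono) auto
    finally show ?thesis by simp
  qed
  then have "norm (\<integral>x. exp (t * blinfun_apply h x) - 1 - t * blinfun_apply h x \<partial>\<mu>) \<le> (t\<^sup>2 * (norm h)\<^sup>2) * D"
    by (intro integrable_dominated(2)) auto
  moreover have "(\<integral>x. exp (t * blinfun_apply h x) - 1 - t * blinfun_apply h x \<partial>\<mu>) = mgf t - 1"
    using integrable_h exp_integrable by (simp add: mean_h prob_space mgf_def)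
  ultimately show ?thesis by (simp add: abs_le_iff mult_ac)
qed

definition tilted :: "'a measure" where
  "tilted = density \<mu> (\<lambda>x. ennreal (exp (t * blinfun_apply h x) / mgf t))"

lemma sets_tilted[measurable_cong, simp]: "sets tilted = sets borel"
  by (simp add: tilted_def)

lemma prob_space_tilted: "prob_space tilted"
proof
  have "emeasure tilted (space tilted) = (\<integral>\<^sup>+x. ennreal (exp (t * blinfun_apply h x) / mgf t) \<partial>\<mu>)"
    unfolding tilted_def by (subst emeasure_density) (auto intro!: nn_integral_cong simp: space_\<mu>)
  also have "\<dots> = ennreal (\<integral>x. exp (t * blinfun_apply h x) / mgf t \<partial>\<mu>)"
    using exp_integrable mgf_ge_1 by (intro nn_integral_eq_integral) auto
  also have "(\<integral>x. exp (t * blinfun_apply h x) / mgf t \<partial>\<mu>) = 1"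
    using mgf_ge_1 by (simp add: mgf_def[symmetric])
  finally show "emeasure tilted (space tilted) = 1" by simp
qed

lemma tilted_moment:
  fixes g :: "'a \<Rightarrow> 'c::{banach, second_countable_topology}"
  assumes g[measurable]: "g \<in> borel_measurable borel" and bd: "\<And>x. norm (g x) \<le> c * norm x ^ k" and "k \<le> 3" "0 \<le> c"
  shows "integrable tilted g" "(\<integral>x. g x \<partial>tilted) = (\<integral>x. exp (t * blinfun_apply h x) *\<^sub>R g x \<partial>\<mu>) /\<^sub>R mgf t"
    "norm (\<integral>x. g x \<partial>tilted) \<le> c * D"
proof -
  have e: "(exp (t * blinfun_apply h x) / mgf t) *\<^sub>R g x = (exp (t * blinfun_apply h x) *\<^sub>R g x) /\<^sub>R mgf t" for x
    by (simp add: divide_inverse mult.commute)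
  have "integrable \<mu> (\<lambda>x. (exp (t * blinfun_apply h x) / mgf t) *\<^sub>R g x)"
    unfolding e by (intro integrable_scaleR_right tilted_integrable(1)[OF assms])
  then show "integrable tilted g"
    unfolding tilted_def using mgf_ge_1 by (subst integrable_density) auto
  show eq: "(\<integral>x. g x \<partial>tilted) = (\<integral>x. exp (t * blinfun_apply h x) *\<^sub>R g x \<partial>\<mu>) /\<^sub>R mgf t"
  proof -
    have "(\<integral>x. g x \<partial>tilted) = (\<integral>x. (exp (t * blinfun_apply h x) / mgf t) *\<^sub>R g x \<partial>\<mu>)"
      unfolding tilted_def using mgf_ge_1 by (subst integral_density) auto
    then show ?thesis unfolding e by (simp del: scaleR_scaleR)
  qed
  have "norm (\<integral>x. g x \<partial>tilted) = norm (\<integral>x. exp (t * blinfun_apply h x) *\<^sub>R g x \<partial>\<mu>) / mgf t"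
    unfolding eq using mgf_ge_1 by (simp add: divide_inverse_commute)
  also have "\<dots> \<le> norm (\<integral>x. exp (t * blinfun_apply h x) *\<^sub>R g x \<partial>\<mu>)"
    using mgf_ge_1 by (simp add: divide_le_eq mult_le_cancel_left1)
  also have "\<dots> \<le> c * D" by (rule tilted_integrable(2)[OF assms])
  finally show "norm (\<integral>x. g x \<partial>tilted) \<le> c * D" .
qed

definition tmean :: 'a where "tmean = (\<integral>x. x \<partial>tilted)"

text \<open>Multiplying by \<open>mgf t >= 1\<close> avoids a quotient: the unnormalised difference
  is \<open>E ((exp (t * h x) - 1 - t * h x) x)\<close> minus \<open>(mgf t - 1) * t * a0\<close>.
  The Taylor remainder supplies two powers of the norm and the vector a third, which is the weighted
  moment assumed finite.\<close>

lemma tmean_approx: "norm (tmean - t *\<^sub>R a0) \<le> (norm h)\<^sup>2 * D * (1 + t * norm a0) * t\<^sup>2"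
proof -
  have ix: "integrable \<mu> (\<lambda>x. exp (t * blinfun_apply h x) *\<^sub>R x)"
    by (rule tilted_integrable(1)[of "\<lambda>x. x" 1 1]) auto
  have "norm ((exp (t * blinfun_apply h x) - 1 - t * blinfun_apply h x) *\<^sub>R x) \<le> (t\<^sup>2 * (norm h)\<^sup>2) * dom x" for x
  proof -
    have "\<bar>exp (t * blinfun_apply h x) - 1 - t * blinfun_apply h x\<bar> \<le> (t * \<bar>blinfun_apply h x\<bar>)\<^sup>2 * exp (t * \<bar>blinfun_apply h x\<bar>)"
      using abs_exp_taylor1_le[of "t * blinfun_apply h x"] t by (simp add: abs_mult power_mult_distrib)
    also have "\<dots> \<le> (t * (norm h * norm x))\<^sup>2 * exp (t * \<bar>blinfun_apply h x\<bar>)"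
      using h_le[of x] t by (intro mult_right_mono power_mono mult_left_mono) auto
    finally have "norm ((exp (t * blinfun_apply h x) - 1 - t * blinfun_apply h x) *\<^sub>R x)
        \<le> (t * (norm h * norm x))\<^sup>2 * exp (t * \<bar>blinfun_apply h x\<bar>) * norm x"
      by (simp add: mult_right_mono)
    also have "\<dots> = (t\<^sup>2 * (norm h)\<^sup>2) * (norm x ^ 3 * exp (t * \<bar>blinfun_apply h x\<bar>))"
      by (simp add: power_mult_distrib power2_eq_square power3_eq_cube)
    also have "\<dots> \<le> (t\<^sup>2 * (norm h)\<^sup>2) * dom x"
      using dom_bound[of 3 t x] t by (intro mult_left_mono) auto
    finally show ?thesis .
  qed
  then have 1: "norm (\<integral>x. (exp (t * blinfun_apply h x) - 1 - t * blinfun_apply h x) *\<^sub>R x \<partial>\<mu>) \<le> (t\<^sup>2 * (norm h)\<^sup>2) * D"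
    by (intro integrable_dominated(2)) auto
  have "(\<integral>x. (exp (t * blinfun_apply h x) - 1 - t * blinfun_apply h x) *\<^sub>R x \<partial>\<mu>)
    = (\<integral>x. exp (t * blinfun_apply h x) *\<^sub>R x - x - t *\<^sub>R (blinfun_apply h x *\<^sub>R x) \<partial>\<mu>)"
    by (simp add: scaleR_left_diff_distrib)
  also have "\<dots> = (\<integral>x. exp (t * blinfun_apply h x) *\<^sub>R x \<partial>\<mu>) - t *\<^sub>R a0"
    using ix integrable_id integrable_hx by (simp add: mean a0_def del: scaleR_scaleR)
  also have "(\<integral>x. exp (t * blinfun_apply h x) *\<^sub>R x \<partial>\<mu>) = mgf t *\<^sub>R tmean"
    unfolding tmean_def using mgf_ge_1 tilted_moment(2)[of "\<lambda>x. x" 1 1] by simp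
  finally have eq: "mgf t *\<^sub>R (tmean - t *\<^sub>R a0)
    = (\<integral>x. (exp (t * blinfun_apply h x) - 1 - t * blinfun_apply h x) *\<^sub>R x \<partial>\<mu>) - (mgf t - 1) *\<^sub>R (t *\<^sub>R a0)"
    by (simp add: algebra_simps)
  have "norm (tmean - t *\<^sub>R a0) \<le> mgf t * norm (tmean - t *\<^sub>R a0)"
    using mgf_ge_1 by (simp add: mult_le_cancel_right1)
  also have "\<dots> = norm (mgf t *\<^sub>R (tmean - t *\<^sub>R a0))" using mgf_ge_1 by simp
  also have "\<dots> \<le> (t\<^sup>2 * (norm h)\<^sup>2) * D + norm ((mgf t - 1) *\<^sub>R (t *\<^sub>R a0))"
    unfolding eq using 1 by (intro order_trans[OF norm_triangle_ineq4] add_right_mono)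
  also have "norm ((mgf t - 1) *\<^sub>R (t *\<^sub>R a0)) \<le> ((norm h)\<^sup>2 * D * t\<^sup>2) * (t * norm a0)"
  proof -
    have "(mgf t - 1) * (t * norm a0) \<le> ((norm h)\<^sup>2 * D * t\<^sup>2) * (t * norm a0)"
      using mgf_upper t by (intro mult_right_mono) auto
    then show ?thesis using mgf_ge_1 t by (simp add: mult.assoc)
  qed
  finally show ?thesis by (simp add: algebra_simps)
qed

text \<open>From \<open>exp (t * h x) >= 1 + t * h x\<close>, tilting changes the second moment
  along \<open>h\<close> downwards by at most \<open>t\<close> times a third moment.\<close>

lemma tilted_h2_lower: "2 * r - norm h ^ 3 * D * t \<le> mgf t * (\<integral>x. (blinfun_apply h x)\<^sup>2 \<partial>tilted)"
proof -
  have h2: "norm ((blinfun_apply h x)\<^sup>2) \<le> (norm h)\<^sup>2 * norm x ^ 2" for x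
    using h_le[of x] unfolding power_mult_distrib[symmetric] by (simp add: abs_le_square_iff[symmetric] abs_mult)
  have n3: "integrable \<mu> (\<lambda>x. norm x ^ 3)" "norm (\<integral>x. norm x ^ 3 \<partial>\<mu>) \<le> 1 * D"
    using dom_bound[of 3 0] t0 by (intro integrable_dominated[where c = 1]; simp)+
  have "2 * r - t * norm h ^ 3 * (\<integral>x. norm x ^ 3 \<partial>\<mu>) = (\<integral>x. (blinfun_apply h x)\<^sup>2 - t * norm h ^ 3 * norm x ^ 3 \<partial>\<mu>)"
    using integrable_h2 n3 by (simp add: r_def)
  also have "\<dots> \<le> (\<integral>x. exp (t * blinfun_apply h x) *\<^sub>R (blinfun_apply h x)\<^sup>2 \<partial>\<mu>)"
  proof (rule integral_mono)
    show "integrable \<mu> (\<lambda>x. (blinfun_apply h x)\<^sup>2 - t * norm h ^ 3 * norm x ^ 3)"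
      using integrable_h2 n3 by simp
    show "integrable \<mu> (\<lambda>x. exp (t * blinfun_apply h x) *\<^sub>R (blinfun_apply h x)\<^sup>2)"
      using h2 by (intro tilted_integrable(1)[where c = "(norm h)\<^sup>2" and k = 2]) auto
    fix x
    have "\<bar>blinfun_apply h x\<bar> ^ 3 \<le> norm h ^ 3 * norm x ^ 3"
      unfolding power_mult_distrib[symmetric] using h_le[of x] by (intro power_mono) auto
    then have "t * \<bar>blinfun_apply h x\<bar> ^ 3 \<le> t * (norm h ^ 3 * norm x ^ 3)"
      using t by (intro mult_left_mono) auto
    moreover have "- (t * \<bar>blinfun_apply h x\<bar> ^ 3) \<le> t * blinfun_apply h x ^ 3"
    proof -
      have "t * - (\<bar>blinfun_apply h x\<bar> ^ 3) \<le> t * blinfun_apply h x ^ 3"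
        unfolding power_abs[symmetric] using t by (intro mult_left_mono) linarith+
      then show ?thesis by simp
    qed
    moreover have "(1 + t * blinfun_apply h x) * (blinfun_apply h x)\<^sup>2 \<le> exp (t * blinfun_apply h x) * (blinfun_apply h x)\<^sup>2"
      by (intro mult_right_mono exp_ge_add_one_self) auto
    moreover have "(1 + t * blinfun_apply h x) * (blinfun_apply h x)\<^sup>2 = (blinfun_apply h x)\<^sup>2 + t * blinfun_apply h x ^ 3"
      by (simp add: algebra_simps power2_eq_square power3_eq_cube)
    ultimately show "(blinfun_apply h x)\<^sup>2 - t * norm h ^ 3 * norm x ^ 3 \<le> exp (t * blinfun_apply h x) *\<^sub>R (blinfun_apply h x)\<^sup>2"
      by (simp add: mult.assoc)
  qed
  also have "\<dots> = mgf t * (\<integral>x. (blinfun_apply h x)\<^sup>2 \<partial>tilted)"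
    using tilted_moment(2)[of "\<lambda>x. (blinfun_apply h x)\<^sup>2" "(norm h)\<^sup>2" 2] h2 mgf_ge_1 by simp
  finally have "2 * r - t * norm h ^ 3 * (\<integral>x. norm x ^ 3 \<partial>\<mu>) \<le> mgf t * (\<integral>x. (blinfun_apply h x)\<^sup>2 \<partial>tilted)" .
  moreover have "t * norm h ^ 3 * (\<integral>x. norm x ^ 3 \<partial>\<mu>) \<le> t * norm h ^ 3 * D"
    using n3 t by (intro mult_left_mono) auto
  ultimately show ?thesis by (simp add: mult_ac)
qed

lemma tilted_variance:
  "(\<integral>x. (blinfun_apply h (x - tmean))\<^sup>2 \<partial>tilted) = (\<integral>x. (blinfun_apply h x)\<^sup>2 \<partial>tilted) - (blinfun_apply h tmean)\<^sup>2"
proof -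
  interpret T: prob_space tilted by (rule prob_space_tilted)
  have ix: "integrable tilted (\<lambda>x. x)"
    by (rule tilted_moment(1)[of _ 1 1]) auto
  have ih: "integrable tilted (blinfun_apply h)"
    by (rule integrable_bounded_linear[OF blinfun.bounded_linear_right ix])
  have mh: "(\<integral>x. blinfun_apply h x \<partial>tilted) = blinfun_apply h tmean"
    unfolding tmean_def using integral_bounded_linear[OF blinfun.bounded_linear_right ix, of h] by simp
  have h2: "norm ((blinfun_apply h x)\<^sup>2) \<le> (norm h)\<^sup>2 * norm x ^ 2" for x
    using h_le[of x] unfolding power_mult_distrib[symmetric] by (simp add: abs_le_square_iff[symmetric] abs_mult)
  have ih2: "integrable tilted (\<lambda>x. (blinfun_apply h x)\<^sup>2)"
    using h2 by (intro tilted_moment(1)[where c = "(norm h)\<^sup>2" and k = 2]) auto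
  have "(\<integral>x. (blinfun_apply h (x - tmean))\<^sup>2 \<partial>tilted)
    = (\<integral>x. (blinfun_apply h x)\<^sup>2 - 2 * blinfun_apply h tmean * blinfun_apply h x + (blinfun_apply h tmean)\<^sup>2 \<partial>tilted)"
    by (simp add: blinfun.diff_right power2_diff algebra_simps)
  also have "\<dots> = (\<integral>x. (blinfun_apply h x)\<^sup>2 \<partial>tilted) - (blinfun_apply h tmean)\<^sup>2"
    using ih ih2 by (simp add: mh T.prob_space power2_eq_square)
  finally show ?thesis .
qed

lemma tilted_centered_cube:
  "integrable tilted (\<lambda>x. norm (x - tmean) ^ 3)"
  "(\<integral>x. norm (x - tmean) ^ 3 \<partial>tilted) \<le> 8 * (D + norm tmean ^ 3)"
proof -
  interpret T: prob_space tilted by (rule prob_space_tilted)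
  have le: "norm (x - tmean) ^ 3 \<le> 8 * (norm x ^ 3 + norm tmean ^ 3)" for x
  proof -
    have "norm (x - tmean) \<le> 2 * max (norm x) (norm tmean)"
      using norm_triangle_ineq4[of x tmean] by linarith
    then have "norm (x - tmean) ^ 3 \<le> (2 * max (norm x) (norm tmean)) ^ 3"
      by (intro power_mono) auto
    also have "\<dots> \<le> 8 * (norm x ^ 3 + norm tmean ^ 3)"
      by (auto simp: power_mult_distrib max_def)
    finally show ?thesis .
  qed
  have n3: "integrable tilted (\<lambda>x. norm x ^ 3)" "norm (\<integral>x. norm x ^ 3 \<partial>tilted) \<le> 1 * D"
    by (rule tilted_moment[where c = 1 and k = 3]; simp)+
  show int: "integrable tilted (\<lambda>x. norm (x - tmean) ^ 3)"
  proof (rule Bochner_Integration.integrable_bound)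
    show "integrable tilted (\<lambda>x. 8 * (norm x ^ 3 + norm tmean ^ 3))" using n3 by simp
  qed (auto intro!: AE_I2 order_trans[OF le])
  have "(\<integral>x. norm (x - tmean) ^ 3 \<partial>tilted) \<le> (\<integral>x. 8 * (norm x ^ 3 + norm tmean ^ 3) \<partial>tilted)"
    using n3 by (intro integral_mono int le) auto
  also have "\<dots> \<le> 8 * (D + norm tmean ^ 3)"
    using n3 by (simp add: T.prob_space)
  finally show "(\<integral>x. norm (x - tmean) ^ 3 \<partial>tilted) \<le> 8 * (D + norm tmean ^ 3)" .
qed

end

lemma tilt_estimates:
  assumes r: "0 < r"
  obtains t1 C K where "0 < t1" "t1 \<le> t0" "0 \<le> C" "0 \<le> K"
    and "\<And>t. 0 \<le> t \<Longrightarrow> t \<le> t1 \<Longrightarrow> exp (r * t\<^sup>2 - C * t ^ 3) \<le> mgf t"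
    and "\<And>t. 0 \<le> t \<Longrightarrow> t \<le> t1 \<Longrightarrow> norm (tmean t - t *\<^sub>R a0) \<le> C * t\<^sup>2"
    and "\<And>t. 0 \<le> t \<Longrightarrow> t \<le> t1 \<Longrightarrow> r / 2 \<le> (\<integral>x. (blinfun_apply h (x - tmean t))\<^sup>2 \<partial>tilted t)"
    and "\<And>t. 0 \<le> t \<Longrightarrow> t \<le> t1 \<Longrightarrow> (\<integral>x. norm (x - tmean t) ^ 3 \<partial>tilted t) \<le> K"
proof -
  define A where "A = norm h ^ 3 * D"
  define B where "B = (norm h)\<^sup>2 * D"
  have A: "A \<ge> 0" and B: "B \<ge> 0" using D_nonneg by (auto simp: A_def B_def)
  define C1 where "C1 = B * (1 + norm a0)"
  have C1: "C1 \<ge> 0" using B by (simp add: C1_def)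
  define C where "C = A + r\<^sup>2 + C1"
  have C: "C \<ge> 0" "C1 \<le> C" "A + r\<^sup>2 \<le> C" using A C1 by (auto simp: C_def)
  define m where "m = norm a0 + C1"
  have m: "m \<ge> 0" using C1 by (simp add: m_def)
  define K where "K = 8 * (D + m ^ 3)"
  have K: "K \<ge> 0" using D_nonneg m by (simp add: K_def)
  define q where "q = A + (1 + B) * ((norm h)\<^sup>2 * m\<^sup>2)"
  have q: "q \<ge> 0" using A B by (simp add: q_def)
  \<comment> \<open>Three entries keep, in this order, the argument of the logarithm bound at most
    1, the loss \<open>q * t\<close> in the variance at most \<open>r\<close>, and
    \<open>mgf t\<close> at most 2. The summand 1 in each denominator keeps it positive even if the
    constant vanishes.\<close>
  define t1 where "t1 = min (min 1 t0) (min (1 / (1 + r)) (min (r / (1 + q)) (1 / (1 + B))))"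
  have t1: "0 < t1" "t1 \<le> 1" "t1 \<le> t0" "t1 \<le> 1 / (1 + r)" "t1 \<le> r / (1 + q)" "t1 \<le> 1 / (1 + B)"
    using t0 r q B by (auto simp: t1_def intro!: divide_pos_pos)
  show thesis
  proof (rule that[OF t1(1,3) C(1) K])
    fix t assume t: "0 \<le> t" "t \<le> t1"
    then have t': "0 \<le> t" "t \<le> t0" "t \<le> 1" using t1 by auto
    have t2: "t\<^sup>2 \<le> t" using t' by (simp add: power2_eq_square mult_left_le)
    have tr: "t * (1 + r) \<le> 1"
    proof -
      have "t * (1 + r) \<le> t1 * (1 + r)" using t r by (intro mult_right_mono) auto
      also have "\<dots> \<le> 1" using t1(4) r by (simp add: pos_le_divide_eq)
      finally show ?thesis .
    qed
    have tq: "t * (1 + q) \<le> r"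
    proof -
      have "t * (1 + q) \<le> t1 * (1 + q)" using t q by (intro mult_right_mono) auto
      also have "\<dots> \<le> r" using t1(5) q by (simp add: pos_le_divide_eq)
      finally show ?thesis .
    qed
    have tB: "t * (1 + B) \<le> 1"
    proof -
      have "t * (1 + B) \<le> t1 * (1 + B)" using t B by (intro mult_right_mono) auto
      also have "\<dots> \<le> 1" using t1(6) B by (simp add: pos_le_divide_eq)
      finally show ?thesis .
    qed
    show "exp (r * t\<^sup>2 - C * t ^ 3) \<le> mgf t"
    \<comment> \<open>A negative Taylor value makes the claim weaker than \<open>mgf t >= 1\<close>.
      Otherwise \<open>ln (1 + y) >= y - y^2\<close> on the unit interval applies, and the part
      \<open>r^2\<close> of \<open>C\<close> pays for \<open>y^2\<close>.\<close>
    proof (cases "r * t\<^sup>2 - A * t ^ 3 \<ge> 0")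
      case True
      define y where "y = r * t\<^sup>2 - A * t ^ 3"
      have y0: "0 \<le> y" using True by (simp add: y_def)
      have yr: "y \<le> r * t\<^sup>2" using A t' by (simp add: y_def)
      also have "r * t\<^sup>2 \<le> r * t" using t2 r by (intro mult_left_mono) auto
      also have "\<dots> \<le> 1" using tr t' by (simp add: algebra_simps)
      finally have y1: "y \<le> 1" .
      have "y\<^sup>2 \<le> (r * t\<^sup>2)\<^sup>2" using y0 yr by (intro power_mono)
      also have "\<dots> = r\<^sup>2 * t ^ 4" by (simp add: power_mult_distrib)
      also have "\<dots> \<le> r\<^sup>2 * t ^ 3" using t' by (intro mult_left_mono power_decreasing) auto
      finally have "r * t\<^sup>2 - (A + r\<^sup>2) * t ^ 3 \<le> y - y\<^sup>2" by (simp add: y_def algebra_simps)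
      moreover have "(A + r\<^sup>2) * t ^ 3 \<le> C * t ^ 3" using C t' by (intro mult_right_mono) auto
      ultimately have "r * t\<^sup>2 - C * t ^ 3 \<le> ln (1 + y)"
        using ln_one_plus_pos_lower_bound[OF y0 y1] by linarith
      then have "exp (r * t\<^sup>2 - C * t ^ 3) \<le> 1 + y"
        using y0 by (simp add: ln_ge_iff)
      then show ?thesis using mgf_lower_taylor[OF t'(1,2)] by (simp add: y_def A_def)
    next
      case False
      moreover have "A * t ^ 3 \<le> C * t ^ 3"
        using C t' zero_le_power2[of r] by (intro mult_right_mono) (linarith, simp)
      ultimately have "exp (r * t\<^sup>2 - C * t ^ 3) \<le> 1" by simp
      then show ?thesis using mgf_ge_1[OF t'(1,2)] by linarith
    qed
    have ap: "norm (tmean t - t *\<^sub>R a0) \<le> C1 * t\<^sup>2"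
    proof -
      have "B * (1 + t * norm a0) * t\<^sup>2 \<le> C1 * t\<^sup>2"
        unfolding C1_def using B t' by (intro mult_right_mono mult_left_mono) (auto simp: mult_left_le_one_le)
      then show ?thesis using tmean_approx[OF t'(1,2)] by (simp add: B_def)
    qed
    also have "\<dots> \<le> C * t\<^sup>2" using C by (intro mult_right_mono) auto
    finally show "norm (tmean t - t *\<^sub>R a0) \<le> C * t\<^sup>2" .
    have mt: "norm (tmean t) \<le> m * t"
    proof -
      have "norm (tmean t) \<le> norm (t *\<^sub>R a0) + norm (tmean t - t *\<^sub>R a0)" by (rule norm_triangle_sub)
      also have "\<dots> \<le> t * norm a0 + C1 * t"
        using ap t' mult_left_mono[OF t2 C1] by simp
      finally show ?thesis by (simp add: m_def algebra_simps)
    qed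
    then have m1: "norm (tmean t) \<le> m" using t' m mult_left_mono[of t 1 m] by linarith
    have "8 * (D + norm (tmean t) ^ 3) \<le> K"
      unfolding K_def using m1 by (intro mult_left_mono add_left_mono power_mono) auto
    then show "(\<integral>x. norm (x - tmean t) ^ 3 \<partial>tilted t) \<le> K"
      using tilted_centered_cube(2)[OF t'(1,2)] by linarith
    have M: "1 \<le> mgf t" "mgf t \<le> 1 + B * t"
      using mgf_ge_1[OF t'(1,2)] mgf_upper[OF t'(1,2)] mult_left_mono[OF t2 B] by (auto simp: B_def)
    have "B * t \<le> 1" using tB t' by (simp add: algebra_simps)
    then have M2: "mgf t \<le> 2" "mgf t \<le> 1 + B"
      using M mult_left_mono[OF t'(3) B] by auto
    have "(blinfun_apply h (tmean t))\<^sup>2 \<le> (norm h * (m * t))\<^sup>2"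
    proof -
      have "\<bar>blinfun_apply h (tmean t)\<bar> \<le> norm h * (m * t)"
        using h_le[of "tmean t"] mult_left_mono[OF mt norm_ge_zero[of h]] by linarith
      then have "\<bar>blinfun_apply h (tmean t)\<bar>\<^sup>2 \<le> (norm h * (m * t))\<^sup>2" by (intro power_mono) auto
      then show ?thesis by simp
    qed
    also have "\<dots> = ((norm h)\<^sup>2 * m\<^sup>2) * t\<^sup>2" by (simp add: power_mult_distrib)
    also have "\<dots> \<le> ((norm h)\<^sup>2 * m\<^sup>2) * t" using t2 by (intro mult_left_mono) auto
    finally have "mgf t * (blinfun_apply h (tmean t))\<^sup>2 \<le> (1 + B) * (((norm h)\<^sup>2 * m\<^sup>2) * t)"
      using M2 B by (intro mult_mono) auto
    then have "2 * r - q * t \<le> mgf t * (\<integral>x. (blinfun_apply h (x - tmean t))\<^sup>2 \<partial>tilted t)"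
      using tilted_h2_lower[OF t'(1,2)] unfolding tilted_variance[OF t'(1,2)]
      by (simp add: q_def A_def algebra_simps)
    moreover have "q * t \<le> r" using tq t' by (simp add: algebra_simps)
    ultimately have "r \<le> mgf t * (\<integral>x. (blinfun_apply h (x - tmean t))\<^sup>2 \<partial>tilted t)" by linarith
    also have "\<dots> \<le> 2 * (\<integral>x. (blinfun_apply h (x - tmean t))\<^sup>2 \<partial>tilted t)"
      using M2 by (intro mult_right_mono) auto
    finally show "r / 2 \<le> (\<integral>x. (blinfun_apply h (x - tmean t))\<^sup>2 \<partial>tilted t)" by simp
  qed
qed

end

section \<open>Change of measure and the moderate deviation lower bound\<close>

context tilting
begin

lemma h_a0: "blinfun_apply h a0 = 2 * r"
  unfolding a0_def r_def
  using integral_bounded_linear[OF blinfun.bounded_linear_right integrable_hx, of h]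
  by (simp add: blinfun.scaleR_right power2_eq_square)

lemma tilted_summands:
  assumes t: "0 \<le> t" "t \<le> t0" and J: "finite J" "J \<noteq> {}"
    and K: "(\<integral>x. norm (x - tmean t) ^ 3 \<partial>tilted t) \<le> K"
  shows "vector_summands (PiM J (\<lambda>_. tilted t)) (\<lambda>i x. x i - tmean t) J h
    (\<integral>x. (blinfun_apply h (x - tmean t))\<^sup>2 \<partial>tilted t) K"
proof -
  interpret T: prob_space "tilted t" by (rule prob_space_tilted[OF t])
  interpret P: prob_space "PiM J (\<lambda>_. tilted t)" by (intro prob_space_PiM T.prob_space_axioms)
  have [measurable_cong]: "sets (tilted t) = sets borel" by (rule sets_tilted[OF t])
  have ix: "integrable (tilted t) (\<lambda>x. x)"
    by (rule tilted_moment(1)[OF t, of _ 1 1]) auto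
  have comp: "distr (PiM J (\<lambda>_. tilted t)) (tilted t) (\<lambda>x. x i) = tilted t" if "i \<in> J" for i
    using that by (intro distr_PiM_component T.prob_space_axioms)
  have coord: "(\<lambda>x. x i) \<in> measurable (PiM J (\<lambda>_. tilted t)) (tilted t)" if "i \<in> J" for i
    using that by simp
  have E: "(\<integral>x. g (x i) \<partial>PiM J (\<lambda>_. tilted t)) = (\<integral>x. g x \<partial>tilted t)"
    if "i \<in> J" and [measurable]: "g \<in> borel_measurable borel"
    for g :: "'a \<Rightarrow> 'c::{banach, second_countable_topology}" and i
    by (subst (2) comp[OF that(1), symmetric], subst integral_distr[OF coord[OF that(1)]]) auto
  have Ec: "integrable (PiM J (\<lambda>_. tilted t)) (\<lambda>x. g (x i))"
    if "i \<in> J" and [measurable]: "g \<in> borel_measurable borel" and "integrable (tilted t) g"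
    for g :: "'a \<Rightarrow> 'c::{banach, second_countable_topology}" and i
    using that(3) by (subst (asm) comp[OF that(1), symmetric], subst (asm) integrable_distr_eq[OF coord[OF that(1)]]) auto
  show ?thesis
  proof
    show "P.indep_vars (\<lambda>_. borel) (\<lambda>i x. x i - tmean t) J"
      by (rule P.indep_vars_compose2[OF indep_vars_PiM_coordinates[OF T.prob_space_axioms J(2)]]) measurable
    fix i assume i: "i \<in> J"
    show "integrable (PiM J (\<lambda>_. tilted t)) (\<lambda>x. norm (x i - tmean t) ^ 3)"
      by (rule Ec[OF i, of "\<lambda>x. norm (x - tmean t) ^ 3"]) (measurable, rule tilted_centered_cube(1)[OF t])
    show "P.expectation (\<lambda>x. norm (x i - tmean t) ^ 3) \<le> K"
      by (subst E[OF i, of "\<lambda>x. norm (x - tmean t) ^ 3"]) (measurable, rule K)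
    show "P.expectation (\<lambda>x. (blinfun_apply h (x i - tmean t))\<^sup>2) = (\<integral>x. (blinfun_apply h (x - tmean t))\<^sup>2 \<partial>tilted t)"
      by (rule E[OF i, of "\<lambda>x. (blinfun_apply h (x - tmean t))\<^sup>2"]) measurable
    have "P.expectation (\<lambda>x. x i - tmean t) = (\<integral>x. x - tmean t \<partial>tilted t)"
      by (rule E[OF i, of "\<lambda>x. x - tmean t"]) measurable
    then show "P.expectation (\<lambda>x. x i - tmean t) = 0"
      using ix by (simp add: T.prob_space tmean_def[OF t])
  qed (use J in auto)
qed

text \<open>The density of the tilted product law is \<open>exp (t * h (sum)) / mgf t ^ n\<close>, a
  function of the sum alone. An upper bound for it on \<open>S\<close> turns a lower bound for the
  tilted probability into one for the original probability.\<close>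

lemma change_of_measure:
  fixes J :: "'i set"
  assumes t: "0 \<le> t" "t \<le> t0" and J: "finite J" and S: "S \<in> sets (PiM J (\<lambda>_. \<mu>))"
    and bound: "\<And>x. x \<in> S \<Longrightarrow> t * blinfun_apply h (\<Sum>i\<in>J. x i) \<le> B"
  shows "measure (PiM J (\<lambda>_. tilted t)) S \<le> exp B / mgf t ^ card J * measure (PiM J (\<lambda>_. \<mu>)) S"
proof -
  interpret P: prob_space "PiM J (\<lambda>_. \<mu>)" by (intro prob_space_PiM prob_space_axioms)
  interpret T: prob_space "tilted t" by (rule prob_space_tilted[OF t])
  interpret PT: prob_space "PiM J (\<lambda>_. tilted t)" by (intro prob_space_PiM T.prob_space_axioms)
  have m: "1 \<le> mgf t" by (rule mgf_ge_1[OF t])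
  let ?w = "\<lambda>x. exp (t * blinfun_apply h x) / mgf t"
  have w: "(\<Prod>i\<in>J. ?w (x i)) = exp (t * blinfun_apply h (\<Sum>i\<in>J. x i)) / mgf t ^ card J" for x :: "'i \<Rightarrow> 'a"
    by (simp add: prod_dividef exp_sum[OF J] blinfun.sum_right sum_distrib_left)
  have dens: "PiM J (\<lambda>_. tilted t) = density (PiM J (\<lambda>_. \<mu>)) (\<lambda>x. ennreal (\<Prod>i\<in>J. ?w (x i)))"
    unfolding tilted_def[OF t] using T.prob_space_axioms m J
    by (intro PiM_density prob_space_axioms) (auto simp: tilted_def[OF t])
  have [measurable]: "(\<lambda>x. ennreal (\<Prod>i\<in>J. ?w (x i))) \<in> borel_measurable (PiM J (\<lambda>_. \<mu>))"
    by measurable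
  have "emeasure (PiM J (\<lambda>_. tilted t)) S = (\<integral>\<^sup>+x. ennreal (\<Prod>i\<in>J. ?w (x i)) * indicator S x \<partial>PiM J (\<lambda>_. \<mu>))"
    unfolding dens by (rule emeasure_density[OF _ S]) measurable
  also have "\<dots> \<le> (\<integral>\<^sup>+x. ennreal (exp B / mgf t ^ card J) * indicator S x \<partial>PiM J (\<lambda>_. \<mu>))"
    using bound m by (intro nn_integral_mono) (auto simp: indicator_def w intro!: ennreal_leI divide_right_mono)
  also have "\<dots> = ennreal (exp B / mgf t ^ card J) * emeasure (PiM J (\<lambda>_. \<mu>)) S"
    by (rule nn_integral_cmult_indicator[OF S])
  finally show ?thesis
    using m by (simp add: P.emeasure_eq_measure PT.emeasure_eq_measure ennreal_mult[symmetric])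
qed

text \<open>With \<open>p = sqrt n / b n\<close>, the window puts \<open>s\<close> at least at
  \<open>A / c1 * p^2\<close>, so the slice radius is at least
  \<open>\<beta> * sqrt (A / c1) * p\<close>. The component \<open>y\<close> has norm at most
  \<open>(R + 2) * p\<close>: \<open>R\<close> from the centred sum, 1 from the error of the tilted
  mean, and 1 from removing \<open>s * x0\<close>.\<close>

lemma moderate_deviation_lower:
  fixes b :: "nat \<Rightarrow> real" and x0 :: 'a and G :: "'a set"
  assumes r: "0 < r" and b: "\<And>n. n \<ge> 1 \<Longrightarrow> b n > 0"
    and b_sqrt: "filterlim (\<lambda>n. b n / sqrt (real n)) at_top sequentially"
    and b_23: "(\<lambda>n. b n / real n powr (2 / 3)) \<longlonglongrightarrow> 0"
    and x0: "blinfun_apply h x0 > 0" and \<delta>: "\<delta> > 0" and \<beta>: "\<beta> > 0" and G: "open G"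
    and slices: "\<And>y s. blinfun_apply h y = 0 \<Longrightarrow> norm y \<le> \<beta> * sqrt s \<Longrightarrow> 0 < s \<Longrightarrow> s \<le> \<delta> \<Longrightarrow> a0 + (y + s *\<^sub>R x0) \<in> G"
  shows "\<exists>c>0. \<forall>\<^sub>F n in sequentially. c \<le> b n / sqrt (real n)
    * measure (PiM {1..n} (\<lambda>_. \<mu>)) {x \<in> space (PiM {1..n} (\<lambda>_. \<mu>)). (1 / b n) *\<^sub>R (\<Sum>i=1..n. x i) \<in> G}
    * exp ((b n)\<^sup>2 / real n * r)"
proof -
  obtain t1 C K where t1: "0 < t1" "t1 \<le> t0" and C: "0 \<le> C" and K: "0 \<le> K"
    and mgf_lower: "\<And>t. 0 \<le> t \<Longrightarrow> t \<le> t1 \<Longrightarrow> exp (r * t\<^sup>2 - C * t ^ 3) \<le> mgf t"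
    and mean_approx: "\<And>t. 0 \<le> t \<Longrightarrow> t \<le> t1 \<Longrightarrow> norm (tmean t - t *\<^sub>R a0) \<le> C * t\<^sup>2"
    and var_lower: "\<And>t. 0 \<le> t \<Longrightarrow> t \<le> t1 \<Longrightarrow> r / 2 \<le> (\<integral>x. (blinfun_apply h (x - tmean t))\<^sup>2 \<partial>tilted t)"
    and third: "\<And>t. 0 \<le> t \<Longrightarrow> t \<le> t1 \<Longrightarrow> (\<integral>x. norm (x - tmean t) ^ 3 \<partial>tilted t) \<le> K"
    by (rule tilt_estimates[OF r]) (rule that; blast)
  have "0 < r / 2" using r by simp
  then obtain \<kappa> c R N where \<kappa>: "\<kappa> > 0" and c: "c > 0" and R: "R > 0"
    and window: "\<And>(P::(nat \<Rightarrow> 'a) measure) (U::nat \<Rightarrow> (nat \<Rightarrow> 'a) \<Rightarrow> 'a) I v a L.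
      vector_summands P U I h v K \<Longrightarrow> r / 2 \<le> v \<Longrightarrow> N \<le> real (card I) \<Longrightarrow>
      0 < L \<Longrightarrow> real (card I) \<le> L ^ 3 \<Longrightarrow> L\<^sup>2 \<le> real (card I) \<Longrightarrow> a\<^sup>2 \<le> real (card I) \<Longrightarrow>
      c * (L / sqrt (real (card I))) \<le> measure P {\<omega> \<in> space P.
        \<bar>blinfun_apply h (\<Sum>i\<in>I. U i \<omega>) - a\<bar> \<le> \<kappa> * L \<and> norm (\<Sum>i\<in>I. U i \<omega>) \<le> R * sqrt (real (card I))}"
    by (rule local_window[OF _ K, where h = h]) (rule that; blast)
  define c1 where "c1 = blinfun_apply h x0"
  have c1: "c1 > 0" using x0 by (simp add: c1_def)
  \<comment> \<open>Solves \<open>\<beta> * sqrt (A / c1) = R + 2\<close>, so that slices at this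
    height are just wide enough.\<close>
  define A where "A = c1 * ((R + 2) / \<beta>)\<^sup>2"
  have A: "A > 0" using c1 R \<beta> by (simp add: A_def)
  have A_sqrt: "\<beta> * sqrt (A / c1) = R + 2"
    using c1 R \<beta> by (simp add: A_def)
  \<comment> \<open>The window is centred at height \<open>A + \<kappa>\<close> with half-width
    \<open>\<kappa>\<close>, in units of \<open>L\<close>.\<close>
  define A' where "A' = A + 2 * \<kappa>"
  have A': "A' > 0" "A \<le> A'" using A \<kappa> by (auto simp: A'_def)
  \<comment> \<open>The two small parameters: \<open>(b n)^3 / n^2 = u^3\<close> controls the Taylor
    errors of tilting, while \<open>L = p * sqrt n\<close> and \<open>L / b n = p^2\<close> control
    the geometry. The thresholds on \<open>u\<close> below make \<open>t\<close> admissible, the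
    drift of the mean small and the cubic cost at most 1; those on \<open>p\<close> keep the window
    centre within \<open>sqrt n\<close>, the height below \<open>\<delta>\<close> and
    \<open>s * x0\<close> small.\<close>
  define u where "u n = b n / real n powr (2 / 3)" for n
  define p where "p n = sqrt (real n) / b n" for n
  have p_lim: "p \<longlonglongrightarrow> 0"
  proof -
    have "(\<lambda>n. inverse (b n / sqrt (real n))) \<longlonglongrightarrow> 0"
      by (rule tendsto_inverse_0_at_top[OF b_sqrt])
    then show ?thesis by (simp add: p_def[abs_def])
  qed
  have u_lim: "u \<longlonglongrightarrow> 0" using b_23 by (simp add: u_def[abs_def])
  have small_u: "\<forall>\<^sub>F n in sequentially. u n < e" if "e > 0" for e
    using order_tendstoD(2)[OF u_lim that] .
  have small_p: "\<forall>\<^sub>F n in sequentially. p n < e" if "e > 0" for e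
    using order_tendstoD(2)[OF p_lim that] .
  have "\<forall>\<^sub>F n in sequentially. u n < 1 \<and> u n < t1 \<and> u n < 1 / (1 + C) \<and> u n < 1 / (1 + 2 * C * (1 + norm h))"
    using t1 C by (intro eventually_conj small_u) (auto intro!: divide_pos_pos add_pos_nonneg mult_nonneg_nonneg)
  moreover have "\<forall>\<^sub>F n in sequentially. p n < 1 \<and> p n < 1 / (2 * (A + \<kappa>)) \<and> p n < \<delta> * c1 / A' \<and> p n < 1 / (1 + A' / c1 * norm x0)"
    using A A' \<kappa> c1 \<delta> by (intro eventually_conj small_p) (auto intro!: divide_pos_pos add_pos_nonneg mult_nonneg_nonneg)
  moreover have "\<forall>\<^sub>F n in sequentially. n \<ge> 1 \<and> real n \<ge> N"
    by (intro eventually_conj eventually_ge_at_top eventually_sequentiallyI[of "nat \<lceil>N\<rceil>"]) linarith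
  ultimately have ev: "\<forall>\<^sub>F n in sequentially. c * exp (- A' - 1) \<le> b n / sqrt (real n)
    * measure (PiM {1..n} (\<lambda>_. \<mu>)) {x \<in> space (PiM {1..n} (\<lambda>_. \<mu>)). (1 / b n) *\<^sub>R (\<Sum>i=1..n. x i) \<in> G}
    * exp ((b n)\<^sup>2 / real n * r)"
  proof eventually_elim
    case (elim n)
    define \<nu> where "\<nu> = real n"
    define B where "B = b n"
    have \<nu>: "\<nu> \<ge> 1" "N \<le> \<nu>" using elim by (auto simp: \<nu>_def)
    have B: "B > 0" using b elim by (auto simp: B_def)
    have u_eq: "B = u n * \<nu> powr (2 / 3)" using \<nu> by (simp add: u_def B_def \<nu>_def)
    have u0: "0 < u n" using B \<nu> by (simp add: u_def B_def[symmetric] \<nu>_def[symmetric])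
    have p_eq: "sqrt \<nu> = p n * B" using B by (simp add: p_def B_def \<nu>_def)
    have p0: "0 < p n" using B \<nu> by (simp add: p_def B_def[symmetric] \<nu>_def[symmetric])
    have \<nu>_eq: "\<nu> = (p n * B)\<^sup>2" unfolding p_eq[symmetric] using \<nu> by simp
    define L where "L = \<nu> / B"
    define t where "t = B / \<nu>"
    have L0: "L > 0" using \<nu> B by (simp add: L_def)
    have tL: "t * L = 1" using \<nu> B by (simp add: t_def L_def)
    have cube: "B ^ 3 = u n ^ 3 * \<nu>\<^sup>2"
    proof -
      have "(\<nu> powr (2 / 3)) ^ 3 = \<nu>\<^sup>2"
        using \<nu> by (simp add: powr_power)
      then show ?thesis unfolding u_eq by (simp add: power_mult_distrib)
    qed
    have "\<nu> powr (2 / 3) \<le> \<nu> powr 1" using \<nu> by (intro powr_mono) auto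
    then have t_u: "t \<le> u n" using \<nu> u0 unfolding t_def u_eq by (simp add: pos_divide_le_eq)
    have t: "0 \<le> t" "t \<le> t1" "t \<le> t0" using t_u elim t1 B \<nu> by (auto simp: t_def)
    have L3: "\<nu> \<le> L ^ 3"
    proof -
      have "u n ^ 3 \<le> 1" using u0 elim by (intro power_le_one) auto
      then have "B ^ 3 \<le> \<nu>\<^sup>2" unfolding cube using \<nu> by (simp add: mult_left_le_one_le)
      then have "\<nu> * B ^ 3 \<le> \<nu> * \<nu>\<^sup>2" using \<nu> by (intro mult_left_mono) auto
      then show ?thesis using B by (simp add: L_def power_divide field_simps eval_nat_numeral)
    qed
    have Lp: "L = p n * sqrt \<nu>"
    proof -
      have "\<nu> = sqrt \<nu> * sqrt \<nu>" using \<nu> by simp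
      then show ?thesis using B unfolding L_def p_def B_def[symmetric] \<nu>_def[symmetric] by simp
    qed
    have L2: "L\<^sup>2 \<le> \<nu>"
    proof -
      have "L\<^sup>2 = (p n)\<^sup>2 * \<nu>" unfolding Lp using \<nu> by (simp add: power_mult_distrib)
      also have "\<dots> \<le> 1 * \<nu>" using p0 elim \<nu> by (intro mult_right_mono power_le_one) auto
      finally show ?thesis by simp
    qed
    \<comment> \<open>The gap between the tilted mean of the sum and its target
      \<open>B * a0\<close>. It is at most \<open>C * n * t^2 = C * B^2 / n\<close>, and
      \<open>B^2 / n = u^2 * n^(1/3) <= u * sqrt n\<close>, hence small against the
      fluctuations.\<close>
    define d where "d = \<nu> *\<^sub>R tmean t - B *\<^sub>R a0"
    have "d = \<nu> *\<^sub>R (tmean t - t *\<^sub>R a0)" using \<nu> by (simp add: d_def t_def scaleR_right_diff_distrib)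
    then have "norm d = \<nu> * norm (tmean t - t *\<^sub>R a0)" using \<nu> by simp
    also have "\<dots> \<le> \<nu> * (C * t\<^sup>2)" using mean_approx[OF t(1,2)] \<nu> by (intro mult_left_mono) auto
    also have "\<nu> * (C * t\<^sup>2) = C * (\<nu> * t\<^sup>2)" by simp
    also have "\<nu> * t\<^sup>2 \<le> u n * sqrt \<nu>"
    proof -
      have "\<nu> * t\<^sup>2 = (u n)\<^sup>2 * \<nu> powr (1 / 3)"
      proof -
        have "\<nu> * t\<^sup>2 = B\<^sup>2 / \<nu>" using \<nu> by (simp add: t_def power_divide power2_eq_square)
        also have "B\<^sup>2 = (u n)\<^sup>2 * \<nu> powr (4 / 3)"
          unfolding u_eq power_mult_distrib using \<nu> by (simp add: powr_power)
        also have "\<nu> powr (4 / 3) = \<nu> powr (1 / 3) * \<nu>"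
          using \<nu> powr_add[of \<nu> "1 / 3" 1] by simp
        finally show ?thesis using \<nu> by simp
      qed
      also have "\<dots> \<le> u n * \<nu> powr (1 / 2)"
      proof (rule mult_mono)
        show "(u n)\<^sup>2 \<le> u n" using u0 elim by (simp add: power2_eq_square mult_left_le)
        show "\<nu> powr (1 / 3) \<le> \<nu> powr (1 / 2)" using \<nu> by (intro powr_mono) auto
      qed (use u0 in auto)
      also have "\<nu> powr (1 / 2) = sqrt \<nu>" using \<nu> by (simp add: powr_half_sqrt)
      finally show ?thesis .
    qed
    finally have dn: "norm d \<le> C * (u n * sqrt \<nu>)" using C by (simp add: mult_left_mono)
    have "u n * (1 + 2 * C * (1 + norm h)) \<le> 1"
      using elim C by (simp add: pos_less_divide_eq add_pos_nonneg less_imp_le)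
    then have "2 * (C * u n) * (1 + norm h) \<le> 1" using u0 by (simp add: algebra_simps)
    then have "(2 * (C * u n) * (1 + norm h)) * sqrt \<nu> \<le> 1 * sqrt \<nu>"
      using \<nu> by (intro mult_right_mono) auto
    then have "2 * norm d * (1 + norm h) \<le> sqrt \<nu>"
      using mult_right_mono[OF dn, of "2 * (1 + norm h)"] by (simp add: mult_ac)
    then have "2 * norm d + 2 * (norm h * norm d) \<le> sqrt \<nu>" by (simp add: algebra_simps)
    moreover have "0 \<le> norm h * norm d" by simp
    ultimately have d1: "norm d \<le> sqrt \<nu>" and d2: "2 * (norm h * norm d) \<le> sqrt \<nu>"
      using norm_ge_zero[of d] by linarith+
    \<comment> \<open>The centre for the centred sum: adding back the drift \<open>h d\<close> puts
      \<open>h W\<close> into \<open>[A * L, A' * L]\<close>.\<close>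
    define \<mu>n where "\<mu>n = (A + \<kappa>) * L - blinfun_apply h d"
    have "2 * ((A + \<kappa>) * L) \<le> sqrt \<nu>"
    proof -
      have "p n * (2 * (A + \<kappa>)) \<le> 1" using elim A \<kappa> by (simp add: pos_less_divide_eq less_imp_le)
      then have "(p n * (2 * (A + \<kappa>))) * sqrt \<nu> \<le> 1 * sqrt \<nu>" using \<nu> by (intro mult_right_mono) auto
      then show ?thesis unfolding Lp by (simp add: mult_ac)
    qed
    moreover have "0 \<le> (A + \<kappa>) * L" using A \<kappa> L0 by simp
    ultimately have "\<bar>\<mu>n\<bar> \<le> sqrt \<nu>"
      using h_le[of d] d2 unfolding \<mu>n_def by linarith
    then have a2: "\<mu>n\<^sup>2 \<le> \<nu>" using power_mono[of "\<bar>\<mu>n\<bar>" "sqrt \<nu>" 2] \<nu> by simp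
    let ?J = "{1..n}"
    let ?P = "PiM ?J (\<lambda>_. \<mu>)"
    let ?T = "PiM ?J (\<lambda>_. tilted t)"
    define E where "E = {x \<in> space ?T. \<bar>blinfun_apply h (\<Sum>i\<in>?J. x i - tmean t) - \<mu>n\<bar> \<le> \<kappa> * L
       \<and> norm (\<Sum>i\<in>?J. x i - tmean t) \<le> R * sqrt \<nu>}"
    have summands: "vector_summands ?T (\<lambda>i x. x i - tmean t) ?J h (\<integral>x. (blinfun_apply h (x - tmean t))\<^sup>2 \<partial>tilted t) K"
      using elim by (intro tilted_summands t(1,3) third[OF t(1,2)]) auto
    have E_lower: "c * (L / sqrt \<nu>) \<le> measure ?T E"
      using window[OF summands var_lower[OF t(1,2)], of L \<mu>n] \<nu> L0 L3 L2 a2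
      by (simp add: E_def \<nu>_def)
    have sets_eq: "sets ?T = sets ?P" by (intro sets_PiM_cong) (auto simp: sets_tilted[OF t(1,3)])
    interpret P: prob_space ?P by (intro prob_space_PiM prob_space_axioms)
    have E_sets: "E \<in> sets ?P"
    proof -
      have [measurable_cong]: "sets (tilted t) = sets borel" by (rule sets_tilted[OF t(1,3)])
      have "E \<in> sets ?T" unfolding E_def by measurable
      then show ?thesis unfolding sets_eq .
    qed
    have G_sets: "{x \<in> space ?P. (1 / b n) *\<^sub>R (\<Sum>i\<in>?J. x i) \<in> G} \<in> sets ?P"
    proof -
      have [measurable]: "G \<in> sets borel" using G by simp
      show ?thesis by measurable
    qed
    have E_facts: "A * L \<le> blinfun_apply h W \<and> blinfun_apply h W \<le> A' * L \<and> norm W \<le> (R + 1) * sqrt \<nu>"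
      if "x \<in> E" "W = (\<Sum>i\<in>?J. x i) - B *\<^sub>R a0" for x W
    proof -
      have "W = (\<Sum>i\<in>?J. x i - tmean t) + d"
        by (simp add: that(2) d_def sum_subtractf \<nu>_def sum_constant_scaleR)
      then have W: "blinfun_apply h W = blinfun_apply h (\<Sum>i\<in>?J. x i - tmean t) + blinfun_apply h d"
        "norm W \<le> norm (\<Sum>i\<in>?J. x i - tmean t) + norm d"
        by (auto simp: blinfun.add_right norm_triangle_ineq)
      have "\<bar>blinfun_apply h (\<Sum>i\<in>?J. x i - tmean t) - \<mu>n\<bar> \<le> \<kappa> * L" "norm (\<Sum>i\<in>?J. x i - tmean t) \<le> R * sqrt \<nu>"
        using that(1) by (auto simp: E_def)
      then show ?thesis using W d1 unfolding \<mu>n_def A'_def by (auto simp: algebra_simps abs_le_iff)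
    qed
    have E_G: "E \<subseteq> {x \<in> space ?P. (1 / b n) *\<^sub>R (\<Sum>i\<in>?J. x i) \<in> G}"
    proof
      fix x assume x: "x \<in> E"
      define W where "W = (\<Sum>i\<in>?J. x i) - B *\<^sub>R a0"
      note F = E_facts[OF x W_def]
      \<comment> \<open>Decomposes \<open>W / B\<close> as \<open>y + s * x0\<close>; this value of
        \<open>s\<close> is forced by \<open>h y = 0\<close>.\<close>
      define s where "s = blinfun_apply h W / (B * c1)"
      define y where "y = (1 / B) *\<^sub>R W - s *\<^sub>R x0"
      have LB: "L / B = (p n)\<^sup>2" using B unfolding L_def \<nu>_eq by (simp add: power2_eq_square)
      have s_lower: "A / c1 * (p n)\<^sup>2 \<le> s"
      proof -
        have "A / c1 * (L / B) = (A * L) / (B * c1)" by simp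
        also have "\<dots> \<le> s" unfolding s_def using F B c1 by (intro divide_right_mono) auto
        finally show ?thesis unfolding LB .
      qed
      have s_upper: "s \<le> A' / c1 * (p n)\<^sup>2"
      proof -
        have "s \<le> (A' * L) / (B * c1)" unfolding s_def using F B c1 by (intro divide_right_mono) auto
        also have "\<dots> = A' / c1 * (L / B)" by simp
        finally show ?thesis unfolding LB .
      qed
      have p2: "(p n)\<^sup>2 \<le> p n" using p0 elim by (simp add: power2_eq_square mult_left_le)
      have s0: "0 < s" using s_lower A c1 p0 by (smt (verit) divide_pos_pos mult_pos_pos zero_less_power)
      have "A' / c1 * (p n)\<^sup>2 \<le> A' / c1 * p n" using p2 A' c1 by (intro mult_left_mono) auto
      also have "\<dots> \<le> \<delta>" using elim A' c1 by (simp add: field_simps)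
      finally have s_\<delta>: "s \<le> \<delta>" using s_upper by linarith
      have hy: "blinfun_apply h y = 0"
        using B c1 by (simp add: y_def s_def blinfun.diff_right blinfun.scaleR_right c1_def[symmetric])
      have "norm y \<le> norm ((1 / B) *\<^sub>R W) + norm (s *\<^sub>R x0)"
        unfolding y_def by (rule norm_triangle_ineq4)
      also have "norm ((1 / B) *\<^sub>R W) \<le> (R + 1) * p n"
      proof -
        have "norm ((1 / B) *\<^sub>R W) = norm W / B" using B by simp
        also have "\<dots> \<le> (R + 1) * sqrt \<nu> / B" using F B by (intro divide_right_mono) auto
        also have "\<dots> = (R + 1) * p n" unfolding p_eq using B by simp
        finally show ?thesis .
      qed
      also have "norm (s *\<^sub>R x0) \<le> p n"
      proof -
        have "norm (s *\<^sub>R x0) = s * norm x0" using s0 by simp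
        also have "\<dots> \<le> (A' / c1 * (p n)\<^sup>2) * norm x0" using s_upper by (intro mult_right_mono) auto
        also have "\<dots> = p n * (p n * (A' / c1 * norm x0))" by (simp add: power2_eq_square)
        also have "\<dots> \<le> p n * 1"
        proof (rule mult_left_mono)
          have "p n * (1 + A' / c1 * norm x0) \<le> 1"
            using elim A' c1 by (simp add: pos_less_divide_eq add_pos_nonneg less_imp_le)
          then show "p n * (A' / c1 * norm x0) \<le> 1" using p0 by (simp add: algebra_simps)
        qed (use p0 in simp)
        finally show ?thesis by simp
      qed
      finally have "norm y \<le> (R + 2) * p n" by (simp add: algebra_simps)
      also have "\<dots> = \<beta> * sqrt (A / c1) * sqrt ((p n)\<^sup>2)" unfolding A_sqrt using p0 by simp
      also have "\<dots> = \<beta> * sqrt (A / c1 * (p n)\<^sup>2)" by (simp only: real_sqrt_mult mult.assoc)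
      also have "\<dots> \<le> \<beta> * sqrt s" using s_lower \<beta> by (intro mult_left_mono real_sqrt_le_mono) auto
      finally have "a0 + (y + s *\<^sub>R x0) \<in> G" by (intro slices hy s0 s_\<delta>)
      moreover have "a0 + (y + s *\<^sub>R x0) = (1 / b n) *\<^sub>R (\<Sum>i\<in>?J. x i)"
        using B by (simp add: y_def W_def B_def[symmetric] scaleR_right_diff_distrib)
      moreover have "x \<in> space ?P" using x E_sets sets.sets_into_space by blast
      ultimately show "x \<in> {x \<in> space ?P. (1 / b n) *\<^sub>R (\<Sum>i\<in>?J. x i) \<in> G}" by simp
    qed
    \<comment> \<open>Since \<open>t * L = 1\<close>, the position in the window contributes only
      the constant \<open>A'\<close>; the target contributes
      \<open>t * B * h a0 = 2 * r * B^2 / n\<close>.\<close>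
    have "t * blinfun_apply h (\<Sum>i\<in>?J. x i) \<le> A' + 2 * r * (B\<^sup>2 / \<nu>)" if "x \<in> E" for x
    proof -
      define W where "W = (\<Sum>i\<in>?J. x i) - B *\<^sub>R a0"
      have "t * blinfun_apply h W \<le> t * (A' * L)"
        using E_facts[OF that W_def] t by (intro mult_left_mono) auto
      also have "\<dots> = A'" using tL by (simp add: mult.left_commute)
      finally have 1: "t * blinfun_apply h W \<le> A'" .
      have "(\<Sum>i\<in>?J. x i) = W + B *\<^sub>R a0" by (simp add: W_def)
      then have "t * blinfun_apply h (\<Sum>i\<in>?J. x i) = t * blinfun_apply h W + t * (B * (2 * r))"
        by (simp add: blinfun.add_right blinfun.scaleR_right h_a0 distrib_left)
      also have "t * (B * (2 * r)) = 2 * r * (B\<^sup>2 / \<nu>)"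
        by (simp add: t_def power2_eq_square)
      finally show ?thesis using 1 by linarith
    qed
    note com = change_of_measure[OF t(1,3) finite_atLeastAtMost E_sets this]
    \<comment> \<open>The accumulated cubic error is \<open>n * C * t^3 = C * u^3\<close>, which is
      at most 1.\<close>
    have mgf_n: "exp (r * (B\<^sup>2 / \<nu>) - 1) \<le> mgf t ^ n"
    proof -
      have "\<nu> * (C * t ^ 3) = C * u n ^ 3"
        using \<nu> cube by (simp add: t_def power_divide power2_eq_square power3_eq_cube field_simps)
      also have "\<dots> \<le> C * u n"
        using u0 elim C power_decreasing[of 1 3 "u n"] by (intro mult_left_mono) auto
      also have "\<dots> \<le> 1"
      proof -
        have "u n * (1 + C) \<le> 1" using elim C by (simp add: pos_less_divide_eq less_imp_le)
        then show ?thesis using u0 by (simp add: algebra_simps)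
      qed
      finally have "\<nu> * (C * t ^ 3) \<le> 1" .
      moreover have "\<nu> * (r * t\<^sup>2) = r * (B\<^sup>2 / \<nu>)"
        using \<nu> by (simp add: t_def power_divide power2_eq_square)
      ultimately have "r * (B\<^sup>2 / \<nu>) - 1 \<le> \<nu> * (r * t\<^sup>2 - C * t ^ 3)"
        by (simp add: right_diff_distrib)
      then have "exp (r * (B\<^sup>2 / \<nu>) - 1) \<le> exp (r * t\<^sup>2 - C * t ^ 3) ^ n"
        unfolding exp_of_nat_mult[symmetric] \<nu>_def by simp
      also have "\<dots> \<le> mgf t ^ n" using mgf_lower[OF t(1,2)] by (intro power_mono) auto
      finally show ?thesis .
    qed
    define Q where "Q = measure ?P {x \<in> space ?P. (1 / b n) *\<^sub>R (\<Sum>i\<in>?J. x i) \<in> G}"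
    have "c * (L / sqrt \<nu>) \<le> exp (A' + 2 * r * (B\<^sup>2 / \<nu>)) / mgf t ^ n * measure ?P E"
      using E_lower com by simp
    also have "\<dots> \<le> exp (A' + 2 * r * (B\<^sup>2 / \<nu>)) / exp (r * (B\<^sup>2 / \<nu>) - 1) * Q"
      unfolding Q_def using mgf_n P.finite_measure_mono[OF E_G G_sets]
      by (intro mult_mono divide_left_mono) (auto intro!: mult_pos_pos less_le_trans[OF exp_gt_zero mgf_n])
    \<comment> \<open>The tilt costs \<open>2 * r\<close> through \<open>h a0\<close> and regains
      \<open>r\<close> through the normalisation, which leaves exactly the rate. The prefactors then
      cancel, as \<open>B / sqrt n\<close> times \<open>L / sqrt n\<close> is 1.\<close>
    also have "exp (A' + 2 * r * (B\<^sup>2 / \<nu>)) / exp (r * (B\<^sup>2 / \<nu>) - 1) = exp (A' + 1) * exp (B\<^sup>2 / \<nu> * r)"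
      unfolding exp_diff[symmetric] exp_add[symmetric] by (simp add: algebra_simps)
    finally have "exp (- A' - 1) * (c * (L / sqrt \<nu>)) \<le> exp (- A' - 1) * (exp (A' + 1) * exp (B\<^sup>2 / \<nu> * r) * Q)"
      by (rule mult_left_mono) simp
    also have "\<dots> = exp (B\<^sup>2 / \<nu> * r) * Q"
      by (simp add: mult.assoc[symmetric] exp_add[symmetric])
    finally have "B / sqrt \<nu> * (exp (- A' - 1) * (c * (L / sqrt \<nu>))) \<le> B / sqrt \<nu> * (exp (B\<^sup>2 / \<nu> * r) * Q)"
      using B \<nu> by (intro mult_left_mono) auto
    moreover have "B / sqrt \<nu> * (exp (- A' - 1) * (c * (L / sqrt \<nu>))) = c * exp (- A' - 1)"
      using B \<nu> by (simp add: L_def)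
    ultimately show ?case
      unfolding Q_def B_def \<nu>_def by (simp only: mult_ac)
  qed
  then show ?thesis using c by (intro exI[of _ "c * exp (- A' - 1)"]) auto
qed

end

section \<open>The Gaussian limit and the dominating point\<close>

text \<open>A first-order optimality condition without derivatives: for small \<open>e\<close> of
  the sign of \<open>a\<close> the linear term would win.\<close>

lemma linear_quadratic_nonpos_imp_zero:
  fixes a c :: real
  assumes "\<And>e. e * a - e\<^sup>2 * c \<le> 0"
  shows "a = 0"
proof (rule ccontr)
  assume a: "a \<noteq> 0"
  define e where "e = a / (2 * (1 + \<bar>c\<bar>))"
  have e: "a = 2 * (1 + \<bar>c\<bar>) * e" by (simp add: e_def)
  have "0 < e\<^sup>2 * (2 * (1 + \<bar>c\<bar>) - c)"
    using a by (intro mult_pos_pos) (auto simp: e_def)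
  also have "\<dots> = e * a - e\<^sup>2 * c"
    by (subst e) (simp add: power2_eq_square algebra_simps)
  finally show False using assms[of e] by simp
qed

text \<open>The same \<open>q\<close> appears in both transforms. The cosine is a bounded continuous
  test function and passes to weak limits, whereas the exponential, which enters the rate, is
  unbounded; \<open>q\<close> carries the information across. The case \<open>q = 0\<close> is the
  degenerate one without a density.\<close>

lemma gaussian_functional:
  fixes g :: "'a::real_normed_vector \<Rightarrow>\<^sub>L real"
  assumes "centered_gaussian \<gamma>"
  obtains q where "0 \<le> q" "(\<integral>x. cos (blinfun_apply g x) \<partial>\<gamma>) = exp (- q / 2)"
    "laplace \<gamma> g = exp (q / 2)" "q = 0 \<Longrightarrow> AE x in \<gamma>. blinfun_apply g x = 0"
proof -
  interpret prob_space \<gamma> using assms by (simp add: centered_gaussian_def)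
  have [measurable_cong]: "sets \<gamma> = sets borel" using assms by (simp add: centered_gaussian_def)
  have [measurable]: "blinfun_apply g \<in> borel_measurable borel"
    by (intro borel_measurable_continuous_onI continuous_intros)
  from assms consider "AE x in \<gamma>. blinfun_apply g x = 0"
    | \<sigma> where "\<sigma> > 0" "distributed \<gamma> lborel (blinfun_apply g) (normal_density 0 \<sigma>)"
    unfolding centered_gaussian_def by blast
  then show thesis
  proof cases
    case 1
    have "(\<integral>x. cos (blinfun_apply g x) \<partial>\<gamma>) = (\<integral>x. 1 \<partial>\<gamma>)"
      by (rule integral_cong_AE) (measurable, use 1 in \<open>auto elim!: eventually_mono\<close>)
    moreover have "laplace \<gamma> g = (\<integral>x. 1 \<partial>\<gamma>)"
      unfolding laplace_def by (rule integral_cong_AE) (measurable, use 1 in \<open>auto elim!: eventually_mono\<close>)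
    ultimately show thesis using 1 by (intro that[of 0]) (auto simp: prob_space)
  next
    case 2
    note \<sigma> = 2(1)
    have Z: "distributed \<gamma> lborel (\<lambda>x. blinfun_apply g x / \<sigma>) std_normal_density"
      using normal_standard_normal_convert[OF \<sigma>, of "blinfun_apply g" 0] 2(2) by simp
    have "(\<integral>x. cos (blinfun_apply g x) \<partial>\<gamma>) = (\<integral>x. cos (\<sigma> * (blinfun_apply g x / \<sigma>)) \<partial>\<gamma>)"
      using \<sigma> by simp
    also have "\<dots> = (\<integral>z. std_normal_density z * cos (\<sigma> * z) \<partial>lborel)"
      by (rule distributed_integral[OF Z, symmetric]) auto
    also have "\<dots> = (\<integral>z. cos (\<sigma> * z) \<partial>std_normal_distribution)"
      by (subst integral_density) auto
    also have "\<dots> = Re (char std_normal_distribution \<sigma>)"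
    proof -
      interpret N: real_distribution std_normal_distribution by (rule real_dist_normal_dist)
      have "integrable std_normal_distribution (\<lambda>z. iexp (\<sigma> * z))"
        by (intro N.integrable_const_bound[where B = 1]) auto
      then show ?thesis unfolding char_def by (subst integral_Re[symmetric]) (auto simp: Re_exp)
    qed
    also have "\<dots> = exp (- \<sigma>\<^sup>2 / 2)"
      by (simp add: char_std_normal_distribution)
    finally have cos: "(\<integral>x. cos (blinfun_apply g x) \<partial>\<gamma>) = exp (- \<sigma>\<^sup>2 / 2)" .
    have "laplace \<gamma> g = (\<integral>z. normal_density 0 \<sigma> z * exp z \<partial>lborel)"
      unfolding laplace_def by (rule distributed_integral[OF 2(2), symmetric]) auto
    also have "\<dots> = (\<integral>z. exp (\<sigma>\<^sup>2 / 2) * normal_density (\<sigma>\<^sup>2) \<sigma> z \<partial>lborel)"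
    proof (rule Bochner_Integration.integral_cong[OF refl])
      fix z
      have "- (z - 0)\<^sup>2 / (2 * \<sigma>\<^sup>2) + z = \<sigma>\<^sup>2 / 2 + - (z - \<sigma>\<^sup>2)\<^sup>2 / (2 * \<sigma>\<^sup>2)"
        using \<sigma> by (simp add: field_simps power2_eq_square)
      then show "normal_density 0 \<sigma> z * exp z = exp (\<sigma>\<^sup>2 / 2) * normal_density (\<sigma>\<^sup>2) \<sigma> z"
        unfolding normal_density_def by (simp add: exp_add[symmetric] mult.assoc mult.left_commute)
    qed
    also have "\<dots> = exp (\<sigma>\<^sup>2 / 2)" using \<sigma> by simp
    finally show thesis using cos \<sigma> by (intro that[of "\<sigma>\<^sup>2"]) auto
  qed
qed

text \<open>
  The limit \<open>\<gamma>\<close> has the covariance of the summands: both \<open>cos\<close>-transforms of a functional are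
  Gaussian, and they agree along the weakly convergent sequence.
\<close>

lemma laplace_weak_limit:
  fixes X :: "nat \<Rightarrow> 'w \<Rightarrow> 'a::{real_inner, banach, second_countable_topology}" and g :: "'a \<Rightarrow>\<^sub>L real"
  assumes P: "prob_space M" and ind: "prob_space.indep_vars M (\<lambda>_. borel) X UNIV"
    and id: "\<And>j. distr M borel (X j) = distr M borel (X 0)"
    and cube: "integrable M (\<lambda>\<omega>. norm (X 0 \<omega>) ^ 3)"
    and mean: "(\<integral>\<omega>. X 0 \<omega> \<partial>M) = 0"
    and gauss: "centered_gaussian \<gamma>"
    and conv: "weakly_converges (\<lambda>n. distr M borel (\<lambda>\<omega>. (1 / sqrt (real n)) *\<^sub>R (\<Sum>j=1..n. X j \<omega>))) \<gamma>"
  defines "v \<equiv> (\<integral>\<omega>. (blinfun_apply g (X 0 \<omega>))\<^sup>2 \<partial>M)"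
  shows "laplace \<gamma> g = exp (v / 2)" "v = 0 \<Longrightarrow> AE x in \<gamma>. blinfun_apply g x = 0"
proof -
  interpret prob_space M by fact
  have X[measurable]: "X j \<in> borel_measurable M" for j using ind by (simp add: indep_vars_def2)
  have g[measurable]: "blinfun_apply g \<in> borel_measurable borel"
    by (intro borel_measurable_continuous_onI continuous_intros)
  have same: "expectation (\<lambda>\<omega>. G (X j \<omega>)) = expectation (\<lambda>\<omega>. G (X 0 \<omega>))" if [measurable]: "G \<in> borel_measurable borel"
    for G :: "'a \<Rightarrow> 'c::{banach, second_countable_topology}" and j
    using arg_cong[OF id[of j], of "\<lambda>m. \<integral>x. G x \<partial>m"] by (simp add: integral_distr)
  have same_int: "integrable M (\<lambda>\<omega>. G (X j \<omega>))" if [measurable]: "G \<in> borel_measurable borel" and "integrable M (\<lambda>\<omega>. G (X 0 \<omega>))"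
    for G :: "'a \<Rightarrow> 'c::{banach, second_countable_topology}" and j
    using arg_cong[OF id[of j], of "\<lambda>m. integrable m G"] that(2) by (simp add: integrable_distr_eq)
  define K where "K = expectation (\<lambda>\<omega>. norm (X 0 \<omega>) ^ 3)"
  define K' where "K' = norm g ^ 3 * K"
  have summands: "centered_summands M (\<lambda>i \<omega>. blinfun_apply g (X i \<omega>)) {1..n} v K'" if "n \<ge> 1" for n
  proof -
    have "vector_summands M X {1..n} g v K"
    proof
      show "indep_vars (\<lambda>_. borel) X {1..n}" using ind by (rule indep_vars_subset) simp
      fix i
      show "integrable M (\<lambda>\<omega>. norm (X i \<omega>) ^ 3)" by (rule same_int[of "\<lambda>x. norm x ^ 3", OF _ cube]) measurable
      show "expectation (X i) = 0" using same[of "\<lambda>x. x" i] mean by simp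
      show "expectation (\<lambda>\<omega>. (blinfun_apply g (X i \<omega>))\<^sup>2) = v"
        unfolding v_def by (rule same[of "\<lambda>x. (blinfun_apply g x)\<^sup>2"]) measurable
      show "expectation (\<lambda>\<omega>. norm (X i \<omega>) ^ 3) \<le> K"
        unfolding K_def by (rule eq_refl[OF same[of "\<lambda>x. norm x ^ 3"]]) measurable
    qed (use that in auto)
    then show ?thesis unfolding K'_def by (rule vector_summands.real_summands) simp
  qed
  define S where "S n \<omega> = (\<Sum>i=1..n. blinfun_apply g (X i \<omega>))" for n \<omega>
  define a where "a n = (\<integral>x. cos (blinfun_apply g x) \<partial>distr M borel (\<lambda>\<omega>. (1 / sqrt (real n)) *\<^sub>R (\<Sum>j=1..n. X j \<omega>)))" for n
  have a_eq: "a n = Re (char (distr M borel (S n)) (1 / sqrt (real n)))" for n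
  proof -
    have [measurable]: "S n \<in> borel_measurable M" unfolding S_def by measurable
    have int: "integrable M (\<lambda>\<omega>. iexp ((1 / sqrt (real n)) * S n \<omega>))"
      by (rule integrable_const_bound[where B = 1]) auto
    have "a n = expectation (\<lambda>\<omega>. cos ((1 / sqrt (real n)) * S n \<omega>))"
      unfolding a_def by (subst integral_distr) (auto simp: blinfun.scaleR_right blinfun.sum_right S_def)
    also have "\<dots> = Re (CLINT \<omega>|M. iexp ((1 / sqrt (real n)) * S n \<omega>))"
      using int by (subst integral_Re[symmetric]) (auto simp: Re_exp)
    also have "(CLINT \<omega>|M. iexp ((1 / sqrt (real n)) * S n \<omega>)) = char (distr M borel (S n)) (1 / sqrt (real n))"
      unfolding char_def by (subst integral_distr) auto
    finally show ?thesis .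
  qed
  have a_bound: "\<bar>a n - exp (- v / 2)\<bar> \<le> (1 + K')\<^sup>2 * (1 / sqrt (real n))" if n: "n \<ge> 1" for n
  proof -
    interpret Y: centered_summands M "\<lambda>i \<omega>. blinfun_apply g (X i \<omega>)" "{1..n}" v K' by (rule summands[OF n])
    have "cmod (char (distr M borel (S n)) (1 / sqrt (real n)) - of_real (exp (- v * real (card {1..n}) * (1 / sqrt (real n))\<^sup>2 / 2)))
      \<le> real (card {1..n}) * ((1 + K')\<^sup>2 * \<bar>1 / sqrt (real n)\<bar> ^ 3)"
      unfolding S_def using n by (intro Y.sum_char_gaussian_approx) simp
    also have "real (card {1..n}) * ((1 + K')\<^sup>2 * \<bar>1 / sqrt (real n)\<bar> ^ 3) = (1 + K')\<^sup>2 * (1 / sqrt (real n))"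
      using n by (simp add: power3_eq_cube)
    also have "exp (- v * real (card {1..n}) * (1 / sqrt (real n))\<^sup>2 / 2) = exp (- v / 2)"
      using n by (simp add: power_divide)
    finally show ?thesis
      unfolding a_eq using abs_Re_le_cmod[of "char (distr M borel (S n)) (1 / sqrt (real n)) - of_real (exp (- v / 2))"]
      by simp
  qed
  have "(\<lambda>n. a n - exp (- v / 2)) \<longlonglongrightarrow> 0"
  proof (rule Lim_null_comparison)
    show "\<forall>\<^sub>F n in sequentially. norm (a n - exp (- v / 2)) \<le> (1 + K')\<^sup>2 * (1 / sqrt (real n))"
      using a_bound by (intro eventually_sequentiallyI[of 1]) simp
    have "(\<lambda>n. 1 / sqrt (real n)) \<longlonglongrightarrow> 0"
      using tendsto_inverse_0_at_top[OF filterlim_compose[OF sqrt_at_top filterlim_real_sequentially]] by (simp add: inverse_eq_divide)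
    then show "(\<lambda>n. (1 + K')\<^sup>2 * (1 / sqrt (real n))) \<longlonglongrightarrow> 0"
      by (rule tendsto_mult_right_zero)
  qed
  then have lim1: "a \<longlonglongrightarrow> exp (- v / 2)" by (simp add: LIM_zero_iff)
  have "bounded (range (\<lambda>x. cos (blinfun_apply g x)))"
    by (auto simp: bounded_iff intro!: exI[of _ 1])
  moreover have "continuous_on UNIV (\<lambda>x. cos (blinfun_apply g x))"
    by (intro continuous_intros)
  ultimately have lim2: "a \<longlonglongrightarrow> (\<integral>x. cos (blinfun_apply g x) \<partial>\<gamma>)"
    using conv unfolding weakly_converges_def a_def by blast
  obtain q where q: "(\<integral>x. cos (blinfun_apply g x) \<partial>\<gamma>) = exp (- q / 2)"
    "laplace \<gamma> g = exp (q / 2)" "q = 0 \<Longrightarrow> AE x in \<gamma>. blinfun_apply g x = 0"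
    using gaussian_functional[OF gauss, of g] by blast
  have "v = q" using LIMSEQ_unique[OF lim1 lim2] q(1) by simp
  then show "laplace \<gamma> g = exp (v / 2)" "v = 0 \<Longrightarrow> AE x in \<gamma>. blinfun_apply g x = 0"
    using q by auto
qed

text \<open>A functional that is null for \<open>\<gamma>\<close> kills every covariance image and,
  by continuity, their limits. This will exclude degenerate slicing functionals.\<close>

lemma generating_space_null:
  fixes \<gamma> :: "'a::{banach, second_countable_topology} measure" and f :: "'a \<Rightarrow>\<^sub>L real"
  assumes null: "AE x in \<gamma>. blinfun_apply f x = 0" and x: "x \<in> generating_space \<gamma>" and sets: "sets \<gamma> = sets borel"
  shows "blinfun_apply f x = 0"
proof -
  have [measurable_cong]: "sets \<gamma> = sets borel" by fact
  have meas[measurable]: "blinfun_apply g \<in> borel_measurable borel" for g :: "'a \<Rightarrow>\<^sub>L real"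
    by (intro borel_measurable_continuous_onI continuous_intros)
  have zero: "blinfun_apply f (cov_map \<gamma> F) = 0" for F
  proof (cases "integrable \<gamma> (\<lambda>x. blinfun_apply F x *\<^sub>R x)")
    case True
    have "blinfun_apply f (cov_map \<gamma> F) = (\<integral>x. blinfun_apply f (blinfun_apply F x *\<^sub>R x) \<partial>\<gamma>)"
      unfolding cov_map_def by (rule integral_bounded_linear[OF blinfun.bounded_linear_right True, symmetric])
    also have "\<dots> = (\<integral>x. 0 \<partial>\<gamma>)"
      using null by (intro integral_cong_AE) (auto simp: blinfun.scaleR_right elim!: eventually_mono)
    finally show ?thesis by simp
  next
    \<comment> \<open>If the Bochner integral does not exist, \<open>cov_map\<close> takes the
      default value 0, where \<open>f\<close> vanishes as well.\<close>
    case False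
    then show ?thesis by (simp add: cov_map_def not_integrable_integral_eq blinfun.zero_right)
  qed
  obtain F where "(\<lambda>n. cov_map \<gamma> (F n)) \<longlonglongrightarrow> x"
    using x unfolding generating_space_def by blast
  then have "(\<lambda>n. blinfun_apply f (cov_map \<gamma> (F n))) \<longlonglongrightarrow> blinfun_apply f x"
    by (intro tendsto_intros)
  then show ?thesis unfolding zero by (simp add: LIMSEQ_const_iff)
qed

text \<open>
  Equality in \<open>f z \<le> sqrt (V f) * sqrt (2 * rate z)\<close> pins down \<open>a\<close>: perturbing the functional
  that attains the supremum defining \<open>rate a\<close> in every direction shows \<open>a = \<integral> h x x d\<mu>\<close>.
\<close>

lemma dominating_point_representation:
  fixes \<mu> :: "'a::{real_inner, banach, second_countable_topology} measure" and f :: "'a \<Rightarrow>\<^sub>L real"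
  assumes sq: "integrable \<mu> (\<lambda>x. (norm x)\<^sup>2)" and sets: "sets \<mu> = sets borel"
  defines "V \<equiv> \<lambda>g :: 'a \<Rightarrow>\<^sub>L real. \<integral>x. (blinfun_apply g x)\<^sup>2 \<partial>\<mu>"
  assumes rate: "\<And>z. rate \<gamma> z = (SUP g. ereal (blinfun_apply g z - V g / 2))"
    and fin: "rate \<gamma> a < \<infinity>" and a: "a \<noteq> 0" and Vf: "V f \<noteq> 0"
    and sup: "(SUP z\<in>{z. rate \<gamma> z \<le> rate \<gamma> a}. ereal (blinfun_apply f z)) = ereal (blinfun_apply f a)"
  obtains l where "0 < l" "a = (\<integral>x. blinfun_apply (l *\<^sub>R f) x *\<^sub>R x \<partial>\<mu>)"
    "rate \<gamma> a = ereal (V (l *\<^sub>R f) / 2)" "0 < V (l *\<^sub>R f)"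
proof -
  have [measurable_cong]: "sets \<mu> = sets borel" by fact
  have meas[measurable]: "blinfun_apply g \<in> borel_measurable borel" for g :: "'a \<Rightarrow>\<^sub>L real"
    by (intro borel_measurable_continuous_onI continuous_intros)
  have bound: "\<bar>blinfun_apply g x\<bar> * norm x \<le> norm g * (norm x)\<^sup>2" for g :: "'a \<Rightarrow>\<^sub>L real" and x
    using mult_right_mono[OF norm_blinfun[of g x] norm_ge_zero[of x]] by (simp add: power2_eq_square mult.assoc)
  have int_vec: "integrable \<mu> (\<lambda>x. blinfun_apply g x *\<^sub>R x)" for g :: "'a \<Rightarrow>\<^sub>L real"
    by (rule Bochner_Integration.integrable_bound[OF integrable_mult_right[OF sq, of "norm g"]])
      (auto intro!: AE_I2 bound)
  have int_mix: "integrable \<mu> (\<lambda>x. blinfun_apply g x * blinfun_apply k x)" for g k :: "'a \<Rightarrow>\<^sub>L real"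
    using integrable_bounded_linear[OF blinfun.bounded_linear_right int_vec[of g], of k]
    by (simp add: blinfun.scaleR_right)
  define cov where "cov g k = (\<integral>x. blinfun_apply g x * blinfun_apply k x \<partial>\<mu>)" for g k :: "'a \<Rightarrow>\<^sub>L real"
  have cov_vec: "blinfun_apply k (\<integral>x. blinfun_apply g x *\<^sub>R x \<partial>\<mu>) = cov g k" for g k
    using integral_bounded_linear[OF blinfun.bounded_linear_right int_vec[of g], of k]
    by (simp add: blinfun.scaleR_right cov_def)
  have V_cov: "V g = cov g g" for g by (simp add: V_def cov_def power2_eq_square)
  have V_nonneg: "0 \<le> V g" for g by (simp add: V_def)
  have V_add: "V (l *\<^sub>R g + e *\<^sub>R k) = l\<^sup>2 * V g + 2 * l * e * cov g k + e\<^sup>2 * V k" for g k l e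
  proof -
    have "V (l *\<^sub>R g + e *\<^sub>R k) = (\<integral>x. l\<^sup>2 * (blinfun_apply g x * blinfun_apply g x) + 2 * l * e * (blinfun_apply g x * blinfun_apply k x) + e\<^sup>2 * (blinfun_apply k x * blinfun_apply k x) \<partial>\<mu>)"
      unfolding V_def by (simp add: blinfun.add_left blinfun.scaleR_left power2_eq_square algebra_simps)
    also have "\<dots> = l\<^sup>2 * cov g g + 2 * l * e * cov g k + e\<^sup>2 * cov k k"
      using int_mix by (simp add: cov_def)
    finally show ?thesis by (simp add: V_cov)
  qed
  have V_scale: "V (l *\<^sub>R g) = l\<^sup>2 * V g" for l g using V_add[of l g 0 g] by simp
  have ge: "ereal (blinfun_apply g z - V g / 2) \<le> rate \<gamma> z" for g z
    unfolding rate by (rule SUP_upper) simp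
  have "ereal 0 \<le> rate \<gamma> a" using ge[of 0 a] by (simp add: V_def)
  then obtain r where r: "rate \<gamma> a = ereal r" "0 \<le> r"
    using fin by (cases "rate \<gamma> a") auto
  have le_r: "blinfun_apply g z - V g / 2 \<le> r" if "rate \<gamma> z \<le> rate \<gamma> a" for g z
    using order_trans[OF ge[of g z] that] r by simp
  \<comment> \<open>Rate 0 would make the zero functional optimal at \<open>a\<close>, hence
    stationary in every direction; then all functionals, in particular \<open>inner a\<close>, would
    vanish at \<open>a\<close>.\<close>
  have "r \<noteq> 0"
  proof
    assume r0: "r = 0"
    have "blinfun_apply g a = 0" for g :: "'a \<Rightarrow>\<^sub>L real"
    proof (rule linear_quadratic_nonpos_imp_zero[where c = "V g / 2"])
      fix e show "e * blinfun_apply g a - e\<^sup>2 * (V g / 2) \<le> 0"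
        using le_r[of a "e *\<^sub>R g"] r0 by (simp add: V_scale blinfun.scaleR_left)
    qed
    from this[of "blinfun_inner_right a"] have "inner a a = 0" by simp
    then show False using a by simp
  qed
  then have r0: "0 < r" using r by simp
  define w where "w = V f"
  have w: "0 < w" using Vf V_nonneg[of f] by (simp add: w_def)
  \<comment> \<open>The best multiple of \<open>f\<close> in the supremum is \<open>f a / w\<close>;
    inserting it gives a Cauchy-Schwarz inequality.\<close>
  have sq_le: "(blinfun_apply f a)\<^sup>2 \<le> 2 * r * w"
  proof -
    have "(blinfun_apply f a / w) * blinfun_apply f a - (blinfun_apply f a / w)\<^sup>2 * w / 2 \<le> r"
      using le_r[of a "(blinfun_apply f a / w) *\<^sub>R f"] by (simp add: V_scale blinfun.scaleR_left w_def)
    moreover have "(blinfun_apply f a / w) * blinfun_apply f a - (blinfun_apply f a / w)\<^sup>2 * w / 2 = (blinfun_apply f a)\<^sup>2 / (2 * w)"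
      using w by (simp add: power2_eq_square field_simps)
    ultimately have "(blinfun_apply f a)\<^sup>2 / (2 * w) \<le> r" by (simp only:)
    then show ?thesis using w by (simp add: pos_divide_le_eq mult_ac)
  qed
  \<comment> \<open>Normalised so that the covariance image \<open>z\<close> of \<open>l * f\<close>
    has rate at most \<open>l^2 * w / 2 = r\<close>. Then \<open>z\<close> competes in the supremum
    over the level set, which forces equality in the previous inequality.\<close>
  define l where "l = sqrt (2 * r / w)"
  have l: "0 < l" "l\<^sup>2 = 2 * r / w" using r0 w by (auto simp: l_def)
  define z where "z = (\<integral>x. blinfun_apply (l *\<^sub>R f) x *\<^sub>R x \<partial>\<mu>)"
  have gz: "blinfun_apply g z = l * cov f g" for g
  proof -
    have "blinfun_apply g z = cov (l *\<^sub>R f) g" unfolding z_def by (rule cov_vec)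
    also have "\<dots> = l * cov f g"
      unfolding cov_def by (simp add: blinfun.scaleR_left mult.assoc)
    finally show ?thesis .
  qed
  have "rate \<gamma> z \<le> rate \<gamma> a"
    unfolding rate[of z] r
  proof (rule SUP_least)
    fix g
    have "0 \<le> V (l *\<^sub>R f + (-1) *\<^sub>R g)" by (rule V_nonneg)
    also have "\<dots> = l\<^sup>2 * w - 2 * (l * cov f g) + V g" unfolding V_add w_def by simp
    finally have "l * cov f g - V g / 2 \<le> l\<^sup>2 * w / 2" by simp
    also have "\<dots> = r" using l w by simp
    finally show "ereal (blinfun_apply g z - V g / 2) \<le> ereal r" by (simp add: gz)
  qed
  then have "ereal (blinfun_apply f z) \<le> ereal (blinfun_apply f a)"
    unfolding sup[symmetric] by (intro SUP_upper) simp
  then have fa_ge: "l * w \<le> blinfun_apply f a" by (simp add: gz V_cov[symmetric] w_def)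
  have "(l * w)\<^sup>2 = l\<^sup>2 * w * w" by (simp add: power2_eq_square)
  then have "(l * w)\<^sup>2 = 2 * r * w" using l w by simp
  then have "(blinfun_apply f a)\<^sup>2 \<le> (l * w)\<^sup>2" using sq_le by simp
  then have "blinfun_apply f a \<le> l * w"
    using l w by (simp add: abs_le_square_iff[symmetric])
  with fa_ge have fa: "blinfun_apply f a = l * w" by simp
  have Vl: "V (l *\<^sub>R f) = 2 * r" using l w by (simp add: V_scale w_def)
  \<comment> \<open>By that equality \<open>l * f\<close> attains the supremum defining
    \<open>rate a\<close>, so the term linear in \<open>e\<close> of the perturbation
    \<open>l * f + e * g\<close> must vanish.\<close>
  have ga: "blinfun_apply g a = blinfun_apply g z" for g :: "'a \<Rightarrow>\<^sub>L real"
  proof -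
    have "blinfun_apply g a - l * cov f g = 0"
    proof (rule linear_quadratic_nonpos_imp_zero[where c = "V g / 2"])
      fix e
      have "l * (l * w) + e * blinfun_apply g a - (l\<^sup>2 * w + 2 * l * e * cov f g + e\<^sup>2 * V g) / 2 \<le> r"
        using le_r[of a "l *\<^sub>R f + e *\<^sub>R g"] by (simp add: V_add blinfun.add_left blinfun.scaleR_left fa w_def)
      moreover have l2w: "l\<^sup>2 * w = 2 * r"
        using l w by simp
      moreover have "l * (l * w) = 2 * r"
        using l2w by (simp only: power2_eq_square mult.assoc)
      ultimately show "e * (blinfun_apply g a - l * cov f g) - e\<^sup>2 * (V g / 2) \<le> 0"
        by (simp add: algebra_simps add_divide_distrib)
    qed
    then show ?thesis by (simp add: gz)
  qed
  have "a = z"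
  proof -
    have "blinfun_apply (blinfun_inner_right (a - z)) (a - z) = 0"
      by (simp only: blinfun.diff_right ga diff_self)
    then show ?thesis by simp
  qed
  then show thesis using l Vl r r0 by (intro that[of l]) (auto simp: z_def)
qed

theorem theorem3:
  fixes M :: "'w measure"
    and X :: "nat \<Rightarrow> 'w \<Rightarrow> 'a::{real_inner, banach, second_countable_topology}"
    and \<gamma> :: "'a measure"
    and b :: "nat \<Rightarrow> real"
    and D :: "'a set"
    and a0 :: 'a
    and \<beta> :: real
  assumes "prob_space M"
    and "prob_space.indep_vars M (\<lambda>_. borel) X UNIV"
    and "\<And>j. distr M borel (X j) = distr M borel (X 0)"
    and "integrable M (X 0)"
    and "(\<integral>\<omega>. X 0 \<omega> \<partial>M) = 0"
    and "\<And>f :: 'a \<Rightarrow>\<^sub>L real. \<exists>tf>0. \<forall>t. 0 < \<bar>t\<bar> \<and> \<bar>t\<bar> < tf \<longrightarrow>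
           integrable M (\<lambda>\<omega>. norm (X 0 \<omega>) ^ 3 * exp (t * \<bar>blinfun_apply f (X 0 \<omega>)\<bar>))"
    and "centered_gaussian \<gamma>"
    and "weakly_converges
           (\<lambda>n. distr M borel (\<lambda>\<omega>. (1 / sqrt (real n)) *\<^sub>R (\<Sum>j=1..n. X j \<omega>))) \<gamma>"
    and "\<And>n. n \<ge> 1 \<Longrightarrow> b n > 0"
    and "filterlim (\<lambda>n. b n / sqrt (real n)) at_top sequentially"
    and "(\<lambda>n. b n / real n powr (2 / 3)) \<longlonglongrightarrow> 0"
    and "open D"
    and "convex D"
    and "D \<inter> generating_space \<gamma> \<noteq> {}"
    and "0 \<notin> closure D"
    and "dominating_point \<gamma> D a0"
    and "\<beta> > 0"
    and "slices_dominate \<gamma> D a0 (\<lambda>s. \<beta> * sqrt s)"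
  shows "liminf (\<lambda>n. ereal (b n / sqrt (real n)
             * measure M {\<omega> \<in> space M. (1 / b n) *\<^sub>R (\<Sum>j=1..n. X j \<omega>) \<in> D}
             * exp ((b n)\<^sup>2 / real n * real_of_ereal (rate \<gamma> a0)))) > 0"
proof -
  interpret prob_space M by fact
  note ind = assms(2) and id = assms(3) and mgf = assms(6) and gauss = assms(7)
  have X[measurable]: "X j \<in> borel_measurable M" for j using ind by (simp add: indep_vars_def2)
  have meas[measurable]: "blinfun_apply g \<in> borel_measurable borel" for g :: "'a \<Rightarrow>\<^sub>L real"
    by (intro borel_measurable_continuous_onI continuous_intros)
  \<comment> \<open>The zero functional turns the exponential moment condition into a plain third
    moment.\<close>
  have cube: "integrable M (\<lambda>\<omega>. norm (X 0 \<omega>) ^ 3)"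
  proof -
    obtain tf where tf: "tf > 0" "\<And>t. 0 < \<bar>t\<bar> \<and> \<bar>t\<bar> < tf \<Longrightarrow>
        integrable M (\<lambda>\<omega>. norm (X 0 \<omega>) ^ 3 * exp (t * \<bar>blinfun_apply (0 :: 'a \<Rightarrow>\<^sub>L real) (X 0 \<omega>)\<bar>))"
      using mgf[of 0] by blast
    show ?thesis using tf(1) tf(2)[of "tf / 2"] by simp
  qed
  define \<mu> where "\<mu> = distr M borel (X 0)"
  have sets_\<mu>: "sets \<mu> = sets borel" by (simp add: \<mu>_def)
  interpret \<mu>: prob_space \<mu> unfolding \<mu>_def by (rule prob_space_distr) simp
  have sq: "integrable \<mu> (\<lambda>x. (norm x)\<^sup>2)"
  proof -
    have "integrable M (\<lambda>\<omega>. (norm (X 0 \<omega>))\<^sup>2)"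
    proof (rule Bochner_Integration.integrable_bound)
      show "integrable M (\<lambda>\<omega>. 1 + norm (X 0 \<omega>) ^ 3)" using cube by simp
    qed (auto intro!: AE_I2 order_trans[OF square_le_one_plus_cube])
    then show ?thesis unfolding \<mu>_def by (simp add: integrable_distr_eq)
  qed
  have V_eq: "(\<integral>\<omega>. (blinfun_apply g (X 0 \<omega>))\<^sup>2 \<partial>M) = (\<integral>x. (blinfun_apply g x)\<^sup>2 \<partial>\<mu>)" for g :: "'a \<Rightarrow>\<^sub>L real"
    unfolding \<mu>_def by (simp add: integral_distr)
  note limit = laplace_weak_limit[OF assms(1) ind id cube assms(5) gauss assms(8), unfolded V_eq]
  have rate: "rate \<gamma> z = (SUP g. ereal (blinfun_apply g z - (\<integral>x. (blinfun_apply g x)\<^sup>2 \<partial>\<mu>) / 2))" for z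
    unfolding rate_def limit(1) by simp
  have a0: "a0 \<in> closure D" "rate \<gamma> a0 < \<infinity>"
    using assms(16) by (auto simp: dominating_point_def frontier_def)
  have "a0 \<noteq> 0" using a0(1) assms(15) by blast
  obtain f x0 \<delta> where sup: "(SUP z\<in>{z. rate \<gamma> z \<le> rate \<gamma> a0}. ereal (blinfun_apply f z)) = ereal (blinfun_apply f a0)"
    and f_D: "\<forall>x\<in>D. blinfun_apply f a0 < blinfun_apply f x"
    and \<delta>: "\<delta> > 0" and x0: "blinfun_apply f x0 > 0"
    and slices: "{y + s *\<^sub>R x0 | y s. blinfun_apply f y = 0 \<and> norm y \<le> \<beta> * sqrt s \<and> 0 < s \<and> s \<le> \<delta>} \<subseteq> (\<lambda>d. d - a0) ` D"
    using assms(18) unfolding slices_dominate_def by (elim exE conjE) (rule that; blast)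
  \<comment> \<open>If \<open>f\<close> were degenerate, finiteness of the rate would force
    \<open>f a0 = 0\<close>, since all multiples of \<open>f\<close> enter the supremum without
    penalty. But \<open>f\<close> also vanishes at a point of \<open>D\<close> in the generating
    space, contrary to \<open>f a0 < f z\<close> on \<open>D\<close>.\<close>
  have Vf: "(\<integral>x. (blinfun_apply f x)\<^sup>2 \<partial>\<mu>) \<noteq> 0"
  proof
    assume V0: "(\<integral>x. (blinfun_apply f x)\<^sup>2 \<partial>\<mu>) = 0"
    obtain z where z: "z \<in> D" "z \<in> generating_space \<gamma>" using assms(14) by blast
    have "blinfun_apply f z = 0"
      using generating_space_null[OF limit(2)[OF V0] z(2)] gauss by (simp add: centered_gaussian_def)
    moreover have "blinfun_apply f a0 = 0"
    proof (rule ccontr)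
      assume nz: "blinfun_apply f a0 \<noteq> 0"
      have le: "ereal (t * blinfun_apply f a0) \<le> rate \<gamma> a0" for t
        unfolding rate using V0
        by (intro SUP_upper2[of "t *\<^sub>R f"]) (auto simp: blinfun.scaleR_left power_mult_distrib)
      have "0 \<le> rate \<gamma> a0" using le[of 0] by (simp only: mult_zero_left zero_ereal_def)
      then obtain r where "rate \<gamma> a0 = ereal r" using a0(2) by (cases "rate \<gamma> a0") auto
      then show False using le[of "(r + 1) / blinfun_apply f a0"] nz by simp
    qed
    ultimately show False using bspec[OF f_D z(1)] by simp
  qed
  obtain l where l: "0 < l" "a0 = (\<integral>x. blinfun_apply (l *\<^sub>R f) x *\<^sub>R x \<partial>\<mu>)"
    and rate_a0: "rate \<gamma> a0 = ereal ((\<integral>x. (blinfun_apply (l *\<^sub>R f) x)\<^sup>2 \<partial>\<mu>) / 2)"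
    and Vl: "0 < (\<integral>x. (blinfun_apply (l *\<^sub>R f) x)\<^sup>2 \<partial>\<mu>)"
    using dominating_point_representation[OF sq sets_\<mu> rate a0(2) \<open>a0 \<noteq> 0\<close> Vf sup] by blast
  define h where "h = l *\<^sub>R f"
  obtain tf where tf: "tf > 0" "\<And>t. 0 < \<bar>t\<bar> \<and> \<bar>t\<bar> < tf \<Longrightarrow>
      integrable M (\<lambda>\<omega>. norm (X 0 \<omega>) ^ 3 * exp (t * \<bar>blinfun_apply h (X 0 \<omega>)\<bar>))"
    using mgf[of h] by blast
  interpret T: tilting \<mu> h "tf / 2"
  proof
    show "sets \<mu> = sets borel" by (rule sets_\<mu>)
    show "0 < tf / 2" using tf(1) by simp
    show "integrable \<mu> (\<lambda>x. norm x ^ 3 * exp (tf / 2 * \<bar>blinfun_apply h x\<bar>))"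
      unfolding \<mu>_def using tf(1) tf(2)[of "tf / 2"] by (subst integrable_distr_eq) auto
    show "(\<integral>x. x \<partial>\<mu>) = 0"
      unfolding \<mu>_def using assms(5) by (subst integral_distr) auto
  qed
  have Ta0: "T.a0 = a0" unfolding T.a0_def by (rule l(2)[folded h_def, symmetric])
  have Tr: "real_of_ereal (rate \<gamma> a0) = T.r" unfolding T.r_def rate_a0[folded h_def] by simp
  have r: "0 < T.r" unfolding T.r_def using Vl[folded h_def] by simp
  have hx0: "0 < blinfun_apply h x0" using l(1) x0 by (simp add: h_def blinfun.scaleR_left)
  have in_D: "T.a0 + (y + s *\<^sub>R x0) \<in> D"
    if "blinfun_apply h y = 0" "norm y \<le> \<beta> * sqrt s" "0 < s" "s \<le> \<delta>" for y s
  proof -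
    have "blinfun_apply f y = 0" using that(1) l(1) by (simp add: h_def blinfun.scaleR_left)
    then have "y + s *\<^sub>R x0 \<in> (\<lambda>d. d - a0) ` D" using slices that by blast
    then show ?thesis by (auto simp: Ta0)
  qed
  obtain c where c: "c > 0" "\<forall>\<^sub>F n in sequentially. c \<le> b n / sqrt (real n)
    * measure (PiM {1..n} (\<lambda>_. \<mu>)) {x \<in> space (PiM {1..n} (\<lambda>_. \<mu>)). (1 / b n) *\<^sub>R (\<Sum>i=1..n. x i) \<in> D}
    * exp ((b n)\<^sup>2 / real n * T.r)"
    using T.moderate_deviation_lower[OF r assms(9,10,11) hx0 \<delta> assms(17,12) in_D] by blast
  \<comment> \<open>The sums start at index 1, while \<open>X 0\<close> only represents the common
    law \<open>\<mu>\<close>. For \<open>n >= 1\<close> the index set is nonempty, and independence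
    identifies the joint law of the summands with the product of copies of
    \<open>\<mu>\<close>.\<close>
  have law: "measure (PiM {1..n} (\<lambda>_. \<mu>)) {x \<in> space (PiM {1..n} (\<lambda>_. \<mu>)). (1 / b n) *\<^sub>R (\<Sum>i=1..n. x i) \<in> D}
    = measure M {\<omega> \<in> space M. (1 / b n) *\<^sub>R (\<Sum>j=1..n. X j \<omega>) \<in> D}" if n: "n \<ge> 1" for n
  proof -
    have [measurable]: "D \<in> sets borel" using assms(12) by simp
    have ne: "{1..n} \<noteq> {}" using n by auto
    have "distr M (PiM {1..n} (\<lambda>_. borel)) (\<lambda>\<omega>. \<lambda>i\<in>{1..n}. X i \<omega>) = PiM {1..n} (\<lambda>i. distr M borel (X i))"
      using indep_vars_subset[OF ind subset_UNIV] by (subst indep_vars_iff_distr_eq_PiM'[OF ne, symmetric]) (rule X)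
    also have "\<dots> = PiM {1..n} (\<lambda>_. \<mu>)" unfolding \<mu>_def using id by (intro PiM_cong) auto
    finally have eq: "PiM {1..n} (\<lambda>_. \<mu>) = distr M (PiM {1..n} (\<lambda>_. borel)) (\<lambda>\<omega>. \<lambda>i\<in>{1..n}. X i \<omega>)" by simp
    show ?thesis
      unfolding eq by (subst measure_distr) (auto simp: space_PiM intro!: arg_cong[where f = prob])
  qed
  have "\<forall>\<^sub>F n in sequentially. ereal c \<le> ereal (b n / sqrt (real n)
             * measure M {\<omega> \<in> space M. (1 / b n) *\<^sub>R (\<Sum>j=1..n. X j \<omega>) \<in> D}
             * exp ((b n)\<^sup>2 / real n * real_of_ereal (rate \<gamma> a0)))"
    using c(2) eventually_ge_at_top[of 1]
  proof eventually_elim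
    case (elim n)
    then show ?case unfolding Tr law[OF elim(2), symmetric] by simp
  qed
  then have "ereal c \<le> liminf (\<lambda>n. ereal (b n / sqrt (real n)
             * measure M {\<omega> \<in> space M. (1 / b n) *\<^sub>R (\<Sum>j=1..n. X j \<omega>) \<in> D}
             * exp ((b n)\<^sup>2 / real n * real_of_ereal (rate \<gamma> a0))))"
    by (rule Liminf_bounded)
  then show ?thesis using c(1) by (meson ereal_less(2) less_le_trans)
qed

end
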